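(* Let $\mathscr E$ and $\mathscr B$ be small categories and $u:\mathscr E\to\mathscr B$ a functor. Let $\mathscr A$ be a complete abelian category with exact products. Given a functor $T:\Delta/\mathscr E\to\mathscr A$, there is a first quadrant cohomology spectral sequence $$E_2^{p,q}\cong H^p_{Th}(\mathscr B,(R^q\Delta/u_* )(T))\Rightarrow H^{p+q}_{Th}(\mathscr E,T)$$ which is functorial with respect to natural transformations, where $R^q\Delta/u_*=Ran^q_{\Delta/u}$ is the $q$-th right satellite of $Ran_{\Delta/u}$, the right Kan extension along the induced functor $\Delta/u:\Delta/\mathscr E\to\Delta/\mathscr B$ between the simplex categories.
   Context: Simplex category: for a small category $\mathscr C$, $\Delta/\mathscr C$ has as objects the pairs $([n],f)$ with $n\ge 0$, $[n]=\{0<1<\dots<n\}$ regarded as a category, and $f:[n]\to\mathscr C$ a functor; morphisms $([n],f)\to([m],g)$ are the order preserving maps $\sigma:[n]\to[m]$ with $f=g\circ\sigma$. A functor $u:\mathscr E\to\mathscr B$ induces $\Delta/u:\Delta/\mathscr E\to\Delta/\mathscr B$, $([n],f)\mapsto([n],u\circ f)$. Thomason cohomology: for a functor $T:\Delta/\mathscr C\to\mathscr A$ (a Thomason natural system), $H^n_{Th}(\mathscr C,T)$ is the $n$-th cohomology of the complex $C^n_{Th}(\mathscr C,T)=\prod_{f:[n]\to\mathscr C}T(f)$, $n\ge 0$, with $d=\sum_{i=0}^{n+1}(-1)^id_i$, where the component of $d_i$ at $g:[n+1]\to\mathscr C$ is the projection to $T(g\circ\delta^i)$ followed by the induced morphism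 $T(g\circ\delta^i)\to T(g)$, $\delta^i:[n]\to[n+1]$ being the injection omitting $i$. $Ran_{\Delta/u}:\mathrm{Fun}(\Delta/\mathscr E,\mathscr A)\to\mathrm{Fun}(\Delta/\mathscr B,\mathscr A)$ is the right adjoint of pre-composition with $\Delta/u$; its right satellites are its right derived functors. *)

theory Defs
  imports "HOL-Algebra.FiniteProduct"
begin

section \<open>Categories, functors, natural transformations\<close>

text \<open>\<open>g \<cdot>\<^bsub>C\<^esub> f\<close> is "\<open>g\<close> after \<open>f\<close>". Arrows know their domain and codomain.\<close>

record ('o, 'm) cat =
  Ob :: "'o set"
  Ar :: "'m set"
  Dom :: "'m \<Rightarrow> 'o"
  Cod :: "'m \<Rightarrow> 'o"
  Id :: "'o \<Rightarrow> 'm"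
  Comp :: "'m \<Rightarrow> 'm \<Rightarrow> 'm"  (infixl "\<cdot>\<index>" 70)

definition Hom :: "('o, 'm, 'z) cat_scheme \<Rightarrow> 'o \<Rightarrow> 'o \<Rightarrow> 'm set" where
  "Hom C a b = {f \<in> Ar C. Dom C f = a \<and> Cod C f = b}"

locale category =
  fixes C :: "('o, 'm, 'z) cat_scheme" (structure)
  assumes Dom_Ob: "f \<in> Ar C \<Longrightarrow> Dom C f \<in> Ob C"
    and Cod_Ob: "f \<in> Ar C \<Longrightarrow> Cod C f \<in> Ob C"
    and Id_Hom: "a \<in> Ob C \<Longrightarrow> Id C a \<in> Hom C a a"
    and Comp_Hom: "f \<in> Hom C a b \<Longrightarrow> g \<in> Hom C b c \<Longrightarrow> g \<cdot> f \<in> Hom C a c"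
    and Comp_assoc:
      "f \<in> Hom C a b \<Longrightarrow> g \<in> Hom C b c \<Longrightarrow> h \<in> Hom C c d \<Longrightarrow> h \<cdot> (g \<cdot> f) = h \<cdot> g \<cdot> f"
    and Id_left: "f \<in> Hom C a b \<Longrightarrow> Id C b \<cdot> f = f"
    and Id_right: "f \<in> Hom C a b \<Longrightarrow> f \<cdot> Id C a = f"

definition is_iso :: "('o, 'm, 'z) cat_scheme \<Rightarrow> 'm \<Rightarrow> bool" where
  "is_iso C f \<longleftrightarrow> f \<in> Ar C \<and>
    (\<exists>g \<in> Hom C (Cod C f) (Dom C f). g \<cdot>\<^bsub>C\<^esub> f = Id C (Dom C f) \<and> f \<cdot>\<^bsub>C\<^esub> g = Id C (Cod C f))"

definition monic :: "('o, 'm, 'z) cat_scheme \<Rightarrow> 'm \<Rightarrow> bool" where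
  "monic C f \<longleftrightarrow> f \<in> Ar C \<and>
    (\<forall>a. \<forall>g \<in> Hom C a (Dom C f). \<forall>h \<in> Hom C a (Dom C f). f \<cdot>\<^bsub>C\<^esub> g = f \<cdot>\<^bsub>C\<^esub> h \<longrightarrow> g = h)"

definition epic :: "('o, 'm, 'z) cat_scheme \<Rightarrow> 'm \<Rightarrow> bool" where
  "epic C f \<longleftrightarrow> f \<in> Ar C \<and>
    (\<forall>b. \<forall>g \<in> Hom C (Cod C f) b. \<forall>h \<in> Hom C (Cod C f) b. g \<cdot>\<^bsub>C\<^esub> f = h \<cdot>\<^bsub>C\<^esub> f \<longrightarrow> g = h)"

text \<open>
  Functors and natural transformations are required to be \<open>undefined\<close> off their source category,
  so that equality in HOL is equality of functors and of natural transformations.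
\<close>

record ('o, 'm, 'p, 'n) functor_data =
  FO :: "'o \<Rightarrow> 'p"
  FM :: "'m \<Rightarrow> 'n"

definition is_functor ::
  "('o, 'm, 'y) cat_scheme \<Rightarrow> ('p, 'n, 'z) cat_scheme \<Rightarrow> ('o, 'm, 'p, 'n) functor_data \<Rightarrow> bool" where
  "is_functor C D F \<longleftrightarrow>
    FO F \<in> Ob C \<rightarrow>\<^sub>E Ob D \<and> FM F \<in> Ar C \<rightarrow>\<^sub>E Ar D \<and>
    (\<forall>f \<in> Ar C. Dom D (FM F f) = FO F (Dom C f) \<and> Cod D (FM F f) = FO F (Cod C f)) \<and>
    (\<forall>a \<in> Ob C. FM F (Id C a) = Id D (FO F a)) \<and>
    (\<forall>f \<in> Ar C. \<forall>g \<in> Ar C. Cod C f = Dom C g \<longrightarrow> FM F (g \<cdot>\<^bsub>C\<^esub> f) = FM F g \<cdot>\<^bsub>D\<^esub> FM F f)"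

text \<open>\<open>fcomp C G F\<close> is \<open>G \<circ> F\<close>, where \<open>C\<close> is the source of \<open>F\<close>.\<close>

definition fcomp ::
  "('o, 'm, 'z) cat_scheme \<Rightarrow> ('p, 'n, 'q, 'k) functor_data \<Rightarrow> ('o, 'm, 'p, 'n) functor_data
    \<Rightarrow> ('o, 'm, 'q, 'k) functor_data" where
  "fcomp C G F = \<lparr>FO = (\<lambda>a \<in> Ob C. FO G (FO F a)), FM = (\<lambda>f \<in> Ar C. FM G (FM F f))\<rparr>"

record ('o, 'm, 'p, 'n) nt_data =
  NDom :: "('o, 'm, 'p, 'n) functor_data"
  NCod :: "('o, 'm, 'p, 'n) functor_data"
  NC :: "'o \<Rightarrow> 'n"

definition nat_trans ::
  "('o, 'm, 'y) cat_scheme \<Rightarrow> ('p, 'n, 'z) cat_scheme \<Rightarrow> ('o, 'm, 'p, 'n) functor_data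
    \<Rightarrow> ('o, 'm, 'p, 'n) functor_data \<Rightarrow> ('o, 'm, 'p, 'n) nt_data \<Rightarrow> bool" where
  "nat_trans C D F G t \<longleftrightarrow>
    is_functor C D F \<and> is_functor C D G \<and> NDom t = F \<and> NCod t = G \<and>
    NC t \<in> extensional (Ob C) \<and>
    (\<forall>a \<in> Ob C. NC t a \<in> Hom D (FO F a) (FO G a)) \<and>
    (\<forall>f \<in> Ar C. NC t (Cod C f) \<cdot>\<^bsub>D\<^esub> FM F f = FM G f \<cdot>\<^bsub>D\<^esub> NC t (Dom C f))"

definition naturally_isomorphic ::
  "('o, 'm, 'y) cat_scheme \<Rightarrow> ('p, 'n, 'z) cat_scheme \<Rightarrow> ('o, 'm, 'p, 'n) functor_data
    \<Rightarrow> ('o, 'm, 'p, 'n) functor_data \<Rightarrow> bool" where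
  "naturally_isomorphic C D F G \<longleftrightarrow>
    (\<exists>t. nat_trans C D F G t \<and> (\<forall>a \<in> Ob C. is_iso D (NC t a)))"

definition is_right_adjoint ::
  "('o, 'm, 'y) cat_scheme \<Rightarrow> ('p, 'n, 'z) cat_scheme \<Rightarrow> ('o, 'm, 'p, 'n) functor_data
    \<Rightarrow> ('p, 'n, 'o, 'm) functor_data \<Rightarrow> bool" where
  "is_right_adjoint X Y F G \<longleftrightarrow>
    is_functor X Y F \<and> is_functor Y X G \<and>
    (\<exists>\<phi>.
      (\<forall>x \<in> Ob X. \<forall>y \<in> Ob Y. bij_betw (\<phi> x y) (Hom Y (FO F x) y) (Hom X x (FO G y))) \<and>
      (\<forall>a \<in> Ar X. \<forall>b \<in> Ar Y. \<forall>h \<in> Hom Y (FO F (Cod X a)) (Dom Y b).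
        \<phi> (Dom X a) (Cod Y b) (b \<cdot>\<^bsub>Y\<^esub> h \<cdot>\<^bsub>Y\<^esub> FM F a)
          = FM G b \<cdot>\<^bsub>X\<^esub> \<phi> (Cod X a) (Dom Y b) h \<cdot>\<^bsub>X\<^esub> a))"


section \<open>Limits and products\<close>

definition is_cone ::
  "('o, 'm, 'z) cat_scheme \<Rightarrow> ('i, 'j, 'y) cat_scheme \<Rightarrow> ('i, 'j, 'o, 'm) functor_data
    \<Rightarrow> 'o \<Rightarrow> ('i \<Rightarrow> 'm) \<Rightarrow> bool" where
  "is_cone A J D L \<pi> \<longleftrightarrow>
    L \<in> Ob A \<and> (\<forall>x \<in> Ob J. \<pi> x \<in> Hom A L (FO D x)) \<and>
    (\<forall>j \<in> Ar J. FM D j \<cdot>\<^bsub>A\<^esub> \<pi> (Dom J j) = \<pi> (Cod J j))"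

definition is_limit ::
  "('o, 'm, 'z) cat_scheme \<Rightarrow> ('i, 'j, 'y) cat_scheme \<Rightarrow> ('i, 'j, 'o, 'm) functor_data
    \<Rightarrow> 'o \<Rightarrow> ('i \<Rightarrow> 'm) \<Rightarrow> bool" where
  "is_limit A J D L \<pi> \<longleftrightarrow>
    is_cone A J D L \<pi> \<and>
    (\<forall>Q \<rho>. is_cone A J D Q \<rho> \<longrightarrow> (\<exists>!h. h \<in> Hom A Q L \<and> (\<forall>x \<in> Ob J. \<pi> x \<cdot>\<^bsub>A\<^esub> h = \<rho> x)))"

text \<open>
  Smallness is relative to a type \<open>'u\<close> playing the role of the universe: a small category is one
  whose objects and arrows form subsets of \<open>'u\<close>, a small set is a subset of \<open>'u\<close>.
\<close>

definition complete_category :: "'u itself \<Rightarrow> ('o, 'm, 'z) cat_scheme \<Rightarrow> bool" where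
  "complete_category U A \<longleftrightarrow>
    (\<forall>(J :: ('u, 'u) cat) D. category J \<and> is_functor J A D \<longrightarrow> (\<exists>L \<pi>. is_limit A J D L \<pi>))"

definition is_product ::
  "('o, 'm, 'z) cat_scheme \<Rightarrow> 'i set \<Rightarrow> ('i \<Rightarrow> 'o) \<Rightarrow> 'o \<Rightarrow> ('i \<Rightarrow> 'm) \<Rightarrow> bool" where
  "is_product A I X P \<pi> \<longleftrightarrow>
    P \<in> Ob A \<and> (\<forall>i \<in> I. \<pi> i \<in> Hom A P (X i)) \<and>
    (\<forall>Q \<rho>. Q \<in> Ob A \<and> (\<forall>i \<in> I. \<rho> i \<in> Hom A Q (X i)) \<longrightarrow>
      (\<exists>!h. h \<in> Hom A Q P \<and> (\<forall>i \<in> I. \<pi> i \<cdot>\<^bsub>A\<^esub> h = \<rho> i)))"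

text \<open>An arbitrary but fixed choice of product; meaningful when a product exists.\<close>

definition prod_cone ::
  "('o, 'm, 'z) cat_scheme \<Rightarrow> 'i set \<Rightarrow> ('i \<Rightarrow> 'o) \<Rightarrow> 'o \<times> ('i \<Rightarrow> 'm)" where
  "prod_cone A I X = (SOME c. is_product A I X (fst c) (snd c))"

definition prod_ob :: "('o, 'm, 'z) cat_scheme \<Rightarrow> 'i set \<Rightarrow> ('i \<Rightarrow> 'o) \<Rightarrow> 'o" where
  "prod_ob A I X = fst (prod_cone A I X)"

definition prod_proj :: "('o, 'm, 'z) cat_scheme \<Rightarrow> 'i set \<Rightarrow> ('i \<Rightarrow> 'o) \<Rightarrow> 'i \<Rightarrow> 'm" where
  "prod_proj A I X = snd (prod_cone A I X)"

definition prod_tuple ::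
  "('o, 'm, 'z) cat_scheme \<Rightarrow> 'i set \<Rightarrow> ('i \<Rightarrow> 'o) \<Rightarrow> 'o \<Rightarrow> ('i \<Rightarrow> 'm) \<Rightarrow> 'm" where
  "prod_tuple A I X Q \<rho> =
    (THE h. h \<in> Hom A Q (prod_ob A I X) \<and> (\<forall>i \<in> I. prod_proj A I X i \<cdot>\<^bsub>A\<^esub> h = \<rho> i))"


section \<open>Abelian categories\<close>

record ('o, 'm) pcat = "('o, 'm) cat" +
  HZero :: "'o \<Rightarrow> 'o \<Rightarrow> 'm"
  HAdd :: "'m \<Rightarrow> 'm \<Rightarrow> 'm"

definition hom_group :: "('o, 'm, 'z) pcat_scheme \<Rightarrow> 'o \<Rightarrow> 'o \<Rightarrow> 'm monoid" where
  "hom_group A a b = \<lparr>carrier = Hom A a b, mult = HAdd A, one = HZero A a b\<rparr>"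

definition is_kernel :: "('o, 'm, 'z) pcat_scheme \<Rightarrow> 'm \<Rightarrow> 'm \<Rightarrow> bool" where
  "is_kernel A k f \<longleftrightarrow>
    f \<in> Ar A \<and> k \<in> Ar A \<and> Cod A k = Dom A f \<and> f \<cdot>\<^bsub>A\<^esub> k = HZero A (Dom A k) (Cod A f) \<and>
    (\<forall>h \<in> Ar A. Cod A h = Dom A f \<and> f \<cdot>\<^bsub>A\<^esub> h = HZero A (Dom A h) (Cod A f) \<longrightarrow>
      (\<exists>!l. l \<in> Hom A (Dom A h) (Dom A k) \<and> k \<cdot>\<^bsub>A\<^esub> l = h))"

definition is_cokernel :: "('o, 'm, 'z) pcat_scheme \<Rightarrow> 'm \<Rightarrow> 'm \<Rightarrow> bool" where
  "is_cokernel A c f \<longleftrightarrow>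
    f \<in> Ar A \<and> c \<in> Ar A \<and> Dom A c = Cod A f \<and> c \<cdot>\<^bsub>A\<^esub> f = HZero A (Dom A f) (Cod A c) \<and>
    (\<forall>h \<in> Ar A. Dom A h = Cod A f \<and> h \<cdot>\<^bsub>A\<^esub> f = HZero A (Dom A f) (Cod A h) \<longrightarrow>
      (\<exists>!l. l \<in> Hom A (Cod A c) (Cod A h) \<and> l \<cdot>\<^bsub>A\<^esub> c = h))"

definition is_zero_object :: "('o, 'm, 'z) cat_scheme \<Rightarrow> 'o \<Rightarrow> bool" where
  "is_zero_object A z \<longleftrightarrow>
    z \<in> Ob A \<and> (\<forall>x \<in> Ob A. (\<exists>!f. f \<in> Hom A x z) \<and> (\<exists>!f. f \<in> Hom A z x))"

locale preadditive_category = category A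
  for A :: "('o, 'm, 'z) pcat_scheme" (structure) +
  assumes hom_comm_group: "a \<in> Ob A \<Longrightarrow> b \<in> Ob A \<Longrightarrow> comm_group (hom_group A a b)"
    and Comp_add_left:
      "f \<in> Hom A a b \<Longrightarrow> g \<in> Hom A b c \<Longrightarrow> g' \<in> Hom A b c \<Longrightarrow>
        HAdd A g g' \<cdot> f = HAdd A (g \<cdot> f) (g' \<cdot> f)"
    and Comp_add_right:
      "f \<in> Hom A a b \<Longrightarrow> f' \<in> Hom A a b \<Longrightarrow> g \<in> Hom A b c \<Longrightarrow>
        g \<cdot> HAdd A f f' = HAdd A (g \<cdot> f) (g \<cdot> f')"

locale abelian_category = preadditive_category A
  for A :: "('o, 'm, 'z) pcat_scheme" (structure) +
  assumes has_zero_object: "\<exists>z. is_zero_object A z"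
    and has_binary_products:
      "a \<in> Ob A \<Longrightarrow> b \<in> Ob A \<Longrightarrow> \<exists>P \<pi>. is_product A UNIV (\<lambda>i :: bool. if i then a else b) P \<pi>"
    and has_kernels: "f \<in> Ar A \<Longrightarrow> \<exists>k. is_kernel A k f"
    and has_cokernels: "f \<in> Ar A \<Longrightarrow> \<exists>c. is_cokernel A c f"
    and monic_is_kernel: "monic A f \<Longrightarrow> \<exists>g. is_kernel A f g"
    and epic_is_cokernel: "epic A f \<Longrightarrow> \<exists>g. is_cokernel A f g"

definition is_image :: "('o, 'm, 'z) pcat_scheme \<Rightarrow> 'm \<Rightarrow> 'm \<Rightarrow> bool" where
  "is_image A m f \<longleftrightarrow> (\<exists>c. is_cokernel A c f \<and> is_kernel A m c)"

text \<open>\<open>exact_at A f g\<close>: the image of \<open>f\<close> is the kernel of \<open>g\<close>.\<close>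

definition exact_at :: "('o, 'm, 'z) pcat_scheme \<Rightarrow> 'm \<Rightarrow> 'm \<Rightarrow> bool" where
  "exact_at A f g \<longleftrightarrow> Cod A f = Dom A g \<and> (\<exists>m. is_image A m f \<and> is_kernel A m g)"

definition short_exact :: "('o, 'm, 'z) pcat_scheme \<Rightarrow> 'm \<Rightarrow> 'm \<Rightarrow> bool" where
  "short_exact A f g \<longleftrightarrow> monic A f \<and> exact_at A f g \<and> epic A g"

definition exact_products :: "'u itself \<Rightarrow> ('o, 'm, 'z) pcat_scheme \<Rightarrow> bool" where
  "exact_products U A \<longleftrightarrow>
    (\<forall>(I :: 'u set) X Y Z f g P Q R \<pi> \<rho> \<sigma> h k.
      (\<forall>i \<in> I. f i \<in> Hom A (X i) (Y i) \<and> g i \<in> Hom A (Y i) (Z i) \<and> short_exact A (f i) (g i)) \<and>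
      is_product A I X P \<pi> \<and> is_product A I Y Q \<rho> \<and> is_product A I Z R \<sigma> \<and>
      h \<in> Hom A P Q \<and> (\<forall>i \<in> I. \<rho> i \<cdot>\<^bsub>A\<^esub> h = f i \<cdot>\<^bsub>A\<^esub> \<pi> i) \<and>
      k \<in> Hom A Q R \<and> (\<forall>i \<in> I. \<sigma> i \<cdot>\<^bsub>A\<^esub> k = g i \<cdot>\<^bsub>A\<^esub> \<rho> i)
      \<longrightarrow> short_exact A h k)"

definition additive_functor ::
  "('o, 'm, 'y) pcat_scheme \<Rightarrow> ('p, 'n, 'z) pcat_scheme \<Rightarrow> ('o, 'm, 'p, 'n) functor_data \<Rightarrow> bool" where
  "additive_functor X Y F \<longleftrightarrow>
    is_functor X Y F \<and>
    (\<forall>f \<in> Ar X. \<forall>g \<in> Hom X (Dom X f) (Cod X f). FM F (HAdd X f g) = HAdd Y (FM F f) (FM F g))"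


section \<open>Functor categories\<close>

definition Fun ::
  "('o, 'm, 'y) cat_scheme \<Rightarrow> ('p, 'n, 'z) pcat_scheme
    \<Rightarrow> (('o, 'm, 'p, 'n) functor_data, ('o, 'm, 'p, 'n) nt_data) pcat" where
  "Fun C A = \<lparr>
    Ob = {F. is_functor C A F},
    Ar = {t. nat_trans C A (NDom t) (NCod t) t},
    Dom = NDom,
    Cod = NCod,
    Id = (\<lambda>F. \<lparr>NDom = F, NCod = F, NC = (\<lambda>a \<in> Ob C. Id A (FO F a))\<rparr>),
    Comp = (\<lambda>s t. \<lparr>NDom = NDom t, NCod = NCod s, NC = (\<lambda>a \<in> Ob C. NC s a \<cdot>\<^bsub>A\<^esub> NC t a)\<rparr>),
    HZero = (\<lambda>F G. \<lparr>NDom = F, NCod = G, NC = (\<lambda>a \<in> Ob C. HZero A (FO F a) (FO G a))\<rparr>),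
    HAdd = (\<lambda>s t. \<lparr>NDom = NDom s, NCod = NCod s, NC = (\<lambda>a \<in> Ob C. HAdd A (NC s a) (NC t a))\<rparr>)\<rparr>"

text \<open>\<open>precomp C D A w\<close> is the functor \<open>Fun D A \<rightarrow> Fun C A\<close>, \<open>T \<mapsto> T \<circ> w\<close>, for \<open>w : C \<rightarrow> D\<close>.\<close>

definition precomp ::
  "('o, 'm, 'x) cat_scheme \<Rightarrow> ('p, 'n, 'y) cat_scheme \<Rightarrow> ('q, 'k, 'z) pcat_scheme
    \<Rightarrow> ('o, 'm, 'p, 'n) functor_data
    \<Rightarrow> (('p, 'n, 'q, 'k) functor_data, ('p, 'n, 'q, 'k) nt_data,
        ('o, 'm, 'q, 'k) functor_data, ('o, 'm, 'q, 'k) nt_data) functor_data" where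
  "precomp C D A w = \<lparr>
    FO = (\<lambda>T \<in> Ob (Fun D A). fcomp C T w),
    FM = (\<lambda>t \<in> Ar (Fun D A). \<lparr>NDom = fcomp C (NDom t) w, NCod = fcomp C (NCod t) w,
                             NC = (\<lambda>a \<in> Ob C. NC t (FO w a))\<rparr>)\<rparr>"


section \<open>Satellites\<close>

text \<open>
  A cohomological \<open>\<delta>\<close>-functor: additive functors \<open>F 0, F 1, \<dots>\<close> with connecting morphisms
  \<open>\<delta> n f g : F n c \<rightarrow> F (n + 1) a\<close> for each short exact sequence \<open>0 \<rightarrow> a \<rightarrow> b \<rightarrow> c \<rightarrow> 0\<close> given by
  \<open>f\<close> and \<open>g\<close>, natural in the sequence, with exact long sequences starting \<open>0 \<rightarrow> F 0 a\<close>.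
\<close>

definition delta_functor ::
  "('o, 'm, 'y) pcat_scheme \<Rightarrow> ('p, 'n, 'z) pcat_scheme
    \<Rightarrow> (nat \<Rightarrow> ('o, 'm, 'p, 'n) functor_data) \<Rightarrow> (nat \<Rightarrow> 'm \<Rightarrow> 'm \<Rightarrow> 'n) \<Rightarrow> bool" where
  "delta_functor X Y F \<delta> \<longleftrightarrow>
    (\<forall>n. additive_functor X Y (F n)) \<and>
    (\<forall>f g. short_exact X f g \<longrightarrow>
      monic Y (FM (F 0) f) \<and>
      (\<forall>n. \<delta> n f g \<in> Hom Y (FO (F n) (Cod X g)) (FO (F (Suc n)) (Dom X f)) \<and>
        exact_at Y (FM (F n) f) (FM (F n) g) \<and>
        exact_at Y (FM (F n) g) (\<delta> n f g) \<and>
        exact_at Y (\<delta> n f g) (FM (F (Suc n)) f))) \<and>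
    (\<forall>f g f' g' a b c.
      short_exact X f g \<and> short_exact X f' g' \<and>
      a \<in> Hom X (Dom X f) (Dom X f') \<and> b \<in> Hom X (Cod X f) (Cod X f') \<and>
      c \<in> Hom X (Cod X g) (Cod X g') \<and>
      b \<cdot>\<^bsub>X\<^esub> f = f' \<cdot>\<^bsub>X\<^esub> a \<and> c \<cdot>\<^bsub>X\<^esub> g = g' \<cdot>\<^bsub>X\<^esub> b
      \<longrightarrow> (\<forall>n. FM (F (Suc n)) a \<cdot>\<^bsub>Y\<^esub> \<delta> n f g = \<delta> n f' g' \<cdot>\<^bsub>Y\<^esub> FM (F n) c))"

text \<open>
  The right satellites of a left exact functor \<open>\<Phi>\<close>: the universal cohomological \<open>\<delta>\<close>-functor
  starting with \<open>\<Phi>\<close> in degree 0.  No injective objects are required.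
\<close>

definition right_satellites ::
  "('o, 'm, 'y) pcat_scheme \<Rightarrow> ('p, 'n, 'z) pcat_scheme \<Rightarrow> ('o, 'm, 'p, 'n) functor_data
    \<Rightarrow> (nat \<Rightarrow> ('o, 'm, 'p, 'n) functor_data) \<Rightarrow> (nat \<Rightarrow> 'm \<Rightarrow> 'm \<Rightarrow> 'n) \<Rightarrow> bool" where
  "right_satellites X Y \<Phi> R \<delta> \<longleftrightarrow>
    delta_functor X Y R \<delta> \<and> R 0 = \<Phi> \<and>
    (\<forall>G \<gamma> t. delta_functor X Y G \<gamma> \<and> nat_trans X Y (R 0) (G 0) t \<longrightarrow>
      (\<exists>!\<tau>. \<tau> 0 = t \<and> (\<forall>n. nat_trans X Y (R n) (G n) (\<tau> n)) \<and>
        (\<forall>f g n. short_exact X f g \<longrightarrow>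
          NC (\<tau> (Suc n)) (Dom X f) \<cdot>\<^bsub>Y\<^esub> \<delta> n f g = \<gamma> n f g \<cdot>\<^bsub>Y\<^esub> NC (\<tau> n) (Cod X g))))"


section \<open>Cohomology\<close>

text \<open>
  For composable \<open>f\<close>, \<open>g\<close> with \<open>g \<cdot> f = 0\<close>, the object \<open>coh_ob A f g\<close> is \<open>ker g / im f\<close>: the
  cokernel of the lift of \<open>f\<close> to a kernel of \<open>g\<close>.  Kernel and cokernel are arbitrary but fixed
  choices.  A morphism of such pairs with middle component \<open>b\<close> induces \<open>coh_map A f g f' g' b\<close>.
\<close>

definition coh_ker :: "('o, 'm, 'z) pcat_scheme \<Rightarrow> 'm \<Rightarrow> 'm" where
  "coh_ker A g = (SOME k. is_kernel A k g)"

definition coh_lift :: "('o, 'm, 'z) pcat_scheme \<Rightarrow> 'm \<Rightarrow> 'm \<Rightarrow> 'm" where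
  "coh_lift A f g = (THE l. l \<in> Hom A (Dom A f) (Dom A (coh_ker A g)) \<and> coh_ker A g \<cdot>\<^bsub>A\<^esub> l = f)"

definition coh_quot :: "('o, 'm, 'z) pcat_scheme \<Rightarrow> 'm \<Rightarrow> 'm \<Rightarrow> 'm" where
  "coh_quot A f g = (SOME c. is_cokernel A c (coh_lift A f g))"

definition coh_ob :: "('o, 'm, 'z) pcat_scheme \<Rightarrow> 'm \<Rightarrow> 'm \<Rightarrow> 'o" where
  "coh_ob A f g = Cod A (coh_quot A f g)"

definition coh_map :: "('o, 'm, 'z) pcat_scheme \<Rightarrow> 'm \<Rightarrow> 'm \<Rightarrow> 'm \<Rightarrow> 'm \<Rightarrow> 'm \<Rightarrow> 'm" where
  "coh_map A f g f' g' b =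
    (let z = (THE z. z \<in> Hom A (Dom A (coh_ker A g)) (Dom A (coh_ker A g')) \<and>
                     coh_ker A g' \<cdot>\<^bsub>A\<^esub> z = b \<cdot>\<^bsub>A\<^esub> coh_ker A g)
     in THE h. h \<in> Hom A (coh_ob A f g) (coh_ob A f' g') \<and>
               h \<cdot>\<^bsub>A\<^esub> coh_quot A f g = coh_quot A f' g' \<cdot>\<^bsub>A\<^esub> z)"


section \<open>The simplex category and Thomason cohomology\<close>

text \<open>\<open>[n]\<close>, with the pair \<open>(i, j)\<close>, \<open>i \<le> j\<close>, as the arrow from \<open>i\<close> to \<open>j\<close>.\<close>

definition ord_cat :: "nat \<Rightarrow> (nat, nat \<times> nat) cat" where
  "ord_cat n = \<lparr>Ob = {..n}, Ar = {(i, j). i \<le> j \<and> j \<le> n}, Dom = fst, Cod = snd,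
                Id = (\<lambda>i. (i, i)), Comp = (\<lambda>g f. (fst f, snd g))\<rparr>"

definition mono_maps :: "nat \<Rightarrow> nat \<Rightarrow> (nat \<Rightarrow> nat) set" where
  "mono_maps n m = {\<sigma> \<in> {..n} \<rightarrow>\<^sub>E {..m}. mono_on {..n} \<sigma>}"

definition ord_functor :: "nat \<Rightarrow> (nat \<Rightarrow> nat) \<Rightarrow> (nat, nat \<times> nat, nat, nat \<times> nat) functor_data" where
  "ord_functor n \<sigma> = \<lparr>FO = restrict \<sigma> {..n}, FM = restrict (map_prod \<sigma> \<sigma>) (Ar (ord_cat n))\<rparr>"

type_synonym ('o, 'm) simplex = "nat \<times> (nat, nat \<times> nat, 'o, 'm) functor_data"
type_synonym ('o, 'm) simplex_arrow = "('o, 'm) simplex \<times> (nat \<Rightarrow> nat) \<times> ('o, 'm) simplex"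

definition simplices ::
  "('o, 'm, 'z) cat_scheme \<Rightarrow> nat \<Rightarrow> (nat, nat \<times> nat, 'o, 'm) functor_data set" where
  "simplices C n = {f. is_functor (ord_cat n) C f}"

definition pull_simplex ::
  "nat \<Rightarrow> (nat \<Rightarrow> nat) \<Rightarrow> (nat, nat \<times> nat, 'o, 'm) functor_data
    \<Rightarrow> (nat, nat \<times> nat, 'o, 'm) functor_data" where
  "pull_simplex n \<sigma> g = fcomp (ord_cat n) g (ord_functor n \<sigma>)"

text \<open>The category \<open>\<Delta>/C\<close>.\<close>

definition simplex_cat ::
  "('o, 'm, 'z) cat_scheme \<Rightarrow> (('o, 'm) simplex, ('o, 'm) simplex_arrow) cat" where
  "simplex_cat C = \<lparr>
    Ob = {(n, f). f \<in> simplices C n},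
    Ar = {((n, f), \<sigma>, (m, g)) | n f \<sigma> m g.
            f \<in> simplices C n \<and> g \<in> simplices C m \<and> \<sigma> \<in> mono_maps n m \<and> f = pull_simplex n \<sigma> g},
    Dom = (\<lambda>(x, \<sigma>, y). x),
    Cod = (\<lambda>(x, \<sigma>, y). y),
    Id = (\<lambda>x. (x, (\<lambda>i \<in> {..fst x}. i), x)),
    Comp = (\<lambda>(y, \<tau>, z) (x, \<sigma>, y'). (x, compose {..fst x} \<tau> \<sigma>, z))\<rparr>"

text \<open>The functor \<open>\<Delta>/u : \<Delta>/E \<rightarrow> \<Delta>/B\<close>.\<close>

definition simplex_functor ::
  "('o, 'm, 'z) cat_scheme \<Rightarrow> ('o, 'm, 'p, 'n) functor_data
    \<Rightarrow> (('o, 'm) simplex, ('o, 'm) simplex_arrow, ('p, 'n) simplex, ('p, 'n) simplex_arrow)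
        functor_data" where
  "simplex_functor E u =
    (let F = (\<lambda>(n, f). (n, fcomp (ord_cat n) u f)) in
     \<lparr>FO = restrict F (Ob (simplex_cat E)),
      FM = (\<lambda>(x, \<sigma>, y) \<in> Ar (simplex_cat E). (F x, \<sigma>, F y))\<rparr>)"

definition skip :: "nat \<Rightarrow> nat \<Rightarrow> nat \<Rightarrow> nat" where
  "skip n i = (\<lambda>k \<in> {..n}. if k < i then k else Suc k)"

type_synonym ('u, 'v, 'o, 'm) natural_system =
  "(('u, 'v) simplex, ('u, 'v) simplex_arrow, 'o, 'm) functor_data"
type_synonym ('u, 'v, 'o, 'm) natural_system_map =
  "(('u, 'v) simplex, ('u, 'v) simplex_arrow, 'o, 'm) nt_data"

definition Th_ob ::
  "('o, 'm, 'z) pcat_scheme \<Rightarrow> ('u, 'v, 'y) cat_scheme \<Rightarrow> ('u, 'v, 'o, 'm) natural_system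
    \<Rightarrow> nat \<Rightarrow> 'o" where
  "Th_ob A C T n = prod_ob A (simplices C n) (\<lambda>f. FO T (n, f))"

definition Th_proj ::
  "('o, 'm, 'z) pcat_scheme \<Rightarrow> ('u, 'v, 'y) cat_scheme \<Rightarrow> ('u, 'v, 'o, 'm) natural_system
    \<Rightarrow> nat \<Rightarrow> (nat, nat \<times> nat, 'u, 'v) functor_data \<Rightarrow> 'm" where
  "Th_proj A C T n = prod_proj A (simplices C n) (\<lambda>f. FO T (n, f))"

definition Th_tuple ::
  "('o, 'm, 'z) pcat_scheme \<Rightarrow> ('u, 'v, 'y) cat_scheme \<Rightarrow> ('u, 'v, 'o, 'm) natural_system
    \<Rightarrow> nat \<Rightarrow> 'o \<Rightarrow> ((nat, nat \<times> nat, 'u, 'v) functor_data \<Rightarrow> 'm) \<Rightarrow> 'm" where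
  "Th_tuple A C T n = prod_tuple A (simplices C n) (\<lambda>f. FO T (n, f))"

definition Th_coface ::
  "('o, 'm, 'z) pcat_scheme \<Rightarrow> ('u, 'v, 'y) cat_scheme \<Rightarrow> ('u, 'v, 'o, 'm) natural_system
    \<Rightarrow> nat \<Rightarrow> nat \<Rightarrow> 'm" where
  "Th_coface A C T n i =
    Th_tuple A C T (Suc n) (Th_ob A C T n)
      (\<lambda>g. let f = pull_simplex n (skip n i) g
           in FM T ((n, f), skip n i, (Suc n, g)) \<cdot>\<^bsub>A\<^esub> Th_proj A C T n f)"

text \<open>The alternating sum \<open>\<Sum>i \<le> n + 1. (-1)^i d_i\<close> in the (multiplicatively written) hom group.\<close>

definition Th_diff ::
  "('o, 'm, 'z) pcat_scheme \<Rightarrow> ('u, 'v, 'y) cat_scheme \<Rightarrow> ('u, 'v, 'o, 'm) natural_system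
    \<Rightarrow> nat \<Rightarrow> 'm" where
  "Th_diff A C T n =
    (let H = hom_group A (Th_ob A C T n) (Th_ob A C T (Suc n)) in
     \<Otimes>\<^bsub>H\<^esub>i \<in> {..Suc n}. if even i then Th_coface A C T n i else inv\<^bsub>H\<^esub> Th_coface A C T n i)"

text \<open>
  The arrow into degree \<open>n\<close>; in degree 0 a zero arrow (its source does not affect the cohomology).
\<close>

definition Th_incoming ::
  "('o, 'm, 'z) pcat_scheme \<Rightarrow> ('u, 'v, 'y) cat_scheme \<Rightarrow> ('u, 'v, 'o, 'm) natural_system
    \<Rightarrow> nat \<Rightarrow> 'm" where
  "Th_incoming A C T n =
    (case n of 0 \<Rightarrow> HZero A (Th_ob A C T 0) (Th_ob A C T 0) | Suc k \<Rightarrow> Th_diff A C T k)"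

definition Th_map ::
  "('o, 'm, 'z) pcat_scheme \<Rightarrow> ('u, 'v, 'y) cat_scheme \<Rightarrow> ('u, 'v, 'o, 'm) natural_system_map
    \<Rightarrow> nat \<Rightarrow> 'm" where
  "Th_map A C t n =
    Th_tuple A C (NCod t) n (Th_ob A C (NDom t) n)
      (\<lambda>f. NC t (n, f) \<cdot>\<^bsub>A\<^esub> Th_proj A C (NDom t) n f)"

text \<open>The functor \<open>T \<mapsto> H\<^sup>n(C, T)\<close> from \<open>Fun(\<Delta>/C, A)\<close> to \<open>A\<close>.\<close>

definition Th_cohomology ::
  "('o, 'm, 'z) pcat_scheme \<Rightarrow> ('u, 'v, 'y) cat_scheme \<Rightarrow> nat
    \<Rightarrow> (('u, 'v, 'o, 'm) natural_system, ('u, 'v, 'o, 'm) natural_system_map, 'o, 'm) functor_data"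
  where
  "Th_cohomology A C n = \<lparr>
    FO = (\<lambda>T \<in> Ob (Fun (simplex_cat C) A). coh_ob A (Th_incoming A C T n) (Th_diff A C T n)),
    FM = (\<lambda>t \<in> Ar (Fun (simplex_cat C) A).
            coh_map A (Th_incoming A C (NDom t) n) (Th_diff A C (NDom t) n)
                      (Th_incoming A C (NCod t) n) (Th_diff A C (NCod t) n) (Th_map A C t n))\<rparr>"


section \<open>Spectral sequences\<close>

text \<open>
  Cohomology spectral sequences starting at page 2: \<open>SE r p q\<close> is \<open>E_r^{p,q}\<close>,
  \<open>Sd r p q : E_r^{p,q} \<rightarrow> E_r^{p+r,q-r+1}\<close>, and \<open>Si r p q\<close> is the structure isomorphism from the
  cohomology of page \<open>r\<close> at \<open>(p,q)\<close> to \<open>E_{r+1}^{p,q}\<close>.  Values at \<open>r < 2\<close> are irrelevant.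
\<close>

record ('o, 'm) specseq =
  SE :: "nat \<Rightarrow> int \<Rightarrow> int \<Rightarrow> 'o"
  Sd :: "nat \<Rightarrow> int \<Rightarrow> int \<Rightarrow> 'm"
  Si :: "nat \<Rightarrow> int \<Rightarrow> int \<Rightarrow> 'm"

abbreviation Sd_in :: "('o, 'm) specseq \<Rightarrow> nat \<Rightarrow> int \<Rightarrow> int \<Rightarrow> 'm" where
  "Sd_in S r p q \<equiv> Sd S r (p - int r) (q + int r - 1)"

definition spectral_sequence :: "('o, 'm, 'z) pcat_scheme \<Rightarrow> ('o, 'm) specseq \<Rightarrow> bool" where
  "spectral_sequence A S \<longleftrightarrow>
    (\<forall>r \<ge> 2. \<forall>p q.
      SE S r p q \<in> Ob A \<and>
      Sd S r p q \<in> Hom A (SE S r p q) (SE S r (p + int r) (q - int r + 1)) \<and>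
      Sd S r p q \<cdot>\<^bsub>A\<^esub> Sd_in S r p q
        = HZero A (SE S r (p - int r) (q + int r - 1)) (SE S r (p + int r) (q - int r + 1)) \<and>
      Si S r p q \<in> Hom A (coh_ob A (Sd_in S r p q) (Sd S r p q)) (SE S (Suc r) p q) \<and>
      is_iso A (Si S r p q))"

definition first_quadrant :: "('o, 'm, 'z) pcat_scheme \<Rightarrow> ('o, 'm) specseq \<Rightarrow> bool" where
  "first_quadrant A S \<longleftrightarrow> (\<forall>r \<ge> 2. \<forall>p q. p < 0 \<or> q < 0 \<longrightarrow> is_zero_object A (SE S r p q))"

record ('o, 'm) ss_arrow =
  MDom :: "('o, 'm) specseq"
  MCod :: "('o, 'm) specseq"
  MC :: "nat \<Rightarrow> int \<Rightarrow> int \<Rightarrow> 'm"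

definition ss_morphism :: "('o, 'm, 'z) pcat_scheme \<Rightarrow> ('o, 'm) ss_arrow \<Rightarrow> bool" where
  "ss_morphism A m \<longleftrightarrow>
    (let S = MDom m; S' = MCod m in
      spectral_sequence A S \<and> spectral_sequence A S' \<and> MC m \<in> extensional {2..} \<and>
      (\<forall>r \<ge> 2. \<forall>p q.
        MC m r p q \<in> Hom A (SE S r p q) (SE S' r p q) \<and>
        MC m r (p + int r) (q - int r + 1) \<cdot>\<^bsub>A\<^esub> Sd S r p q = Sd S' r p q \<cdot>\<^bsub>A\<^esub> MC m r p q \<and>
        MC m (Suc r) p q \<cdot>\<^bsub>A\<^esub> Si S r p q
          = Si S' r p q \<cdot>\<^bsub>A\<^esub>
            coh_map A (Sd_in S r p q) (Sd S r p q) (Sd_in S' r p q) (Sd S' r p q) (MC m r p q)))"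

definition SpecSeq ::
  "('o, 'm, 'z) pcat_scheme \<Rightarrow> (('o, 'm) specseq, ('o, 'm) ss_arrow) cat" where
  "SpecSeq A = \<lparr>
    Ob = {S. spectral_sequence A S},
    Ar = {m. ss_morphism A m},
    Dom = MDom,
    Cod = MCod,
    Id = (\<lambda>S. \<lparr>MDom = S, MCod = S, MC = (\<lambda>r \<in> {2..}. \<lambda>p q. Id A (SE S r p q))\<rparr>),
    Comp = (\<lambda>m l. \<lparr>MDom = MDom l, MCod = MCod m,
                   MC = (\<lambda>r \<in> {2..}. \<lambda>p q. MC m r p q \<cdot>\<^bsub>A\<^esub> MC l r p q)\<rparr>)\<rparr>"

definition page ::
  "('o, 'm, 'z) pcat_scheme \<Rightarrow> nat \<Rightarrow> int \<Rightarrow> int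
    \<Rightarrow> (('o, 'm) specseq, ('o, 'm) ss_arrow, 'o, 'm) functor_data" where
  "page A r p q = \<lparr>FO = (\<lambda>S \<in> Ob (SpecSeq A). SE S r p q),
                   FM = (\<lambda>m \<in> Ar (SpecSeq A). MC m r p q)\<rparr>"

text \<open>
  In a first quadrant spectral sequence, from page \<open>r = max (p + 1) (q + 2)\<close> on (which is at
  least 2) the differentials into and out of position \<open>(p, q)\<close> vanish, so \<open>E_\<infinity>^{p,q}\<close> is \<open>E_r^{p,q}\<close>.
\<close>

definition stable_page :: "nat \<Rightarrow> nat \<Rightarrow> nat" where
  "stable_page p q = max (p + 1) (q + 2)"

definition E_infty :: "('o, 'm) specseq \<Rightarrow> nat \<Rightarrow> nat \<Rightarrow> 'o" where
  "E_infty S p q = SE S (stable_page p q) (int p) (int q)"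

definition E_infty_map :: "('o, 'm) ss_arrow \<Rightarrow> nat \<Rightarrow> nat \<Rightarrow> 'm" where
  "E_infty_map m p q = MC m (stable_page p q) (int p) (int q)"

text \<open>
  Convergence \<open>E_2^{p,q} \<Rightarrow> H^{p+q}\<close>: every \<open>H n\<close> has a decreasing filtration by subobjects
  \<open>Finc n p : F^p \<rightarrow> H n\<close> with \<open>F^0 = H n\<close> and \<open>F^{n+1} = 0\<close>; \<open>Fstep n p\<close> is the inclusion
  \<open>F^{p+1} \<rightarrow> F^p\<close>, and \<open>Fproj n p : F^p \<rightarrow> E_\<infinity>^{p,n-p}\<close> exhibits \<open>E_\<infinity>^{p,n-p}\<close> as \<open>F^p/F^{p+1}\<close>.
\<close>

record ('o, 'm) filtration =
  Fob :: "nat \<Rightarrow> nat \<Rightarrow> 'o"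
  Finc :: "nat \<Rightarrow> nat \<Rightarrow> 'm"
  Fstep :: "nat \<Rightarrow> nat \<Rightarrow> 'm"
  Fproj :: "nat \<Rightarrow> nat \<Rightarrow> 'm"

definition converges_to ::
  "('o, 'm, 'z) pcat_scheme \<Rightarrow> ('o, 'm) specseq \<Rightarrow> (nat \<Rightarrow> 'o) \<Rightarrow> ('o, 'm) filtration \<Rightarrow> bool" where
  "converges_to A S H \<Phi> \<longleftrightarrow>
    spectral_sequence A S \<and> first_quadrant A S \<and>
    (\<forall>n.
      H n \<in> Ob A \<and>
      (\<forall>p \<le> Suc n. Finc \<Phi> n p \<in> Hom A (Fob \<Phi> n p) (H n) \<and> monic A (Finc \<Phi> n p)) \<and>
      is_iso A (Finc \<Phi> n 0) \<and>
      is_zero_object A (Fob \<Phi> n (Suc n)) \<and>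
      (\<forall>p \<le> n.
        Fstep \<Phi> n p \<in> Hom A (Fob \<Phi> n (Suc p)) (Fob \<Phi> n p) \<and>
        Finc \<Phi> n p \<cdot>\<^bsub>A\<^esub> Fstep \<Phi> n p = Finc \<Phi> n (Suc p) \<and>
        Fproj \<Phi> n p \<in> Hom A (Fob \<Phi> n p) (E_infty S p (n - p)) \<and>
        short_exact A (Fstep \<Phi> n p) (Fproj \<Phi> n p)))"

text \<open>
  A morphism of spectral sequences \<open>m\<close> and maps \<open>h n : H n \<rightarrow> H' n\<close> are compatible with
  convergence: \<open>h\<close> preserves the filtrations and induces on quotients the maps of \<open>m\<close> on \<open>E_\<infinity>\<close>.
\<close>

definition convergence_compatible ::
  "('o, 'm, 'z) pcat_scheme \<Rightarrow> ('o, 'm) ss_arrow \<Rightarrow> (nat \<Rightarrow> 'm)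
    \<Rightarrow> ('o, 'm) filtration \<Rightarrow> ('o, 'm) filtration \<Rightarrow> bool" where
  "convergence_compatible A m h \<Phi> \<Phi>' \<longleftrightarrow>
    (\<forall>n. \<forall>p \<le> n. \<exists>k \<in> Hom A (Fob \<Phi> n p) (Fob \<Phi>' n p).
      Finc \<Phi>' n p \<cdot>\<^bsub>A\<^esub> k = h n \<cdot>\<^bsub>A\<^esub> Finc \<Phi> n p \<and>
      Fproj \<Phi>' n p \<cdot>\<^bsub>A\<^esub> k = E_infty_map m p (n - p) \<cdot>\<^bsub>A\<^esub> Fproj \<Phi> n p)"

end

theory Submission
  imports Defs
begin

text \<open>
  The category \<open>\<Delta>/C\<close> is the category of elements of the nerve of \<open>C\<close>, so \<open>\<Delta>/u\<close> is a discrete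
  fibration, and the right Kan extension of \<open>T\<close> along it takes a simplex \<open>g\<close> of \<open>B\<close> to the product
  of the \<open>T f\<close> over the simplices \<open>f\<close> of \<open>E\<close> with \<open>u f = g\<close>. As products are exact, so is this Kan
  extension: its satellites vanish in positive degrees. Moreover, its Thomason cochains on \<open>B\<close> are
  products of products, which is to say the Thomason cochains of \<open>T\<close> on \<open>E\<close>. The spectral sequence
  is therefore concentrated in the row \<open>q = 0\<close>, where it is the cohomology of \<open>E\<close>.
\<close>

section \<open>Categories and products\<close>

text \<open>A product over the fibre suffices because fibres are initial in comma categories: an
  object of the comma category under \<open>c\<close> is a \<open>y\<close> with an arrow from
  \<open>c\<close> to \<open>w y\<close>, and the unique lift of that arrow is the unique arrow to
  it from an object of the fibre over \<open>c\<close>. The obstacle is that the data are given by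
  universal properties only. The right adjoint is arbitrary, so its counit is compared with that of
  an explicit model; its components then become product projections, and through them additivity,
  exactness and the comparison of cochains are proved for the given functor. Short exactness of
  natural systems is meant in the functor category, whereas exactness of products concerns
  components; hence kernels, cokernels, monics and epics there are shown to be pointwise. The
  satellites are arbitrary too: their vanishing comes from the uniqueness clause, applied to two
  transformations of the satellites into themselves. Finally, simplices are not elements of the
  universe \<open>'u\<close>; that \<open>'u\<close> is infinite provides codes for them, and so
  products over them.\<close>

lemma Hom_iff [simp]: "f \<in> Hom C a b \<longleftrightarrow> f \<in> Ar C \<and> Dom C f = a \<and> Cod C f = b"
  by (simp add: Hom_def)

context category
begin

declare Dom_Ob [simp] Cod_Ob [simp]

lemma Id_simps [simp]:
  assumes "a \<in> Ob C"
  shows "Id C a \<in> Ar C" "Dom C (Id C a) = a" "Cod C (Id C a) = a"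
  using Id_Hom[OF assms] by auto

lemma Comp_simps [simp]:
  assumes "f \<in> Ar C" "g \<in> Ar C" "Cod C f = Dom C g"
  shows "g \<cdot> f \<in> Ar C" "Dom C (g \<cdot> f) = Dom C f" "Cod C (g \<cdot> f) = Cod C g"
  using Comp_Hom[of f "Dom C f" "Cod C f" g "Cod C g"] assms by auto

lemma Comp_Id_left [simp]: "f \<in> Ar C \<Longrightarrow> Cod C f = b \<Longrightarrow> Id C b \<cdot> f = f"
  using Id_left[of f "Dom C f" b] by simp

lemma Comp_Id_right [simp]: "f \<in> Ar C \<Longrightarrow> Dom C f = a \<Longrightarrow> f \<cdot> Id C a = f"
  using Id_right[of f a "Cod C f"] by simp

lemma assoc [simp]:
  "f \<in> Ar C \<Longrightarrow> g \<in> Ar C \<Longrightarrow> h \<in> Ar C \<Longrightarrow> Cod C f = Dom C g \<Longrightarrow> Cod C g = Dom C h \<Longrightarrow>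
    (h \<cdot> g) \<cdot> f = h \<cdot> (g \<cdot> f)"
  using Comp_assoc[of f "Dom C f" "Cod C f" g "Cod C g" h "Cod C h"] by simp

text \<open>As a simplification rule, \<open>assoc\<close> brackets composites to the right, after
  which an equation for \<open>g \<cdot> f\<close> no longer matches inside
  \<open>g \<cdot> (f \<cdot> x)\<close>. This form does.\<close>

lemma assoc_eq:
  assumes "g \<cdot> f = h" "f \<in> Ar C" "g \<in> Ar C" "x \<in> Ar C" "Cod C f = Dom C g" "Cod C x = Dom C f"
  shows "g \<cdot> (f \<cdot> x) = h \<cdot> x"
  using assoc[of x f g] assms by simp

lemma is_iso_Id [simp]: "a \<in> Ob C \<Longrightarrow> is_iso C (Id C a)"
  unfolding is_iso_def by (auto intro!: bexI[of _ "Id C a"])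

lemma is_isoI:
  assumes "f \<in> Hom C a b" "g \<in> Hom C b a" "g \<cdot> f = Id C a" "f \<cdot> g = Id C b"
  shows "is_iso C f"
  using assms unfolding is_iso_def by (auto intro!: bexI[of _ g])

lemma is_isoE:
  assumes "is_iso C f"
  obtains g where "f \<in> Ar C" "g \<in> Ar C" "Dom C g = Cod C f" "Cod C g = Dom C f"
    "g \<cdot> f = Id C (Dom C f)" "f \<cdot> g = Id C (Cod C f)"
  using assms unfolding is_iso_def by auto

lemma product_simps:
  assumes "is_product C I X P \<pi>"
  shows "P \<in> Ob C" "i \<in> I \<Longrightarrow> \<pi> i \<in> Ar C" "i \<in> I \<Longrightarrow> Dom C (\<pi> i) = P"
    "i \<in> I \<Longrightarrow> Cod C (\<pi> i) = X i"
proof -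
  have "P \<in> Ob C" "\<And>i. i \<in> I \<Longrightarrow> \<pi> i \<in> Hom C P (X i)"
    using assms unfolding is_product_def by blast+
  then show "P \<in> Ob C" "i \<in> I \<Longrightarrow> \<pi> i \<in> Ar C" "i \<in> I \<Longrightarrow> Dom C (\<pi> i) = P"
    "i \<in> I \<Longrightarrow> Cod C (\<pi> i) = X i" by auto
qed

lemma product_ex1:
  assumes "is_product C I X P \<pi>" "Q \<in> Ob C" "\<And>i. i \<in> I \<Longrightarrow> \<rho> i \<in> Hom C Q (X i)"
  shows "\<exists>!h. h \<in> Hom C Q P \<and> (\<forall>i \<in> I. \<pi> i \<cdot> h = \<rho> i)"
  by (rule assms(1)[unfolded is_product_def, THEN conjunct2, THEN conjunct2, rule_format])
    (use assms(2,3) in blast)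

text \<open>Both arrows solve the lifting problem for the family \<open>\<pi> i \<cdot> h\<close>.
  Most equations between arrows into a product are checked this way, one projection at a
  time.\<close>

lemma product_ext:
  assumes P: "is_product C I X P \<pi>" and h: "h \<in> Hom C Q P" and k: "k \<in> Hom C Q P"
    and eq: "\<And>i. i \<in> I \<Longrightarrow> \<pi> i \<cdot> h = \<pi> i \<cdot> k"
  shows "h = k"
proof -
  have "\<exists>!l. l \<in> Hom C Q P \<and> (\<forall>i \<in> I. \<pi> i \<cdot> l = \<pi> i \<cdot> h)"
    by (rule product_ex1[OF P]) (use product_simps[OF P] h Dom_Ob[of h] in auto)
  then show ?thesis
    by (rule ex1E) (metis h k eq)
qed

lemma product_lift:
  assumes "is_product C I X P \<pi>" "Q \<in> Ob C" "\<And>i. i \<in> I \<Longrightarrow> \<rho> i \<in> Hom C Q (X i)"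
  obtains h where "h \<in> Ar C" "Dom C h = Q" "Cod C h = P" "\<And>i. i \<in> I \<Longrightarrow> \<pi> i \<cdot> h = \<rho> i"
proof -
  from product_ex1[of I X P \<pi> Q \<rho>, OF assms] obtain h where
    "h \<in> Hom C Q P" "\<forall>i \<in> I. \<pi> i \<cdot> h = \<rho> i" by blast
  then show ?thesis using that[of h] by simp
qed

lemma productI:
  assumes "P \<in> Ob C" "\<And>i. i \<in> I \<Longrightarrow> \<pi> i \<in> Hom C P (X i)"
    and "\<And>Q \<rho>. Q \<in> Ob C \<Longrightarrow> (\<And>i. i \<in> I \<Longrightarrow> \<rho> i \<in> Hom C Q (X i)) \<Longrightarrow>
      \<exists>h. h \<in> Hom C Q P \<and> (\<forall>i \<in> I. \<pi> i \<cdot> h = \<rho> i)"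
    and "\<And>Q h k. h \<in> Hom C Q P \<Longrightarrow> k \<in> Hom C Q P \<Longrightarrow> (\<And>i. i \<in> I \<Longrightarrow> \<pi> i \<cdot> h = \<pi> i \<cdot> k) \<Longrightarrow> h = k"
  shows "is_product C I X P \<pi>"
  unfolding is_product_def
proof (intro conjI allI impI ballI, goal_cases)
  case (3 Q \<rho>)
  then obtain h where h: "h \<in> Hom C Q P" "\<forall>i \<in> I. \<pi> i \<cdot> h = \<rho> i"
    using assms(3)[of Q \<rho>] by blast
  show ?case
  proof (rule ex1I[of _ h])
    show "h \<in> Hom C Q P \<and> (\<forall>i \<in> I. \<pi> i \<cdot> h = \<rho> i)" using h by blast
    fix k assume "k \<in> Hom C Q P \<and> (\<forall>i \<in> I. \<pi> i \<cdot> k = \<rho> i)"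
    then show "k = h" using assms(4)[of k Q h] h by metis
  qed
qed (use assms in auto)

lemma product_cong:
  assumes "is_product C I X P \<pi>" "\<And>i. i \<in> I \<Longrightarrow> X i = X' i" "\<And>i. i \<in> I \<Longrightarrow> \<pi> i = \<pi>' i"
  shows "is_product C I X' P \<pi>'"
  using assms unfolding is_product_def by simp

text \<open>Carries products over sets of functors to subsets of the universe and back, and later
  strips the dimension from the objects of a fibre.\<close>

lemma product_reindex:
  assumes e: "bij_betw e I J" and P: "is_product C J X P \<pi>"
  shows "is_product C I (\<lambda>i. X (e i)) P (\<lambda>i. \<pi> (e i))"
proof (rule productI)
  note ps = product_simps[OF P]
  have eJ: "\<And>i. i \<in> I \<Longrightarrow> e i \<in> J" using e bij_betwE by blast
  show "P \<in> Ob C" by (rule ps)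
  show "\<And>i. i \<in> I \<Longrightarrow> \<pi> (e i) \<in> Hom C P (X (e i))" using ps eJ by simp
  have inv: "\<And>j. j \<in> J \<Longrightarrow> inv_into I e j \<in> I \<and> e (inv_into I e j) = j"
    using e by (simp add: bij_betw_def f_inv_into_f inv_into_into)
  have inv2: "\<And>i. i \<in> I \<Longrightarrow> inv_into I e (e i) = i"
    using e by (simp add: bij_betw_def)
  show "\<exists>h. h \<in> Hom C Q P \<and> (\<forall>i\<in>I. \<pi> (e i) \<cdot> h = \<rho> i)"
    if Q: "Q \<in> Ob C" and r: "\<And>i. i \<in> I \<Longrightarrow> \<rho> i \<in> Hom C Q (X (e i))" for Q \<rho>
  proof -
    \<comment> \<open>The given family lives on \<open>I\<close>; the inverse of \<open>e\<close>
      spreads it over \<open>J\<close>.\<close>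
    have "\<And>j. j \<in> J \<Longrightarrow> \<rho> (inv_into I e j) \<in> Hom C Q (X j)" using r inv by force
    from product_lift[OF P Q this] obtain h where
      "h \<in> Ar C" "Dom C h = Q" "Cod C h = P" "\<And>j. j \<in> J \<Longrightarrow> \<pi> j \<cdot> h = \<rho> (inv_into I e j)" by metis
    then show ?thesis using eJ inv2 by (auto intro!: exI[of _ h])
  qed
  show "h = k" if "h \<in> Hom C Q P" "k \<in> Hom C Q P" "\<And>i. i \<in> I \<Longrightarrow> \<pi> (e i) \<cdot> h = \<pi> (e i) \<cdot> k" for Q h k
    using product_ext[OF P that(1,2)] that(3) inv by metis
qed

text \<open>The values of an arbitrary right adjoint are isomorphic to the chosen products; this
  makes them products as well, with explicit projections.\<close>

lemma product_transport:
  assumes P: "is_product C I X P \<pi>" and h: "is_iso C h" "h \<in> Hom C P' P"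
  shows "is_product C I X P' (\<lambda>i. \<pi> i \<cdot> h)"
proof -
  note ps[simp] = product_simps[OF P]
  obtain g where g[simp]: "g \<in> Ar C" "Dom C g = P" "Cod C g = P'" "g \<cdot> h = Id C P'" "h \<cdot> g = Id C P"
    and h'[simp]: "h \<in> Ar C" "Dom C h = P'" "Cod C h = P"
    using is_isoE[OF h(1)] h(2) by auto
  show ?thesis
  proof (rule productI)
    show "P' \<in> Ob C" using Dom_Ob[of h] by simp
    show "\<And>i. i \<in> I \<Longrightarrow> \<pi> i \<cdot> h \<in> Hom C P' (X i)" by simp
    show "\<exists>k. k \<in> Hom C Q P' \<and> (\<forall>i\<in>I. (\<pi> i \<cdot> h) \<cdot> k = \<rho> i)"
      if Q: "Q \<in> Ob C" and r: "\<And>i. i \<in> I \<Longrightarrow> \<rho> i \<in> Hom C Q (X i)" for Q \<rho>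
    proof -
      from product_lift[OF P Q r] obtain k where
        k: "k \<in> Ar C" "Dom C k = Q" "Cod C k = P" "\<And>j. j \<in> I \<Longrightarrow> \<pi> j \<cdot> k = \<rho> j" by metis
      have "h \<cdot> (g \<cdot> k) = k" using k assoc[of k g h] by simp
      then show ?thesis using k by (intro exI[of _ "g \<cdot> k"]) auto
    qed
    show "k = l" if kl: "k \<in> Hom C Q P'" "l \<in> Hom C Q P'" "\<And>i. i \<in> I \<Longrightarrow> (\<pi> i \<cdot> h) \<cdot> k = (\<pi> i \<cdot> h) \<cdot> l" for Q k l
    proof -
      have "h \<cdot> k = h \<cdot> l"
        by (rule product_ext[OF P, of _ Q]) (use kl in auto)
      then have "g \<cdot> (h \<cdot> k) = g \<cdot> (h \<cdot> l)" by simp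
      then show ?thesis using kl assoc[of k h g] assoc[of l h g] by simp
    qed
  qed
qed

text \<open>The inverse is the lift of the projections in the other direction: both composites have
  the same projections as an identity.\<close>

lemma product_unique:
  assumes P: "is_product C I X P \<pi>" and P': "is_product C I X P' \<pi>'"
    and h: "h \<in> Hom C P P'" "\<And>i. i \<in> I \<Longrightarrow> \<pi>' i \<cdot> h = \<pi> i"
  shows "is_iso C h"
proof -
  note ps[simp] = product_simps[OF P] product_simps[OF P']
  obtain g where g[simp]: "g \<in> Ar C" "Dom C g = P'" "Cod C g = P" "\<And>i. i \<in> I \<Longrightarrow> \<pi> i \<cdot> g = \<pi>' i"
    using product_lift[OF P, of P' \<pi>'] by auto
  have [simp]: "h \<in> Ar C" "Dom C h = P" "Cod C h = P'" using h by auto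
  have "g \<cdot> h = Id C P"
  proof (rule product_ext[OF P, of _ P])
    fix i assume i: "i \<in> I"
    then show "\<pi> i \<cdot> (g \<cdot> h) = \<pi> i \<cdot> Id C P" using assoc[of h g "\<pi> i"] h by simp
  qed auto
  moreover have "h \<cdot> g = Id C P'"
  proof (rule product_ext[OF P', of _ P'])
    fix i assume i: "i \<in> I"
    then show "\<pi>' i \<cdot> (h \<cdot> g) = \<pi>' i \<cdot> Id C P'" using assoc[of g h "\<pi>' i"] h by simp
  qed auto
  ultimately show ?thesis by (intro is_isoI[of h P P' g]) auto
qed

text \<open>The fibres of \<open>w\<close> partition \<open>J\<close>, so a family over
  \<open>J\<close> lifts first to each \<open>X i\<close> and then to \<open>P\<close>. A single
  \<open>\<rho>\<close>, indexed by \<open>J\<close>, serves all fibres because each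
  \<open>j\<close> lies in just one of them.\<close>

lemma product_of_products:
  assumes P: "is_product C I X P \<pi>"
    and R: "\<And>i. i \<in> I \<Longrightarrow> is_product C {j \<in> J. w j = i} Y (X i) \<rho>"
    and w: "\<And>j. j \<in> J \<Longrightarrow> w j \<in> I"
  shows "is_product C J Y P (\<lambda>j. \<rho> j \<cdot> \<pi> (w j))"
proof (rule productI)
  note ps[simp] = product_simps[OF P]
  have r[simp]: "\<rho> j \<in> Ar C" "Dom C (\<rho> j) = X (w j)" "Cod C (\<rho> j) = Y j" if "j \<in> J" for j
    using product_simps(2-4)[OF R[OF w[OF that]], of j] that by auto
  show "P \<in> Ob C" by simp
  show "\<And>j. j \<in> J \<Longrightarrow> \<rho> j \<cdot> \<pi> (w j) \<in> Hom C P (Y j)" using w by simp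
  show "\<exists>k. k \<in> Hom C Q P \<and> (\<forall>j\<in>J. (\<rho> j \<cdot> \<pi> (w j)) \<cdot> k = \<sigma> j)"
    if Q: "Q \<in> Ob C" and s: "\<And>j. j \<in> J \<Longrightarrow> \<sigma> j \<in> Hom C Q (Y j)" for Q \<sigma>
  proof -
    \<comment> \<open>Within the fibre over \<open>i\<close> the family lifts to \<open>X i\<close>;
      these lifts, chosen for all \<open>i\<close> at once, form the family that is lifted to
      \<open>P\<close>.\<close>
    have "\<exists>k. k \<in> Hom C Q (X i) \<and> (\<forall>j \<in> J. w j = i \<longrightarrow> \<rho> j \<cdot> k = \<sigma> j)" if "i \<in> I" for i
    proof -
      from product_lift[OF R[OF that] Q, of \<sigma>] s obtain k where
        "k \<in> Ar C" "Dom C k = Q" "Cod C k = X i" "\<And>j. j \<in> {j \<in> J. w j = i} \<Longrightarrow> \<rho> j \<cdot> k = \<sigma> j" by auto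
      then show ?thesis by auto
    qed
    then obtain \<kappa> where \<kappa>: "\<And>i. i \<in> I \<Longrightarrow> \<kappa> i \<in> Hom C Q (X i)"
      "\<And>j. j \<in> J \<Longrightarrow> \<rho> j \<cdot> \<kappa> (w j) = \<sigma> j" using w by metis
    from product_lift[OF P Q \<kappa>(1)] obtain k where
      k: "k \<in> Ar C" "Dom C k = Q" "Cod C k = P" "\<And>i. i \<in> I \<Longrightarrow> \<pi> i \<cdot> k = \<kappa> i" by metis
    then show ?thesis using \<kappa>(2) w by (intro exI[of _ k]) auto
  qed
  show "k = l" if kl: "k \<in> Hom C Q P" "l \<in> Hom C Q P"
    "\<And>j. j \<in> J \<Longrightarrow> (\<rho> j \<cdot> \<pi> (w j)) \<cdot> k = (\<rho> j \<cdot> \<pi> (w j)) \<cdot> l" for Q k l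
  proof (rule product_ext[OF P kl(1,2)])
    fix i assume i: "i \<in> I"
    show "\<pi> i \<cdot> k = \<pi> i \<cdot> l"
    proof (rule product_ext[OF R[OF i], of _ Q])
      show "\<rho> j \<cdot> (\<pi> i \<cdot> k) = \<rho> j \<cdot> (\<pi> i \<cdot> l)" if "j \<in> {j \<in> J. w j = i}" for j
        using kl(1,2) kl(3)[of j] that w by auto
    qed (use kl i in auto)
  qed
qed

lemma prod_cone_is_product:
  assumes "\<exists>P \<pi>. is_product C I X P \<pi>"
  shows "is_product C I X (prod_ob C I X) (prod_proj C I X)"
proof -
  have "\<exists>c. is_product C I X (fst c) (snd c)" using assms by auto
  from someI_ex[OF this] show ?thesis unfolding prod_ob_def prod_proj_def prod_cone_def .
qed

lemma prod_tuple:
  assumes "\<exists>P \<pi>. is_product C I X P \<pi>" "Q \<in> Ob C" "\<And>i. i \<in> I \<Longrightarrow> \<rho> i \<in> Hom C Q (X i)"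
  shows "prod_tuple C I X Q \<rho> \<in> Ar C" "Dom C (prod_tuple C I X Q \<rho>) = Q"
    "Cod C (prod_tuple C I X Q \<rho>) = prod_ob C I X"
    "i \<in> I \<Longrightarrow> prod_proj C I X i \<cdot> prod_tuple C I X Q \<rho> = \<rho> i"
proof -
  have "\<exists>!h. h \<in> Hom C Q (prod_ob C I X) \<and> (\<forall>i \<in> I. prod_proj C I X i \<cdot> h = \<rho> i)"
    by (rule product_ex1[OF prod_cone_is_product[OF assms(1)]]) (use assms(2,3) in blast)+
  from theI'[OF this] show "prod_tuple C I X Q \<rho> \<in> Ar C" "Dom C (prod_tuple C I X Q \<rho>) = Q"
    "Cod C (prod_tuple C I X Q \<rho>) = prod_ob C I X"
    "i \<in> I \<Longrightarrow> prod_proj C I X i \<cdot> prod_tuple C I X Q \<rho> = \<rho> i"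
    unfolding prod_tuple_def[symmetric] by auto
qed

end

text \<open>Completeness and exactness of products quantify over subsets of the universe
  \<open>'u\<close>, while the index sets that occur consist of functors and simplices. An injection
  into \<open>'u\<close> bridges the two.\<close>

definition small :: "'u itself \<Rightarrow> 'i set \<Rightarrow> bool" where
  "small U I \<longleftrightarrow> (\<exists>e :: 'i \<Rightarrow> 'u. inj_on e I)"

text \<open>Limits over the discrete category on the image of \<open>I\<close> in the universe.\<close>

lemma complete_has_product:
  assumes "category A" "complete_category TYPE('u) A" "small TYPE('u) (I :: 'i set)"
    and X: "\<And>i. i \<in> I \<Longrightarrow> X i \<in> Ob A"
  shows "\<exists>P \<pi>. is_product A I X P \<pi>"
proof -
  interpret A: category A by fact
  obtain e :: "'i \<Rightarrow> 'u" where e: "inj_on e I" using assms(3) unfolding small_def by auto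
  define J :: "('u, 'u) cat" where
    "J = \<lparr>Ob = e ` I, Ar = e ` I, Dom = id, Cod = id, Id = id, Comp = (\<lambda>g f. f)\<rparr>"
  define Y where "Y j = X (inv_into I e j)" for j
  have Y: "\<And>j. j \<in> e ` I \<Longrightarrow> Y j \<in> Ob A" unfolding Y_def by (intro X inv_into_into)
  define D where "D = \<lparr>FO = (\<lambda>j \<in> e ` I. Y j), FM = (\<lambda>j \<in> e ` I. Id A (Y j))\<rparr>"
  have "category J" unfolding J_def by unfold_locales auto
  moreover have "is_functor J A D"
    unfolding is_functor_def J_def D_def using Y by auto
  ultimately obtain L \<pi> where L: "is_limit A J D L \<pi>"
    using assms(2) unfolding complete_category_def by blast
  have cone: "is_cone A J D Q \<rho> \<longleftrightarrow> Q \<in> Ob A \<and> (\<forall>j \<in> e ` I. \<rho> j \<in> Hom A Q (Y j))" for Q \<rho>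
    unfolding is_cone_def J_def D_def by auto
  have "is_product A (e ` I) Y L \<pi>"
    using L unfolding is_limit_def cone unfolding is_product_def J_def by simp
  from A.product_reindex[OF _ this, of e I] e
  have "is_product A I (\<lambda>i. Y (e i)) L (\<lambda>i. \<pi> (e i))" by (simp add: bij_betw_def)
  then have "is_product A I X L (\<lambda>i. \<pi> (e i))"
    by (rule A.product_cong) (use e in \<open>auto simp: Y_def\<close>)
  then show ?thesis by blast
qed

text \<open>A bijection from a subset of the universe to \<open>I\<close> reindexes the three
  products. The product objects and the arrows \<open>h\<close> and \<open>k\<close> between them
  stay the same, so the conclusion transfers unchanged.\<close>

lemma exact_products_small:
  assumes "category A" "exact_products TYPE('u) A" "small TYPE('u) (I :: 'i set)"
    and fg: "\<And>i. i \<in> I \<Longrightarrow> f i \<in> Hom A (X i) (Y i)" "\<And>i. i \<in> I \<Longrightarrow> g i \<in> Hom A (Y i) (Z i)"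
      "\<And>i. i \<in> I \<Longrightarrow> short_exact A (f i) (g i)"
    and P: "is_product A I X P \<pi>" and Q: "is_product A I Y Q \<rho>" and R: "is_product A I Z R \<sigma>"
    and h: "h \<in> Hom A P Q" "\<And>i. i \<in> I \<Longrightarrow> \<rho> i \<cdot>\<^bsub>A\<^esub> h = f i \<cdot>\<^bsub>A\<^esub> \<pi> i"
    and k: "k \<in> Hom A Q R" "\<And>i. i \<in> I \<Longrightarrow> \<sigma> i \<cdot>\<^bsub>A\<^esub> k = g i \<cdot>\<^bsub>A\<^esub> \<rho> i"
  shows "short_exact A h k"
proof -
  interpret A: category A by fact
  obtain e :: "'i \<Rightarrow> 'u" where e: "inj_on e I" using assms(3) unfolding small_def by auto
  define i where "i = inv_into I e"
  have bij: "bij_betw i (e ` I) I" unfolding i_def using e by (simp add: bij_betw_inv_into inj_on_imp_bij_betw)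
  then have i: "\<And>j. j \<in> e ` I \<Longrightarrow> i j \<in> I" using bij_betwE by blast
  have bi: "(\<And>i. i \<in> I \<Longrightarrow> Q' i) \<Longrightarrow> \<forall>j \<in> e ` I. Q' (i j)" for Q' using i by blast
  note ep = assms(2)[unfolded exact_products_def, THEN spec[where x = "e ` I"],
      THEN spec[where x = "\<lambda>j. X (i j)"], THEN spec[where x = "\<lambda>j. Y (i j)"], THEN spec[where x = "\<lambda>j. Z (i j)"],
      THEN spec[where x = "\<lambda>j. f (i j)"], THEN spec[where x = "\<lambda>j. g (i j)"],
      THEN spec[where x = P], THEN spec[where x = Q], THEN spec[where x = R],
      THEN spec[where x = "\<lambda>j. \<pi> (i j)"], THEN spec[where x = "\<lambda>j. \<rho> (i j)"], THEN spec[where x = "\<lambda>j. \<sigma> (i j)"],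
      THEN spec[where x = h], THEN spec[where x = k], THEN mp]
  show ?thesis
    by (rule ep, intro conjI bi A.product_reindex[OF bij] P Q R h k)
      (use fg in blast)+
qed

section \<open>Preadditive and abelian categories\<close>

text \<open>Facts on kernels and monics, applied to the dual category, yield those on cokernels and
  epics.\<close>

definition opc :: "('o, 'm, 'z) pcat_scheme \<Rightarrow> ('o, 'm) pcat" where
  "opc A = \<lparr>Ob = Ob A, Ar = Ar A, Dom = Cod A, Cod = Dom A, Id = Id A, Comp = (\<lambda>g f. f \<cdot>\<^bsub>A\<^esub> g),
    HZero = (\<lambda>a b. HZero A b a), HAdd = HAdd A\<rparr>"

lemma opc_simps [simp]:
  "Ob (opc A) = Ob A" "Ar (opc A) = Ar A" "Dom (opc A) = Cod A" "Cod (opc A) = Dom A"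
  "Id (opc A) = Id A" "g \<cdot>\<^bsub>opc A\<^esub> f = f \<cdot>\<^bsub>A\<^esub> g" "HZero (opc A) a b = HZero A b a" "HAdd (opc A) = HAdd A"
  by (simp_all add: opc_def)

lemma opc_dual [simp]:
  "is_kernel (opc A) k f \<longleftrightarrow> is_cokernel A k f" "is_cokernel (opc A) k f \<longleftrightarrow> is_kernel A k f"
  "monic (opc A) f \<longleftrightarrow> epic A f" "epic (opc A) f \<longleftrightarrow> monic A f"
  unfolding is_kernel_def is_cokernel_def monic_def epic_def by (auto simp: conj_ac)

lemma opc_is_iso [simp]: "is_iso (opc A) f \<longleftrightarrow> is_iso A f"
  unfolding is_iso_def by auto

lemma opc_category: "category A \<Longrightarrow> category (opc A)"
proof -
  assume "category A"
  then interpret category A .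
  show ?thesis by unfold_locales auto
qed

lemma hom_group_simps [simp]:
  "carrier (hom_group A a b) = Hom A a b" "mult (hom_group A a b) = HAdd A" "one (hom_group A a b) = HZero A a b"
  by (simp_all add: hom_group_def)

section \<open>Kernels, cokernels and zero objects\<close>

context preadditive_category
begin

lemma opc_preadditive: "preadditive_category (opc A)"
proof (intro preadditive_category.intro opc_category preadditive_category_axioms.intro)
  show "category A" by unfold_locales
  have "hom_group (opc A) a b = hom_group A b a" for a b
    unfolding hom_group_def by auto
  then show "comm_group (hom_group (opc A) a b)" if "a \<in> Ob (opc A)" "b \<in> Ob (opc A)" for a b
    using that hom_comm_group by simp
  show "HAdd (opc A) g g' \<cdot>\<^bsub>opc A\<^esub> f = HAdd (opc A) (g \<cdot>\<^bsub>opc A\<^esub> f) (g' \<cdot>\<^bsub>opc A\<^esub> f)"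
    if "f \<in> Hom (opc A) a b" "g \<in> Hom (opc A) b c" "g' \<in> Hom (opc A) b c" for f g g' a b c
    using that Comp_add_right[of g c b g' f a] by simp
  show "g \<cdot>\<^bsub>opc A\<^esub> HAdd (opc A) f f' = HAdd (opc A) (g \<cdot>\<^bsub>opc A\<^esub> f) (g \<cdot>\<^bsub>opc A\<^esub> f')"
    if "f \<in> Hom (opc A) a b" "f' \<in> Hom (opc A) a b" "g \<in> Hom (opc A) b c" for f f' g a b c
    using that Comp_add_left[of g c b f a f'] by simp
qed

lemma HZero_simps [simp]:
  assumes "a \<in> Ob A" "b \<in> Ob A"
  shows "HZero A a b \<in> Ar A" "Dom A (HZero A a b) = a" "Cod A (HZero A a b) = b"
proof -
  interpret comm_group "hom_group A a b" using assms by (rule hom_comm_group)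
  show "HZero A a b \<in> Ar A" "Dom A (HZero A a b) = a" "Cod A (HZero A a b) = b"
    using one_closed by auto
qed

lemma HAdd_simps [simp]:
  assumes "f \<in> Ar A" "g \<in> Ar A" "Dom A f = Dom A g" "Cod A f = Cod A g"
  shows "HAdd A f g \<in> Ar A" "Dom A (HAdd A f g) = Dom A g" "Cod A (HAdd A f g) = Cod A g"
proof -
  interpret comm_group "hom_group A (Dom A g) (Cod A g)" using assms by (intro hom_comm_group) auto
  show "HAdd A f g \<in> Ar A" "Dom A (HAdd A f g) = Dom A g" "Cod A (HAdd A f g) = Cod A g"
    using m_closed[of f g] assms by auto
qed

lemma comp_HAdd:
  assumes "f \<in> Ar A" "f' \<in> Ar A" "Dom A f = Dom A f'" "Cod A f = Cod A f'" "g \<in> Ar A" "Dom A g = Cod A f'"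
  shows "g \<cdot> HAdd A f f' = HAdd A (g \<cdot> f) (g \<cdot> f')"
  using Comp_add_right[of f "Dom A f'" "Cod A f'" f' g] assms by simp

lemma HAdd_comp:
  assumes "g \<in> Ar A" "g' \<in> Ar A" "Dom A g = Dom A g'" "Cod A g = Cod A g'" "f \<in> Ar A" "Cod A f = Dom A g'"
  shows "HAdd A g g' \<cdot> f = HAdd A (g \<cdot> f) (g' \<cdot> f)"
  using Comp_add_left[of f "Dom A f" "Dom A g'" g "Cod A g'" g'] assms by simp

text \<open>Phrased as a group homomorphism, bilinearity of composition yields preservation of zero,
  of inverses and, later, of alternating sums.\<close>

lemma comp_hom:
  assumes "g \<in> Ar A" "a \<in> Ob A"
  shows "group_hom (hom_group A a (Dom A g)) (hom_group A a (Cod A g)) (\<lambda>f. g \<cdot> f)"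
proof -
  interpret G: comm_group "hom_group A a (Dom A g)" using assms by (intro hom_comm_group) auto
  interpret H: comm_group "hom_group A a (Cod A g)" using assms by (intro hom_comm_group) auto
  show ?thesis
    by unfold_locales (use assms comp_HAdd in \<open>auto simp: hom_def\<close>)
qed

lemma hom_comp:
  assumes "f \<in> Ar A" "c \<in> Ob A"
  shows "group_hom (hom_group A (Cod A f) c) (hom_group A (Dom A f) c) (\<lambda>g. g \<cdot> f)"
proof -
  interpret G: comm_group "hom_group A (Cod A f) c" using assms by (intro hom_comm_group) auto
  interpret H: comm_group "hom_group A (Dom A f) c" using assms by (intro hom_comm_group) auto
  show ?thesis
    by unfold_locales (use assms HAdd_comp in \<open>auto simp: hom_def\<close>)
qed

lemma comp_zero [simp]:
  assumes "g \<in> Ar A" "a \<in> Ob A" "Dom A g = b"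
  shows "g \<cdot> HZero A a b = HZero A a (Cod A g)"
  using group_hom.hom_one[OF comp_hom[OF assms(1,2)]] assms(3) by simp

lemma zero_comp [simp]:
  assumes "f \<in> Ar A" "c \<in> Ob A" "Cod A f = b"
  shows "HZero A b c \<cdot> f = HZero A (Dom A f) c"
  using group_hom.hom_one[OF hom_comp[OF assms(1,2)]] assms(3) by simp

text \<open>If two arrows agree after \<open>f\<close>, then \<open>f\<close> kills their
  difference, which the assumption makes zero.\<close>

lemma monicI:
  assumes f: "f \<in> Ar A" and z: "\<And>h. h \<in> Ar A \<Longrightarrow> Cod A h = Dom A f \<Longrightarrow>
    f \<cdot> h = HZero A (Dom A h) (Cod A f) \<Longrightarrow> h = HZero A (Dom A h) (Dom A f)"
  shows "monic A f"
  unfolding monic_def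
proof (intro conjI f allI ballI impI)
  fix a g h assume gh: "g \<in> Hom A a (Dom A f)" "h \<in> Hom A a (Dom A f)" "f \<cdot> g = f \<cdot> h"
  then have a: "a \<in> Ob A" using Dom_Ob[of g] by auto
  interpret G: comm_group "hom_group A a (Dom A f)" using a f by (intro hom_comm_group) auto
  interpret H: comm_group "hom_group A a (Cod A f)" using a f by (intro hom_comm_group) auto
  interpret \<phi>: group_hom "hom_group A a (Dom A f)" "hom_group A a (Cod A f)" "\<lambda>g. f \<cdot> g"
    by (rule comp_hom[OF f a])
  \<comment> \<open>The hom groups are written multiplicatively: this is the difference of
    \<open>g\<close> and \<open>h\<close>.\<close>
  let ?d = "g \<otimes>\<^bsub>hom_group A a (Dom A f)\<^esub> inv\<^bsub>hom_group A a (Dom A f)\<^esub> h"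
  have d: "?d \<in> carrier (hom_group A a (Dom A f))" using gh by (intro G.m_closed G.inv_closed) auto
  have "f \<cdot> ?d = (f \<cdot> g) \<otimes>\<^bsub>hom_group A a (Cod A f)\<^esub> inv\<^bsub>hom_group A a (Cod A f)\<^esub> (f \<cdot> h)"
    using \<phi>.hom_mult[of g "inv\<^bsub>hom_group A a (Dom A f)\<^esub> h"] \<phi>.hom_inv[of h] gh G.inv_closed[of h] by simp
  also have "\<dots> = \<one>\<^bsub>hom_group A a (Cod A f)\<^esub>"
    unfolding gh(3) by (rule H.r_inv) (use gh f in auto)
  finally have "?d = \<one>\<^bsub>hom_group A a (Dom A f)\<^esub>"
    using z[of ?d] d by simp
  then show "g = h" using G.inv_equality[of g "inv\<^bsub>hom_group A a (Dom A f)\<^esub> h"] G.inv_inv[of h] G.inv_closed[of h] gh by simp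
qed

lemma monicD: "monic A f \<Longrightarrow> g \<in> Ar A \<Longrightarrow> h \<in> Ar A \<Longrightarrow> Cod A g = Dom A f \<Longrightarrow> Cod A h = Dom A f \<Longrightarrow>
  Dom A g = Dom A h \<Longrightarrow> f \<cdot> g = f \<cdot> h \<Longrightarrow> g = h"
  unfolding monic_def by auto

lemma kernelD:
  assumes "is_kernel A k f"
  shows "f \<in> Ar A" "k \<in> Ar A" "Cod A k = Dom A f" "f \<cdot> k = HZero A (Dom A k) (Cod A f)"
  using assms unfolding is_kernel_def by blast+

lemma kernel_lift:
  assumes "is_kernel A k f" "h \<in> Ar A" "Cod A h = Dom A f" "f \<cdot> h = HZero A (Dom A h) (Cod A f)"
  obtains l where "l \<in> Ar A" "Dom A l = Dom A h" "Cod A l = Dom A k" "k \<cdot> l = h"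
proof -
  have "\<exists>!l. l \<in> Hom A (Dom A h) (Dom A k) \<and> k \<cdot> l = h"
    by (rule assms(1)[unfolded is_kernel_def, THEN conjunct2, THEN conjunct2, THEN conjunct2, THEN conjunct2,
      THEN bspec, THEN mp]) (use assms(2-4) in blast)+
  then obtain l where "l \<in> Hom A (Dom A h) (Dom A k)" "k \<cdot> l = h" by blast
  then show ?thesis using that[of l] by simp
qed

lemma kernel_monic:
  assumes "is_kernel A k f" shows "monic A k"
  unfolding monic_def
proof (intro conjI allI ballI impI)
  note ks[simp] = kernelD[OF assms]
  show "k \<in> Ar A" by simp
  fix a g h assume gh: "g \<in> Hom A a (Dom A k)" "h \<in> Hom A a (Dom A k)" "k \<cdot> g = k \<cdot> h"
  then have a: "a \<in> Ob A" using Dom_Ob[of g] by auto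
  have "f \<cdot> (k \<cdot> g) = (f \<cdot> k) \<cdot> g" using gh by (intro assoc[symmetric]) auto
  also have "\<dots> = HZero A a (Cod A f)" using gh by simp
  finally have "\<exists>!l. l \<in> Hom A (Dom A (k \<cdot> g)) (Dom A k) \<and> k \<cdot> l = k \<cdot> g"
    using assms[unfolded is_kernel_def, THEN conjunct2, THEN conjunct2, THEN conjunct2, THEN conjunct2,
      THEN bspec, of "k \<cdot> g"] gh by simp
  then show "g = h" using gh by (elim ex1E) (simp, metis)
qed

lemma kernelI:
  assumes f: "f \<in> Ar A" and k: "monic A k" and c: "Cod A k = Dom A f" "f \<cdot> k = HZero A (Dom A k) (Cod A f)"
    and l: "\<And>h. h \<in> Ar A \<Longrightarrow> Cod A h = Dom A f \<Longrightarrow> f \<cdot> h = HZero A (Dom A h) (Cod A f) \<Longrightarrow>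
       \<exists>l. l \<in> Hom A (Dom A h) (Dom A k) \<and> k \<cdot> l = h"
  shows "is_kernel A k f"
  unfolding is_kernel_def
proof (intro conjI f c ballI impI)
  show "k \<in> Ar A" using k by (simp add: monic_def)
  fix h assume h: "h \<in> Ar A" "Cod A h = Dom A f \<and> f \<cdot> h = HZero A (Dom A h) (Cod A f)"
  then obtain l where l: "l \<in> Hom A (Dom A h) (Dom A k)" "k \<cdot> l = h" using l by blast
  show "\<exists>!l. l \<in> Hom A (Dom A h) (Dom A k) \<and> k \<cdot> l = h"
  proof (rule ex1I[of _ l])
    fix l' assume "l' \<in> Hom A (Dom A h) (Dom A k) \<and> k \<cdot> l' = h"
    then show "l' = l" using monicD[OF k, of l' l] l by simp
  qed (use l in blast)
qed

text \<open>With the next lemma, being monic amounts to having a zero kernel, a condition that can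
  be read componentwise in a functor category.\<close>

lemma monic_kernel_zero:
  assumes "monic A t" "is_kernel A k t"
  shows "k = HZero A (Dom A k) (Dom A t)"
  by (rule monicD[OF assms(1)]) (use kernelD[OF assms(2)] Dom_Ob[of k] Dom_Ob[of t] in auto)

lemma zero_kernel_monic:
  assumes k: "is_kernel A (HZero A a (Dom A t)) t" and a: "a \<in> Ob A"
  shows "monic A t"
proof (rule monicI)
  note ks = kernelD[OF k]
  show "t \<in> Ar A" using ks by simp
  fix h assume h: "h \<in> Ar A" "Cod A h = Dom A t" "t \<cdot> h = HZero A (Dom A h) (Cod A t)"
  obtain l where "l \<in> Ar A" "Dom A l = Dom A h" "Cod A l = a" "HZero A a (Dom A t) \<cdot> l = h"
    using kernel_lift[OF k h] a ks(1) by auto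
  then show "h = HZero A (Dom A h) (Dom A t)" using ks(1) by auto
qed

text \<open>Each of the two kernels factors through the other, and monicity makes the factors
  mutually inverse.\<close>

lemma kernel_unique:
  assumes k: "is_kernel A k f" and k': "is_kernel A k' f"
  obtains i where "is_iso A i" "Dom A i = Dom A k'" "Cod A i = Dom A k" "k' = k \<cdot> i"
proof -
  note [simp] = kernelD[OF k] kernelD[OF k']
  obtain i where i[simp]: "i \<in> Ar A" "Dom A i = Dom A k'" "Cod A i = Dom A k" "k \<cdot> i = k'"
    using kernel_lift[OF k, of k'] by auto
  obtain j where j[simp]: "j \<in> Ar A" "Dom A j = Dom A k" "Cod A j = Dom A k'" "k' \<cdot> j = k"
    using kernel_lift[OF k', of k] by auto
  have "j \<cdot> i = Id A (Dom A k')"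
    by (rule monicD[OF kernel_monic[OF k']]) (simp_all add: assoc_eq[OF j(4)])
  moreover have "i \<cdot> j = Id A (Dom A k)"
    by (rule monicD[OF kernel_monic[OF k]]) (simp_all add: assoc_eq[OF i(4)])
  ultimately have "is_iso A i" by (intro is_isoI[of i "Dom A k'" "Dom A k" j]) auto
  then show ?thesis by (rule that) auto
qed

text \<open>Together with uniqueness, this moves a known description of one kernel to any other
  kernel of the same arrow.\<close>

lemma kernel_iso:
  assumes k: "is_kernel A k f" and i: "is_iso A i" "Cod A i = Dom A k"
  shows "is_kernel A (k \<cdot> i) f"
proof (rule kernelI)
  note [simp] = kernelD[OF k]
  obtain j where j[simp]: "i \<in> Ar A" "j \<in> Ar A" "Dom A j = Cod A i" "Cod A j = Dom A i"
    "j \<cdot> i = Id A (Dom A i)" "i \<cdot> j = Id A (Cod A i)" using is_isoE[OF i(1)] .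
  note [simp] = i(2)
  show "f \<in> Ar A" "Cod A (k \<cdot> i) = Dom A f" by auto
  show "f \<cdot> (k \<cdot> i) = HZero A (Dom A (k \<cdot> i)) (Cod A f)" using assoc[of i k f] by (simp del: assoc)
  show "monic A (k \<cdot> i)" unfolding monic_def
  proof (intro conjI allI ballI impI)
    fix a g h assume gh: "g \<in> Hom A a (Dom A (k \<cdot> i))" "h \<in> Hom A a (Dom A (k \<cdot> i))" "(k \<cdot> i) \<cdot> g = (k \<cdot> i) \<cdot> h"
    have "i \<cdot> g = i \<cdot> h" by (rule monicD[OF kernel_monic[OF k]]) (use gh in auto)
    then show "g = h" using assoc[of g i j] assoc[of h i j] gh by simp
  qed simp
  fix h assume h: "h \<in> Ar A" "Cod A h = Dom A f" "f \<cdot> h = HZero A (Dom A h) (Cod A f)"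
  obtain l where l: "l \<in> Ar A" "Dom A l = Dom A h" "Cod A l = Dom A k" "k \<cdot> l = h"
    using kernel_lift[OF k h] .
  then show "\<exists>l. l \<in> Hom A (Dom A h) (Dom A (k \<cdot> i)) \<and> (k \<cdot> i) \<cdot> l = h"
    using assoc[of l j i] by (intro exI[of _ "j \<cdot> l"]) auto
qed

lemma cokernelD:
  assumes "is_cokernel A c f"
  shows "f \<in> Ar A" "c \<in> Ar A" "Dom A c = Cod A f" "c \<cdot> f = HZero A (Dom A f) (Cod A c)"
  using assms unfolding is_cokernel_def by blast+

text \<open>Since \<open>f\<close> kills \<open>k\<close>, it factors through the cokernel
  \<open>c\<close>; so whatever \<open>c\<close> kills is killed by \<open>f\<close> and hence
  factors through \<open>k\<close>.\<close>

lemma kernel_of_cokernel: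
  assumes k: "is_kernel A k f" and c: "is_cokernel A c k"
  shows "is_kernel A k c"
proof (rule kernelI)
  note [simp] = kernelD[OF k] cokernelD[OF c]
  show "monic A k" by (rule kernel_monic[OF k])
  fix h assume h: "h \<in> Ar A" "Cod A h = Dom A c" "c \<cdot> h = HZero A (Dom A h) (Cod A c)"
  interpret op: preadditive_category "opc A" by (rule opc_preadditive)
  obtain d where d[simp]: "d \<in> Ar A" "Cod A d = Cod A f" "Dom A d = Cod A c" "d \<cdot> c = f"
    using op.kernel_lift[of c k f] c by auto
  have "f \<cdot> h = d \<cdot> (c \<cdot> h)" using h assoc[of h c d] by simp
  then have "f \<cdot> h = HZero A (Dom A h) (Cod A f)" using h by simp
  then show "\<exists>l. l \<in> Hom A (Dom A h) (Dom A k) \<and> k \<cdot> l = h"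
    using kernel_lift[OF k, of h] h by auto
qed (use kernelD[OF k] cokernelD[OF c] in auto)

text \<open>Duals, read off in \<open>opc A\<close>. The exchange of domain and codomain accounts
  for the order of the conjuncts in the existence conditions that are met when these rules are
  applied.\<close>

lemmas epicI = preadditive_category.monicI[OF opc_preadditive, simplified]
lemmas epicD = preadditive_category.monicD[OF opc_preadditive, simplified]
lemmas cokernel_lift = preadditive_category.kernel_lift[OF opc_preadditive, simplified]
lemmas cokernel_epic = preadditive_category.kernel_monic[OF opc_preadditive, simplified]
lemmas cokernelI = preadditive_category.kernelI[OF opc_preadditive, simplified]
lemmas epic_cokernel_zero = preadditive_category.monic_kernel_zero[OF opc_preadditive, simplified]
lemmas zero_cokernel_epic = preadditive_category.zero_kernel_monic[OF opc_preadditive, simplified]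
lemmas cokernel_unique = preadditive_category.kernel_unique[OF opc_preadditive, simplified]
lemmas cokernel_iso = preadditive_category.kernel_iso[OF opc_preadditive, simplified]
lemmas cokernel_of_kernel = preadditive_category.kernel_of_cokernel[OF opc_preadditive, simplified]

text \<open>\<open>f\<close> is its own image, with \<open>g\<close> as the cokernel that
  \<open>is_image\<close> asks for.\<close>

lemma short_exactI:
  assumes "is_kernel A f g" "is_cokernel A g f"
  shows "short_exact A f g"
  unfolding short_exact_def exact_at_def is_image_def
  using assms kernel_monic cokernel_epic kernelD(3) by blast

lemma zero_object_HZero:
  assumes "is_zero_object A z"
  shows "f \<in> Ar A \<Longrightarrow> Cod A f = z \<Longrightarrow> f = HZero A (Dom A f) z"
    and "f \<in> Ar A \<Longrightarrow> Dom A f = z \<Longrightarrow> f = HZero A z (Cod A f)"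
proof -
  have z: "z \<in> Ob A" and 1: "\<And>x. x \<in> Ob A \<Longrightarrow> \<exists>!f. f \<in> Hom A x z" and 2: "\<And>x. x \<in> Ob A \<Longrightarrow> \<exists>!f. f \<in> Hom A z x"
    using assms unfolding is_zero_object_def by blast+
  show "f = HZero A (Dom A f) z" if "f \<in> Ar A" "Cod A f = z"
  proof -
    have "f \<in> Hom A (Dom A f) z" "HZero A (Dom A f) z \<in> Hom A (Dom A f) z" using that z by auto
    then show ?thesis using 1[OF Dom_Ob[OF that(1)]] by (elim ex1E) metis
  qed
  show "f = HZero A z (Cod A f)" if "f \<in> Ar A" "Dom A f = z"
  proof -
    have "f \<in> Hom A z (Cod A f)" "HZero A z (Cod A f) \<in> Hom A z (Cod A f)" using that z by auto
    then show ?thesis using 2[OF Cod_Ob[OF that(1)]] by (elim ex1E) metis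
  qed
qed

text \<open>Turns a condition on all objects into one equation of arrows, which can be tested on
  components, on projections or after a monic.\<close>

lemma zero_object_iff: "is_zero_object A z \<longleftrightarrow> z \<in> Ob A \<and> Id A z = HZero A z z"
proof
  assume z: "is_zero_object A z"
  then have "z \<in> Ob A" unfolding is_zero_object_def by blast
  then show "z \<in> Ob A \<and> Id A z = HZero A z z" using zero_object_HZero(1)[OF z, of "Id A z"] by simp
next
  assume z: "z \<in> Ob A \<and> Id A z = HZero A z z"
  then have 1: "f = HZero A (Dom A f) z" if "f \<in> Ar A" "Cod A f = z" for f
    using that zero_comp[of f z z] Comp_Id_left[of f z] by simp
  have 2: "f = HZero A z (Cod A f)" if "f \<in> Ar A" "Dom A f = z" for f
    using z that comp_zero[of f z z] Comp_Id_right[of f z] by simp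
  show "is_zero_object A z" unfolding is_zero_object_def
  proof (intro conjI ballI)
    fix x assume x: "x \<in> Ob A"
    show "\<exists>!f. f \<in> Hom A x z" using x z 1 by (intro ex1I[of _ "HZero A x z"]) auto
    show "\<exists>!f. f \<in> Hom A z x" using x z 2 by (intro ex1I[of _ "HZero A z x"]) auto
  qed (use z in blast)
qed

lemma zero_object_Ob: "is_zero_object A z \<Longrightarrow> z \<in> Ob A"
  by (simp add: zero_object_iff)

text \<open>The arrow \<open>d\<close> into a zero object is itself a cokernel of the epic
  \<open>g\<close>, and the identity is a kernel of \<open>d\<close>. This is the exactness needed
  where the long exact sequence of an exact functor leaves degree 0.\<close>

lemma exact_at_epic:
  assumes g: "epic A g" and z: "is_zero_object A z" and d: "d \<in> Hom A (Cod A g) z"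
  shows "exact_at A g d"
proof -
  have [simp]: "g \<in> Ar A" using g by (simp add: epic_def)
  have zo[simp]: "z \<in> Ob A" by (rule zero_object_Ob[OF z])
  have d0: "d = HZero A (Cod A g) z" using zero_object_HZero(1)[OF z, of d] d by simp
  have k: "is_kernel A (Id A (Cod A g)) d"
  proof (rule kernelI)
    show "monic A (Id A (Cod A g))" unfolding monic_def by auto
    fix h assume "h \<in> Ar A" "Cod A h = Dom A d"
    then show "\<exists>l. l \<in> Hom A (Dom A h) (Dom A (Id A (Cod A g))) \<and> Id A (Cod A g) \<cdot> l = h"
      using d by (intro exI[of _ h]) auto
  qed (use d d0 in auto)
  have "is_cokernel A d g"
  proof (rule cokernelI)
    show "epic A d"
      by (rule epicI) (use d zero_object_HZero(2)[OF z] in auto)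
    fix h assume h: "h \<in> Ar A" "Dom A h = Cod A g" "h \<cdot> g = HZero A (Dom A g) (Cod A h)"
    have "h = HZero A (Cod A g) (Cod A h)"
      by (rule epicD[OF g]) (use h in auto)
    then show "\<exists>l. l \<in> Ar A \<and> Cod A l = Cod A h \<and> Dom A l = Cod A d \<and> l \<cdot> d = h"
      using h d d0 by (intro exI[of _ "HZero A z (Cod A h)"]) auto
  qed (use d d0 in auto)
  then show ?thesis unfolding exact_at_def is_image_def using k d by auto
qed

text \<open>The identity of \<open>z\<close> is at once a cokernel of \<open>f\<close>, a kernel of
  \<open>g\<close> and a kernel of itself.\<close>

lemma exact_at_zero:
  assumes z: "is_zero_object A z" and "f \<in> Ar A" "g \<in> Ar A" "Cod A f = z" "Dom A g = z"
  shows "exact_at A f g"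
proof -
  note [simp] = assms(2-5) zero_object_Ob[OF z]
  have m: "monic A (Id A z)" and e: "epic A (Id A z)" unfolding monic_def epic_def by auto
  have "is_kernel A (Id A z) t" if t: "t \<in> Ar A" "Dom A t = z" for t
  proof (rule kernelI[OF t(1) m])
    fix h assume "h \<in> Ar A" "Cod A h = Dom A t"
    then show "\<exists>l. l \<in> Hom A (Dom A h) (Dom A (Id A z)) \<and> Id A z \<cdot> l = h"
      using t by (intro exI[of _ h]) auto
  qed (use t zero_object_HZero[OF z] in auto)
  then have k: "is_kernel A (Id A z) g" "is_kernel A (Id A z) (Id A z)" by auto
  have "is_cokernel A (Id A z) f"
  proof (rule cokernelI[OF _ e])
    fix h assume "h \<in> Ar A" "Dom A h = Cod A f"
    then show "\<exists>l. l \<in> Ar A \<and> Cod A l = Cod A h \<and> Dom A l = Cod A (Id A z) \<and> l \<cdot> Id A z = h"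
      by (intro exI[of _ h]) auto
  qed (use zero_object_HZero[OF z] in auto)
  then show ?thesis unfolding exact_at_def is_image_def using k by auto
qed

end

context abelian_category
begin

text \<open>Here normality enters: a monic is a kernel of some arrow, hence a kernel of its own
  cokernel. So \<open>f\<close> agrees with its image up to isomorphism and is a kernel of
  \<open>g\<close>. Then \<open>g\<close>, being a cokernel of some arrow, is a cokernel of its
  kernel \<open>f\<close>.\<close>

lemma short_exact_kernel:
  assumes "short_exact A f g"
  shows "is_kernel A f g" "is_cokernel A g f"
proof -
  have f: "monic A f" and g: "epic A g" using assms unfolding short_exact_def by auto
  obtain m c where c: "is_cokernel A c f" and mc: "is_kernel A m c" and mg: "is_kernel A m g"
    using assms unfolding short_exact_def exact_at_def is_image_def by blast
  obtain h where "is_kernel A f h" using monic_is_kernel[OF f] by blast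
  then have "is_kernel A f c" by (rule kernel_of_cokernel[OF _ c])
  from kernel_unique[OF mc this] obtain i where i: "is_iso A i" "Dom A i = Dom A f" "Cod A i = Dom A m" "f = m \<cdot> i" .
  then show fg: "is_kernel A f g" using kernel_iso[OF mg i(1,3)] by simp
  obtain h where "is_cokernel A g h" using epic_is_cokernel[OF g] by blast
  then show "is_cokernel A g f" by (rule cokernel_of_kernel[OF _ fg])
qed

end

section \<open>Functor categories\<close>

lemma functor_simps:
  assumes "is_functor C D F"
  shows "a \<in> Ob C \<Longrightarrow> FO F a \<in> Ob D" "f \<in> Ar C \<Longrightarrow> FM F f \<in> Ar D"
    "f \<in> Ar C \<Longrightarrow> Dom D (FM F f) = FO F (Dom C f)" "f \<in> Ar C \<Longrightarrow> Cod D (FM F f) = FO F (Cod C f)"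
    "a \<in> Ob C \<Longrightarrow> FM F (Id C a) = Id D (FO F a)"
    "f \<in> Ar C \<Longrightarrow> g \<in> Ar C \<Longrightarrow> Cod C f = Dom C g \<Longrightarrow> FM F (g \<cdot>\<^bsub>C\<^esub> f) = FM F g \<cdot>\<^bsub>D\<^esub> FM F f"
  using assms unfolding is_functor_def by auto

text \<open>Both components are \<open>undefined\<close> off the source, so agreement on the source
  is equality.\<close>

lemma functor_eqI:
  fixes F G :: "('o, 'm, 'p, 'n) functor_data"
  assumes "is_functor C D F" "is_functor C D G"
    and "\<And>a. a \<in> Ob C \<Longrightarrow> FO F a = FO G a" "\<And>f. f \<in> Ar C \<Longrightarrow> FM F f = FM G f"
  shows "F = G"
proof -
  have "FO F = FO G" "FM F = FM G"
    using assms unfolding is_functor_def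
    by (auto intro!: extensionalityI[of "FO F" "Ob C"] extensionalityI[of "FM F" "Ar C"] simp: PiE_iff)
  then show ?thesis by simp
qed

text \<open>Restriction supplies the value \<open>undefined\<close> that functors must have off
  their source, so only the values on the source remain to be checked.\<close>

definition mk_functor :: "('o, 'm, 'z) cat_scheme \<Rightarrow> ('o \<Rightarrow> 'p) \<Rightarrow> ('m \<Rightarrow> 'n) \<Rightarrow> ('o, 'm, 'p, 'n) functor_data" where
  "mk_functor C \<phi> \<mu> = \<lparr>FO = restrict \<phi> (Ob C), FM = restrict \<mu> (Ar C)\<rparr>"

lemma mk_functor_simps [simp]:
  "a \<in> Ob C \<Longrightarrow> FO (mk_functor C \<phi> \<mu>) a = \<phi> a" "f \<in> Ar C \<Longrightarrow> FM (mk_functor C \<phi> \<mu>) f = \<mu> f"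
  by (simp_all add: mk_functor_def)

lemma (in category) mk_functorI:
  assumes "\<And>a. a \<in> Ob C \<Longrightarrow> \<phi> a \<in> Ob D" "\<And>f. f \<in> Ar C \<Longrightarrow> \<mu> f \<in> Hom D (\<phi> (Dom C f)) (\<phi> (Cod C f))"
    "\<And>a. a \<in> Ob C \<Longrightarrow> \<mu> (Id C a) = Id D (\<phi> a)"
    "\<And>f g. f \<in> Ar C \<Longrightarrow> g \<in> Ar C \<Longrightarrow> Cod C f = Dom C g \<Longrightarrow> \<mu> (g \<cdot> f) = \<mu> g \<cdot>\<^bsub>D\<^esub> \<mu> f"
  shows "is_functor C D (mk_functor C \<phi> \<mu>)"
  using assms unfolding is_functor_def mk_functor_def by auto

lemma (in category) fcomp_functor:
  assumes F: "is_functor C D F" and G: "is_functor D E G"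
  shows "is_functor C E (fcomp C G F)"
  using mk_functorI[of "\<lambda>a. FO G (FO F a)" E "\<lambda>f. FM G (FM F f)"]
    functor_simps[OF F] functor_simps[OF G]
  by (simp add: mk_functor_def fcomp_def restrict_def)

lemma fcomp_simps [simp]:
  "a \<in> Ob C \<Longrightarrow> FO (fcomp C G F) a = FO G (FO F a)" "f \<in> Ar C \<Longrightarrow> FM (fcomp C G F) f = FM G (FM F f)"
  by (simp_all add: fcomp_def)

lemma Fun_Ob: "F \<in> Ob (Fun C A) \<longleftrightarrow> is_functor C A F"
  by (simp add: Fun_def)

lemma Fun_NC [simp]:
  "a \<in> Ob C \<Longrightarrow> NC (s \<cdot>\<^bsub>Fun C A\<^esub> t) a = NC s a \<cdot>\<^bsub>A\<^esub> NC t a"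
  "a \<in> Ob C \<Longrightarrow> NC (Id (Fun C A) F) a = Id A (FO F a)"
  "a \<in> Ob C \<Longrightarrow> NC (HZero (Fun C A) F G) a = HZero A (FO F a) (FO G a)"
  "a \<in> Ob C \<Longrightarrow> NC (HAdd (Fun C A) s t) a = HAdd A (NC s a) (NC t a)"
  by (simp_all add: Fun_def)

lemma Fun_Ar_simps:
  assumes "t \<in> Ar (Fun C A)"
  shows "is_functor C A (Dom (Fun C A) t)" "is_functor C A (Cod (Fun C A) t)"
    "a \<in> Ob C \<Longrightarrow> NC t a \<in> Ar A" "a \<in> Ob C \<Longrightarrow> Dom A (NC t a) = FO (Dom (Fun C A) t) a"
    "a \<in> Ob C \<Longrightarrow> Cod A (NC t a) = FO (Cod (Fun C A) t) a"
  using assms by (auto simp: Fun_def nat_trans_def)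

lemma Fun_naturality:
  "t \<in> Ar (Fun C A) \<Longrightarrow> f \<in> Ar C \<Longrightarrow>
    NC t (Cod C f) \<cdot>\<^bsub>A\<^esub> FM (Dom (Fun C A) t) f = FM (Cod (Fun C A) t) f \<cdot>\<^bsub>A\<^esub> NC t (Dom C f)"
  by (auto simp: Fun_def nat_trans_def)

lemma Fun_eqI:
  assumes "s \<in> Ar (Fun C A)" "t \<in> Ar (Fun C A)" "Dom (Fun C A) s = Dom (Fun C A) t" "Cod (Fun C A) s = Cod (Fun C A) t"
    "\<And>a. a \<in> Ob C \<Longrightarrow> NC s a = NC t a"
  shows "s = t"
proof -
  have "NC s = NC t"
    using assms by (intro extensionalityI[of _ "Ob C"]) (auto simp: Fun_def nat_trans_def)
  then show ?thesis using assms(3,4) by (simp add: Fun_def)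
qed

lemma Fun_Hom: "t \<in> Hom (Fun C A) F G \<longleftrightarrow> nat_trans C A F G t"
  by (auto simp: Fun_def nat_trans_def)

definition mk_nt :: "('o, 'm, 'z) cat_scheme \<Rightarrow> ('o, 'm, 'p, 'n) functor_data \<Rightarrow> ('o, 'm, 'p, 'n) functor_data
    \<Rightarrow> ('o \<Rightarrow> 'n) \<Rightarrow> ('o, 'm, 'p, 'n) nt_data" where
  "mk_nt C F G \<eta> = \<lparr>NDom = F, NCod = G, NC = restrict \<eta> (Ob C)\<rparr>"

lemma mk_nt_simps [simp]:
  "a \<in> Ob C \<Longrightarrow> NC (mk_nt C F G \<eta>) a = \<eta> a" "Dom (Fun C A) (mk_nt C F G \<eta>) = F" "Cod (Fun C A) (mk_nt C F G \<eta>) = G"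
  by (simp_all add: mk_nt_def Fun_def)

lemma mk_ntI:
  assumes "is_functor C A F" "is_functor C A G" "\<And>a. a \<in> Ob C \<Longrightarrow> \<eta> a \<in> Hom A (FO F a) (FO G a)"
    "\<And>f. f \<in> Ar C \<Longrightarrow> \<eta> (Cod C f) \<cdot>\<^bsub>A\<^esub> FM F f = FM G f \<cdot>\<^bsub>A\<^esub> \<eta> (Dom C f)" "category C"
  shows "mk_nt C F G \<eta> \<in> Ar (Fun C A)"
proof -
  interpret category C by fact
  show ?thesis using assms by (auto simp: Fun_def nat_trans_def mk_nt_def)
qed

locale functor_category = C: category C + A: category A
  for C :: "('i, 'j, 'y) cat_scheme" and A :: "('o, 'm, 'z) pcat_scheme" (structure)
begin

lemma Fun_Dom_Cod [simp]:
  "Dom (Fun C A) (s \<cdot>\<^bsub>Fun C A\<^esub> t) = Dom (Fun C A) t" "Cod (Fun C A) (s \<cdot>\<^bsub>Fun C A\<^esub> t) = Cod (Fun C A) s"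
  "Dom (Fun C A) (Id (Fun C A) F) = F" "Cod (Fun C A) (Id (Fun C A) F) = F"
  "Dom (Fun C A) (HZero (Fun C A) F G) = F" "Cod (Fun C A) (HZero (Fun C A) F G) = G"
  "Dom (Fun C A) (HAdd (Fun C A) s t) = Dom (Fun C A) s" "Cod (Fun C A) (HAdd (Fun C A) s t) = Cod (Fun C A) s"
  by (simp_all add: Fun_def)

lemma Fun_comp_Ar:
  assumes s: "s \<in> Ar (Fun C A)" and t: "t \<in> Ar (Fun C A)" and st: "Cod (Fun C A) t = Dom (Fun C A) s"
  shows "s \<cdot>\<^bsub>Fun C A\<^esub> t \<in> Ar (Fun C A)"
proof -
  note [simp] = Fun_Ar_simps[OF s] Fun_Ar_simps[OF t] st
    functor_simps[OF Fun_Ar_simps(1)[OF s]] functor_simps[OF Fun_Ar_simps(2)[OF s]]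
    functor_simps[OF Fun_Ar_simps(1)[OF t]]
  have eq: "mk_nt C (Dom (Fun C A) t) (Cod (Fun C A) s) (\<lambda>a. NC s a \<cdot> NC t a) = s \<cdot>\<^bsub>Fun C A\<^esub> t"
    by (simp add: Fun_def mk_nt_def restrict_def)
  have "mk_nt C (Dom (Fun C A) t) (Cod (Fun C A) s) (\<lambda>a. NC s a \<cdot> NC t a) \<in> Ar (Fun C A)"
  proof (rule mk_ntI)
    fix f assume f[simp]: "f \<in> Ar C"
    have "(NC s (Cod C f) \<cdot> NC t (Cod C f)) \<cdot> FM (Dom (Fun C A) t) f
        = NC s (Cod C f) \<cdot> (FM (Dom (Fun C A) s) f \<cdot> NC t (Dom C f))"
      using Fun_naturality[OF t f] by simp
    also have "\<dots> = (FM (Cod (Fun C A) s) f \<cdot> NC s (Dom C f)) \<cdot> NC t (Dom C f)"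
      unfolding Fun_naturality[OF s f, symmetric] by (rule A.assoc[symmetric]) auto
    finally show "(NC s (Cod C f) \<cdot> NC t (Cod C f)) \<cdot> FM (Dom (Fun C A) t) f
        = FM (Cod (Fun C A) s) f \<cdot> (NC s (Dom C f) \<cdot> NC t (Dom C f))" by simp
  qed (auto intro: C.category_axioms)
  then show ?thesis unfolding eq .
qed

lemma Fun_Id_Ar:
  assumes "is_functor C A F"
  shows "Id (Fun C A) F \<in> Ar (Fun C A)"
proof -
  note [simp] = functor_simps[OF assms]
  have "mk_nt C F F (\<lambda>a. Id A (FO F a)) \<in> Ar (Fun C A)"
    by (rule mk_ntI) (auto intro: C.category_axioms assms)
  then show ?thesis by (simp add: Fun_def mk_nt_def restrict_def)
qed

lemma Fun_category: "category (Fun C A)"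
proof (unfold_locales, goal_cases)
  case (1 f) then show ?case by (simp add: Fun_Ob Fun_Ar_simps)
next
  case (2 f) then show ?case by (simp add: Fun_Ob Fun_Ar_simps)
next
  case (3 F) then show ?case by (simp add: Fun_Ob Fun_Id_Ar)
next
  case (4 f a b g c) then show ?case by (simp add: Fun_comp_Ar)
next
  case (5 f a b g c h d)
  then have fgh[simp]: "f \<in> Ar (Fun C A)" "g \<in> Ar (Fun C A)" "h \<in> Ar (Fun C A)"
    "Dom (Fun C A) f = a" "Cod (Fun C A) f = b" "Dom (Fun C A) g = b" "Cod (Fun C A) g = c"
    "Dom (Fun C A) h = c" "Cod (Fun C A) h = d"
    by auto
  show ?case
    by (rule Fun_eqI[of _ C A])
      (simp_all add: Fun_comp_Ar Fun_Ar_simps[OF fgh(1)] Fun_Ar_simps[OF fgh(2)] Fun_Ar_simps[OF fgh(3)])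
next
  case (6 f a b)
  then have f: "f \<in> Ar (Fun C A)" by simp
  then show ?case using 6 Fun_Ar_simps[OF f]
    by (intro Fun_eqI[of _ C A]) (auto intro!: Fun_comp_Ar Fun_Id_Ar)
next
  case (7 f a b)
  then have f: "f \<in> Ar (Fun C A)" by simp
  then show ?case using 7 Fun_Ar_simps[OF f]
    by (intro Fun_eqI[of _ C A]) (auto intro!: Fun_comp_Ar Fun_Id_Ar)
qed

sublocale Fun: category "Fun C A" by (rule Fun_category)

text \<open>Inverses of the components are chosen separately; the naturality of this family is
  inherited from \<open>t\<close>.\<close>

lemma Fun_isoI:
  assumes t: "t \<in> Ar (Fun C A)" and iso: "\<And>a. a \<in> Ob C \<Longrightarrow> is_iso A (NC t a)"
  shows "is_iso (Fun C A) t"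
proof -
  let ?F = "Dom (Fun C A) t" and ?G = "Cod (Fun C A) t"
  note [simp] = Fun_Ar_simps[OF t] functor_simps[OF Fun_Ar_simps(1)[OF t]] functor_simps[OF Fun_Ar_simps(2)[OF t]]
  have "\<exists>g. g \<in> Ar A \<and> Dom A g = FO ?G a \<and> Cod A g = FO ?F a \<and> g \<cdot> NC t a = Id A (FO ?F a) \<and>
      NC t a \<cdot> g = Id A (FO ?G a)" if "a \<in> Ob C" for a
    using A.is_isoE[OF iso[OF that]] that by auto
  then obtain \<eta> where \<eta>[simp]: "\<And>a. a \<in> Ob C \<Longrightarrow> \<eta> a \<in> Ar A" "\<And>a. a \<in> Ob C \<Longrightarrow> Dom A (\<eta> a) = FO ?G a"
    "\<And>a. a \<in> Ob C \<Longrightarrow> Cod A (\<eta> a) = FO ?F a" "\<And>a. a \<in> Ob C \<Longrightarrow> \<eta> a \<cdot> NC t a = Id A (FO ?F a)"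
    "\<And>a. a \<in> Ob C \<Longrightarrow> NC t a \<cdot> \<eta> a = Id A (FO ?G a)"
    by metis
  have s: "mk_nt C ?G ?F \<eta> \<in> Ar (Fun C A)"
  proof (rule mk_ntI)
    fix f assume f[simp]: "f \<in> Ar C"
    \<comment> \<open>The identity \<open>NC t (Dom C f) \<cdot> \<eta> (Dom C f)\<close> is
      inserted, so that naturality of \<open>t\<close> applies and a pair of inverses cancels at the
      codomain.\<close>
    have "\<eta> (Cod C f) \<cdot> FM ?G f = \<eta> (Cod C f) \<cdot> ((FM ?G f \<cdot> NC t (Dom C f)) \<cdot> \<eta> (Dom C f))"
      by simp
    also have "\<dots> = \<eta> (Cod C f) \<cdot> (NC t (Cod C f) \<cdot> (FM ?F f \<cdot> \<eta> (Dom C f)))"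
      unfolding Fun_naturality[OF t f, symmetric] by (subst A.assoc) auto
    also have "\<dots> = FM ?F f \<cdot> \<eta> (Dom C f)"
      by (subst A.assoc_eq[OF \<eta>(4)]) auto
    finally show "\<eta> (Cod C f) \<cdot> FM ?G f = FM ?F f \<cdot> \<eta> (Dom C f)" .
  qed (auto intro: C.category_axioms)
  show ?thesis
  proof (rule Fun.is_isoI[of t ?F ?G "mk_nt C ?G ?F \<eta>"])
    show "mk_nt C ?G ?F \<eta> \<cdot>\<^bsub>Fun C A\<^esub> t = Id (Fun C A) ?F"
      by (rule Fun_eqI[of _ C A]) (use s t in \<open>auto intro!: Fun_comp_Ar Fun_Id_Ar\<close>)
    show "t \<cdot>\<^bsub>Fun C A\<^esub> mk_nt C ?G ?F \<eta> = Id (Fun C A) ?G"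
      by (rule Fun_eqI[of _ C A]) (use s t in \<open>auto intro!: Fun_comp_Ar Fun_Id_Ar\<close>)
  qed (use s t in auto)
qed

lemma Fun_isoD:
  assumes iso: "is_iso (Fun C A) t" and a: "a \<in> Ob C"
  shows "is_iso A (NC t a)"
proof -
  obtain s where ts: "t \<in> Ar (Fun C A)" "s \<in> Ar (Fun C A)" "Dom (Fun C A) s = Cod (Fun C A) t" "Cod (Fun C A) s = Dom (Fun C A) t"
    "s \<cdot>\<^bsub>Fun C A\<^esub> t = Id (Fun C A) (Dom (Fun C A) t)" "t \<cdot>\<^bsub>Fun C A\<^esub> s = Id (Fun C A) (Cod (Fun C A) t)"
    using Fun.is_isoE[OF iso] .
  have "NC (s \<cdot>\<^bsub>Fun C A\<^esub> t) a = Id A (FO (Dom (Fun C A) t) a)" "NC (t \<cdot>\<^bsub>Fun C A\<^esub> s) a = Id A (FO (Cod (Fun C A) t) a)"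
    unfolding ts(5,6) using a by simp_all
  then show ?thesis
    using a ts(1-4) Fun_Ar_simps[OF ts(1)] Fun_Ar_simps[OF ts(2)] by (intro A.is_isoI[of _ _ _ "NC s a"]) auto
qed

end

locale additive_functor_category = functor_category C A + A: preadditive_category A
  for C :: "('i, 'j, 'y) cat_scheme" and A :: "('o, 'm, 'z) pcat_scheme" (structure)
begin

lemma Fun_HZero_Ar:
  assumes F: "is_functor C A F" and G: "is_functor C A G"
  shows "HZero (Fun C A) F G \<in> Ar (Fun C A)"
proof -
  note [simp] = functor_simps[OF F] functor_simps[OF G]
  have "mk_nt C F G (\<lambda>a. HZero A (FO F a) (FO G a)) \<in> Ar (Fun C A)"
    by (rule mk_ntI) (auto intro: C.category_axioms assms)
  then show ?thesis by (simp add: Fun_def mk_nt_def restrict_def)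
qed

lemma Fun_HAdd_Ar:
  assumes s: "s \<in> Ar (Fun C A)" and t: "t \<in> Ar (Fun C A)"
    and eq: "Dom (Fun C A) s = Dom (Fun C A) t" "Cod (Fun C A) s = Cod (Fun C A) t"
  shows "HAdd (Fun C A) s t \<in> Ar (Fun C A)"
proof -
  note [simp] = Fun_Ar_simps[OF s] Fun_Ar_simps[OF t] eq
    functor_simps[OF Fun_Ar_simps(1)[OF t]] functor_simps[OF Fun_Ar_simps(2)[OF t]]
  have "mk_nt C (Dom (Fun C A) t) (Cod (Fun C A) t) (\<lambda>a. HAdd A (NC s a) (NC t a)) \<in> Ar (Fun C A)"
    by (rule mk_ntI)
      (use Fun_naturality[OF s] Fun_naturality[OF t] in \<open>auto simp: A.comp_HAdd A.HAdd_comp intro: C.category_axioms\<close>)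
  then show ?thesis using eq by (simp add: Fun_def mk_nt_def restrict_def)
qed

text \<open>Componentwise negatives are natural because composition on either side with a fixed
  arrow is a homomorphism of hom groups.\<close>

lemma Fun_inverse:
  assumes t: "t \<in> Ar (Fun C A)"
  shows "\<exists>s. s \<in> Hom (Fun C A) (Dom (Fun C A) t) (Cod (Fun C A) t) \<and>
    HAdd (Fun C A) s t = HZero (Fun C A) (Dom (Fun C A) t) (Cod (Fun C A) t)"
proof -
  let ?F = "Dom (Fun C A) t" and ?G = "Cod (Fun C A) t"
  let ?H = "\<lambda>a. hom_group A (FO ?F a) (FO ?G a)"
  note [simp] = Fun_Ar_simps[OF t] functor_simps[OF Fun_Ar_simps(1)[OF t]] functor_simps[OF Fun_Ar_simps(2)[OF t]]
  define \<eta> where "\<eta> a = inv\<^bsub>?H a\<^esub> (NC t a)" for a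
  have cg: "comm_group (?H a)" if "a \<in> Ob C" for a
    using that by (intro A.hom_comm_group) auto
  have \<eta>: "\<eta> a \<in> carrier (?H a)" "\<eta> a \<otimes>\<^bsub>?H a\<^esub> NC t a = \<one>\<^bsub>?H a\<^esub>" if "a \<in> Ob C" for a
  proof -
    interpret comm_group "?H a" by (rule cg[OF that])
    have t: "NC t a \<in> carrier (?H a)" using that by simp
    show "\<eta> a \<in> carrier (?H a)" "\<eta> a \<otimes>\<^bsub>?H a\<^esub> NC t a = \<one>\<^bsub>?H a\<^esub>" unfolding \<eta>_def
      by (rule inv_closed[OF t], rule l_inv[OF t])
  qed
  note [simp] = \<eta>(1)[simplified]
  have s: "mk_nt C ?F ?G \<eta> \<in> Ar (Fun C A)"
  proof (rule mk_ntI)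
    fix f assume f[simp]: "f \<in> Ar C"
    interpret h1: group_hom "?H (Cod C f)" "hom_group A (FO ?F (Dom C f)) (FO ?G (Cod C f))" "\<lambda>g. g \<cdot> FM ?F f"
      using A.hom_comp[of "FM ?F f" "FO ?G (Cod C f)"] by simp
    interpret h2: group_hom "?H (Dom C f)" "hom_group A (FO ?F (Dom C f)) (FO ?G (Cod C f))" "\<lambda>g. FM ?G f \<cdot> g"
      using A.comp_hom[of "FM ?G f" "FO ?F (Dom C f)"] by simp
    show "\<eta> (Cod C f) \<cdot> FM ?F f = FM ?G f \<cdot> \<eta> (Dom C f)"
      unfolding \<eta>_def using h1.hom_inv[of "NC t (Cod C f)"] h2.hom_inv[of "NC t (Dom C f)"]
      by (simp add: Fun_naturality[OF t])
  qed (auto intro: C.category_axioms)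
  moreover have "HAdd (Fun C A) (mk_nt C ?F ?G \<eta>) t = HZero (Fun C A) ?F ?G"
    by (rule Fun_eqI[of _ C A])
      (use s t \<eta>(2) in \<open>auto intro!: Fun_HAdd_Ar Fun_HZero_Ar\<close>)
  ultimately show ?thesis by (intro exI[of _ "mk_nt C ?F ?G \<eta>"]) auto
qed

lemma Fun_preadditive: "preadditive_category (Fun C A)"
proof (intro preadditive_category.intro Fun_category preadditive_category_axioms.intro, goal_cases)
  case (1 F G)
  then have F: "is_functor C A F" and G: "is_functor C A G" by (auto simp: Fun_Ob)
  have cg: "comm_group (hom_group A (FO F a) (FO G a))" if "a \<in> Ob C" for a
    using that F G by (intro A.hom_comm_group) (auto simp: functor_simps)
  show ?case
  proof (rule comm_groupI)
    fix x y assume "x \<in> carrier (hom_group (Fun C A) F G)" "y \<in> carrier (hom_group (Fun C A) F G)"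
    then show "x \<otimes>\<^bsub>hom_group (Fun C A) F G\<^esub> y \<in> carrier (hom_group (Fun C A) F G)" by (simp add: Fun_HAdd_Ar)
  next
    show "\<one>\<^bsub>hom_group (Fun C A) F G\<^esub> \<in> carrier (hom_group (Fun C A) F G)" using F G by (simp add: Fun_HZero_Ar)
  next
    fix x y z assume 3: "x \<in> carrier (hom_group (Fun C A) F G)" "y \<in> carrier (hom_group (Fun C A) F G)" "z \<in> carrier (hom_group (Fun C A) F G)"
    have "HAdd A (HAdd A (NC x a) (NC y a)) (NC z a) = HAdd A (NC x a) (HAdd A (NC y a) (NC z a))" if a: "a \<in> Ob C" for a
      using comm_groupE(3)[OF cg[OF a], of "NC x a" "NC y a" "NC z a"] 3 a by (auto simp: Fun_Ar_simps)
    then show "(x \<otimes>\<^bsub>hom_group (Fun C A) F G\<^esub> y) \<otimes>\<^bsub>hom_group (Fun C A) F G\<^esub> z = x \<otimes>\<^bsub>hom_group (Fun C A) F G\<^esub> (y \<otimes>\<^bsub>hom_group (Fun C A) F G\<^esub> z)" using 3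
      by (intro Fun_eqI[of _ C A]) (auto intro!: Fun_HAdd_Ar)
  next
    fix x y assume 4: "x \<in> carrier (hom_group (Fun C A) F G)" "y \<in> carrier (hom_group (Fun C A) F G)"
    have "HAdd A (NC x a) (NC y a) = HAdd A (NC y a) (NC x a)" if a: "a \<in> Ob C" for a
      using comm_groupE(4)[OF cg[OF a], of "NC x a" "NC y a"] 4 a by (auto simp: Fun_Ar_simps)
    then show "x \<otimes>\<^bsub>hom_group (Fun C A) F G\<^esub> y = y \<otimes>\<^bsub>hom_group (Fun C A) F G\<^esub> x" using 4
      by (intro Fun_eqI[of _ C A]) (auto intro!: Fun_HAdd_Ar)
  next
    fix x assume 5: "x \<in> carrier (hom_group (Fun C A) F G)"
    have "HAdd A (HZero A (FO F a) (FO G a)) (NC x a) = NC x a" if a: "a \<in> Ob C" for a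
      using comm_groupE(5)[OF cg[OF a], of "NC x a"] 5 a by (auto simp: Fun_Ar_simps)
    then show "\<one>\<^bsub>hom_group (Fun C A) F G\<^esub> \<otimes>\<^bsub>hom_group (Fun C A) F G\<^esub> x = x" using 5 F G
      by (intro Fun_eqI[of _ C A]) (auto intro!: Fun_HAdd_Ar Fun_HZero_Ar)
  next
    fix x assume 6: "x \<in> carrier (hom_group (Fun C A) F G)"
    then show "\<exists>y \<in> carrier (hom_group (Fun C A) F G). y \<otimes>\<^bsub>hom_group (Fun C A) F G\<^esub> x = \<one>\<^bsub>hom_group (Fun C A) F G\<^esub>" using Fun_inverse[of x] by auto
  qed
next
  case (2 f a b g c g')
  then have fg[simp]: "f \<in> Ar (Fun C A)" "g \<in> Ar (Fun C A)" "g' \<in> Ar (Fun C A)"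
    "Dom (Fun C A) f = a" "Cod (Fun C A) f = b" "Dom (Fun C A) g = b" "Cod (Fun C A) g = c"
    "Dom (Fun C A) g' = b" "Cod (Fun C A) g' = c"
    by auto
  show ?case
    by (rule Fun_eqI[of _ C A])
      (simp_all add: Fun_comp_Ar Fun_HAdd_Ar A.HAdd_comp Fun_Ar_simps[OF fg(1)] Fun_Ar_simps[OF fg(2)] Fun_Ar_simps[OF fg(3)])
next
  case (3 f a b f' g c)
  then have fg[simp]: "f \<in> Ar (Fun C A)" "f' \<in> Ar (Fun C A)" "g \<in> Ar (Fun C A)"
    "Dom (Fun C A) f = a" "Cod (Fun C A) f = b" "Dom (Fun C A) f' = a" "Cod (Fun C A) f' = b"
    "Dom (Fun C A) g = b" "Cod (Fun C A) g = c"
    by auto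
  show ?case
    by (rule Fun_eqI[of _ C A])
      (simp_all add: Fun_comp_Ar Fun_HAdd_Ar A.comp_HAdd Fun_Ar_simps[OF fg(1)] Fun_Ar_simps[OF fg(2)] Fun_Ar_simps[OF fg(3)])
qed

sublocale Fun: preadditive_category "Fun C A" by (rule Fun_preadditive)

end

section \<open>Exactness in functor categories is pointwise\<close>

context additive_functor_category
begin

lemma Fun_monic:
  assumes t: "t \<in> Ar (Fun C A)" and m: "\<And>a. a \<in> Ob C \<Longrightarrow> monic A (NC t a)"
  shows "monic (Fun C A) t"
  unfolding monic_def
proof (intro conjI t allI ballI impI)
  fix F g h assume gh: "g \<in> Hom (Fun C A) F (Dom (Fun C A) t)" "h \<in> Hom (Fun C A) F (Dom (Fun C A) t)"
    "t \<cdot>\<^bsub>Fun C A\<^esub> g = t \<cdot>\<^bsub>Fun C A\<^esub> h"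
  then have g: "g \<in> Ar (Fun C A)" and h: "h \<in> Ar (Fun C A)" by auto
  note [simp] = Fun_Ar_simps[OF t] Fun_Ar_simps[OF g] Fun_Ar_simps[OF h]
  show "g = h"
  proof (rule Fun_eqI[OF g h])
    fix a assume a: "a \<in> Ob C"
    have "NC t a \<cdot> NC g a = NC t a \<cdot> NC h a"
      using arg_cong[OF gh(3), of "\<lambda>s. NC s a"] a by simp
    from A.monicD[OF m[OF a] _ _ _ _ _ this] show "NC g a = NC h a" using a gh by auto
  qed (use gh in auto)
qed

lemma Fun_epic:
  assumes t: "t \<in> Ar (Fun C A)" and m: "\<And>a. a \<in> Ob C \<Longrightarrow> epic A (NC t a)"
  shows "epic (Fun C A) t"
  unfolding epic_def
proof (intro conjI t allI ballI impI)
  fix F g h assume gh: "g \<in> Hom (Fun C A) (Cod (Fun C A) t) F" "h \<in> Hom (Fun C A) (Cod (Fun C A) t) F"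
    "g \<cdot>\<^bsub>Fun C A\<^esub> t = h \<cdot>\<^bsub>Fun C A\<^esub> t"
  then have g: "g \<in> Ar (Fun C A)" and h: "h \<in> Ar (Fun C A)" by auto
  note [simp] = Fun_Ar_simps[OF t] Fun_Ar_simps[OF g] Fun_Ar_simps[OF h]
  show "g = h"
  proof (rule Fun_eqI[OF g h])
    fix a assume a: "a \<in> Ob C"
    have "NC g a \<cdot> NC t a = NC h a \<cdot> NC t a"
      using arg_cong[OF gh(3), of "\<lambda>s. NC s a"] a by simp
    from A.epicD[OF m[OF a] _ _ _ _ _ this] show "NC g a = NC h a" using a gh by auto
  qed (use gh in auto)
qed

text \<open>The lifts of \<open>h\<close> are taken in each component. Their naturality is tested
  after the components of \<open>k\<close>, which are monic, and there it follows from that of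
  \<open>h\<close> and \<open>k\<close>.\<close>

lemma Fun_is_kernel:
  assumes k: "k \<in> Ar (Fun C A)" and t: "t \<in> Ar (Fun C A)" and kt: "Cod (Fun C A) k = Dom (Fun C A) t"
    and ker: "\<And>a. a \<in> Ob C \<Longrightarrow> is_kernel A (NC k a) (NC t a)"
  shows "is_kernel (Fun C A) k t"
proof (rule Fun.kernelI[OF t _ kt])
  note nk[simp] = Fun_Ar_simps[OF t] Fun_Ar_simps[OF k] kt
    functor_simps[OF Fun_Ar_simps(1)[OF k]] functor_simps[OF Fun_Ar_simps(1)[OF t]]
  show "monic (Fun C A) k" by (rule Fun_monic[OF k]) (use ker A.kernel_monic in blast)
  show "t \<cdot>\<^bsub>Fun C A\<^esub> k = HZero (Fun C A) (Dom (Fun C A) k) (Cod (Fun C A) t)"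
    by (rule Fun_eqI[of _ C A])
      (use A.kernelD(4)[OF ker] t k kt in \<open>auto intro!: Fun_comp_Ar Fun_HZero_Ar\<close>)
  fix h assume h: "h \<in> Ar (Fun C A)" "Cod (Fun C A) h = Dom (Fun C A) t"
    "t \<cdot>\<^bsub>Fun C A\<^esub> h = HZero (Fun C A) (Dom (Fun C A) h) (Cod (Fun C A) t)"
  let ?K = "Dom (Fun C A) k" and ?H = "Dom (Fun C A) h"
  note [simp] = Fun_Ar_simps[OF h(1)] h(2) functor_simps[OF Fun_Ar_simps(1)[OF h(1)]]
  have "\<exists>l. l \<in> Hom A (FO ?H a) (FO ?K a) \<and> NC k a \<cdot> l = NC h a" if a: "a \<in> Ob C" for a
  proof -
    have "NC t a \<cdot> NC h a = HZero A (FO ?H a) (FO (Cod (Fun C A) t) a)"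
      using arg_cong[OF h(3), of "\<lambda>s. NC s a"] a by simp
    then obtain l where "l \<in> Ar A" "Dom A l = FO ?H a" "Cod A l = FO ?K a" "NC k a \<cdot> l = NC h a"
      using A.kernel_lift[OF ker[OF a], of "NC h a"] a kt by auto
    then show ?thesis by auto
  qed
  then obtain \<eta> where \<eta>: "\<And>a. a \<in> Ob C \<Longrightarrow> \<eta> a \<in> Hom A (FO ?H a) (FO ?K a)"
    "\<And>a. a \<in> Ob C \<Longrightarrow> NC k a \<cdot> \<eta> a = NC h a" by metis
  note [simp] = \<eta>(1)[simplified] \<eta>(2)
  have l: "mk_nt C ?H ?K \<eta> \<in> Ar (Fun C A)"
  proof (rule mk_ntI)
    fix f assume f[simp]: "f \<in> Ar C"
    show "\<eta> (Cod C f) \<cdot> FM ?H f = FM ?K f \<cdot> \<eta> (Dom C f)"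
    proof (rule A.monicD[OF A.kernel_monic[OF ker, of "Cod C f"]])
      have "NC k (Cod C f) \<cdot> (\<eta> (Cod C f) \<cdot> FM ?H f) = NC h (Cod C f) \<cdot> FM ?H f"
        by (rule A.assoc_eq) auto
      also have "\<dots> = FM (Cod (Fun C A) k) f \<cdot> (NC k (Dom C f) \<cdot> \<eta> (Dom C f))"
        using Fun_naturality[OF h(1) f] by simp
      also have "\<dots> = NC k (Cod C f) \<cdot> (FM ?K f \<cdot> \<eta> (Dom C f))"
        by (subst A.assoc_eq[OF Fun_naturality[OF k f]]) simp_all
      finally show "NC k (Cod C f) \<cdot> (\<eta> (Cod C f) \<cdot> FM ?H f) = NC k (Cod C f) \<cdot> (FM ?K f \<cdot> \<eta> (Dom C f))" .
    qed auto
  qed (auto intro: C.category_axioms)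
  moreover have "k \<cdot>\<^bsub>Fun C A\<^esub> mk_nt C ?H ?K \<eta> = h"
    by (rule Fun_eqI[of _ C A]) (use l k h in \<open>auto intro!: Fun_comp_Ar\<close>)
  ultimately show "\<exists>l. l \<in> Hom (Fun C A) (Dom (Fun C A) h) (Dom (Fun C A) k) \<and> k \<cdot>\<^bsub>Fun C A\<^esub> l = h"
    by (intro exI[of _ "mk_nt C ?H ?K \<eta>"]) auto
qed

text \<open>The opposite of a functor category is a functor category only up to isomorphism of
  categories, so the dual argument is carried out directly.\<close>

lemma Fun_is_cokernel:
  assumes k: "k \<in> Ar (Fun C A)" and t: "t \<in> Ar (Fun C A)" and kt: "Dom (Fun C A) k = Cod (Fun C A) t"
    and ker: "\<And>a. a \<in> Ob C \<Longrightarrow> is_cokernel A (NC k a) (NC t a)"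
  shows "is_cokernel (Fun C A) k t"
proof (rule Fun.cokernelI[OF t _ kt])
  note nk[simp] = Fun_Ar_simps[OF t] Fun_Ar_simps[OF k] kt
    functor_simps[OF Fun_Ar_simps(1)[OF k]] functor_simps[OF Fun_Ar_simps(2)[OF k]]
    functor_simps[OF Fun_Ar_simps(2)[OF t]]
  show "epic (Fun C A) k" by (rule Fun_epic[OF k]) (use ker A.cokernel_epic in blast)
  show "k \<cdot>\<^bsub>Fun C A\<^esub> t = HZero (Fun C A) (Dom (Fun C A) t) (Cod (Fun C A) k)"
    by (rule Fun_eqI[of _ C A])
      (use A.cokernelD(4)[OF ker] t k kt in \<open>auto intro!: Fun_comp_Ar Fun_HZero_Ar\<close>)
  fix h assume h: "h \<in> Ar (Fun C A)" "Dom (Fun C A) h = Cod (Fun C A) t"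
    "h \<cdot>\<^bsub>Fun C A\<^esub> t = HZero (Fun C A) (Dom (Fun C A) t) (Cod (Fun C A) h)"
  let ?K = "Cod (Fun C A) k" and ?H = "Cod (Fun C A) h"
  note [simp] = Fun_Ar_simps[OF h(1)] h(2) functor_simps[OF Fun_Ar_simps(2)[OF h(1)]]
  have "\<exists>l. l \<in> Hom A (FO ?K a) (FO ?H a) \<and> l \<cdot> NC k a = NC h a" if a: "a \<in> Ob C" for a
  proof -
    have "NC h a \<cdot> NC t a = HZero A (FO (Dom (Fun C A) t) a) (FO ?H a)"
      using arg_cong[OF h(3), of "\<lambda>s. NC s a"] a by simp
    then obtain l where "l \<in> Ar A" "Cod A l = FO ?H a" "Dom A l = FO ?K a" "l \<cdot> NC k a = NC h a"
      using A.cokernel_lift[OF ker[OF a], of "NC h a"] a kt by auto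
    then show ?thesis by auto
  qed
  then obtain \<eta> where \<eta>: "\<And>a. a \<in> Ob C \<Longrightarrow> \<eta> a \<in> Hom A (FO ?K a) (FO ?H a)"
    "\<And>a. a \<in> Ob C \<Longrightarrow> \<eta> a \<cdot> NC k a = NC h a" by metis
  note [simp] = \<eta>(1)[simplified] \<eta>(2)
  have l: "mk_nt C ?K ?H \<eta> \<in> Ar (Fun C A)"
  proof (rule mk_ntI)
    fix f assume f[simp]: "f \<in> Ar C"
    show "\<eta> (Cod C f) \<cdot> FM ?K f = FM ?H f \<cdot> \<eta> (Dom C f)"
    proof (rule A.epicD[OF A.cokernel_epic[OF ker, of "Dom C f"]])
      have "(\<eta> (Cod C f) \<cdot> FM ?K f) \<cdot> NC k (Dom C f) = \<eta> (Cod C f) \<cdot> (NC k (Cod C f) \<cdot> FM (Dom (Fun C A) k) f)"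
        using Fun_naturality[OF k f] by simp
      also have "\<dots> = NC h (Cod C f) \<cdot> FM (Dom (Fun C A) k) f"
        by (rule A.assoc_eq) auto
      also have "\<dots> = FM ?H f \<cdot> NC h (Dom C f)"
        using Fun_naturality[OF h(1) f] by simp
      also have "\<dots> = (FM ?H f \<cdot> \<eta> (Dom C f)) \<cdot> NC k (Dom C f)"
        by simp
      finally show "(\<eta> (Cod C f) \<cdot> FM ?K f) \<cdot> NC k (Dom C f) = (FM ?H f \<cdot> \<eta> (Dom C f)) \<cdot> NC k (Dom C f)" .
    qed auto
  qed (auto intro: C.category_axioms)
  moreover have "mk_nt C ?K ?H \<eta> \<cdot>\<^bsub>Fun C A\<^esub> k = h"
    by (rule Fun_eqI[of _ C A]) (use l k h in \<open>auto intro!: Fun_comp_Ar\<close>)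
  ultimately show "\<exists>l. l \<in> Ar (Fun C A) \<and> Cod (Fun C A) l = Cod (Fun C A) h \<and> Dom (Fun C A) l = Cod (Fun C A) k \<and> l \<cdot>\<^bsub>Fun C A\<^esub> k = h"
    by (intro exI[of _ "mk_nt C ?K ?H \<eta>"]) auto
qed

lemma Fun_zero_object:
  assumes "is_functor C A F" "\<And>a. a \<in> Ob C \<Longrightarrow> is_zero_object A (FO F a)"
  shows "is_zero_object (Fun C A) F"
  unfolding Fun.zero_object_iff
  using assms by (auto intro!: Fun_eqI[of _ C A] Fun_Id_Ar Fun_HZero_Ar simp: Fun_Ob A.zero_object_iff)

lemma Fun_zero_objectD:
  assumes "is_zero_object (Fun C A) F" "a \<in> Ob C"
  shows "is_zero_object A (FO F a)"
proof -
  have F: "is_functor C A F" and eq: "Id (Fun C A) F = HZero (Fun C A) F F"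
    using assms(1) unfolding Fun.zero_object_iff by (auto simp: Fun_Ob)
  show ?thesis
    using arg_cong[OF eq, of "\<lambda>s. NC s a"] assms(2) functor_simps(1)[OF F assms(2)]
    by (simp add: A.zero_object_iff)
qed

end

locale abelian_functor_category = additive_functor_category C A + A: abelian_category A
  for C :: "('i, 'j, 'y) cat_scheme" and A :: "('o, 'm, 'z) pcat_scheme" (structure)
begin

text \<open>A kernel is chosen at every object. The induced arrows between the chosen kernels are
  unique, and this makes them functorial. The result is a kernel of known shape with which any other
  can be compared.\<close>

lemma pointwise_kernel:
  assumes t: "t \<in> Ar (Fun C A)"
  obtains k where "k \<in> Ar (Fun C A)" "Cod (Fun C A) k = Dom (Fun C A) t"
    "\<And>a. a \<in> Ob C \<Longrightarrow> is_kernel A (NC k a) (NC t a)"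
proof -
  let ?F = "Dom (Fun C A) t" and ?G = "Cod (Fun C A) t"
  note [simp] = Fun_Ar_simps[OF t] functor_simps[OF Fun_Ar_simps(1)[OF t]] functor_simps[OF Fun_Ar_simps(2)[OF t]]
  have "\<exists>k. is_kernel A k (NC t a)" if "a \<in> Ob C" for a using that A.has_kernels by simp
  then obtain \<kappa> where \<kappa>: "\<And>a. a \<in> Ob C \<Longrightarrow> is_kernel A (\<kappa> a) (NC t a)" by metis
  have [simp]: "\<kappa> a \<in> Ar A" "Cod A (\<kappa> a) = FO ?F a"
    "NC t a \<cdot> \<kappa> a = HZero A (Dom A (\<kappa> a)) (FO ?G a)" if "a \<in> Ob C" for a
    using A.kernelD[OF \<kappa>[OF that]] that by auto
  note \<kappa>m = A.monicD[OF A.kernel_monic[OF \<kappa>]]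
  \<comment> \<open>Naturality of \<open>t\<close> shows that
    \<open>FM ?F f \<cdot> \<kappa> (Dom C f)\<close> is killed by the component of \<open>t\<close>
    at the codomain, so it lifts to the kernel chosen there.\<close>
  have "\<exists>m. m \<in> Hom A (Dom A (\<kappa> (Dom C f))) (Dom A (\<kappa> (Cod C f))) \<and>
      \<kappa> (Cod C f) \<cdot> m = FM ?F f \<cdot> \<kappa> (Dom C f)" if f[simp]: "f \<in> Ar C" for f
  proof -
    have "NC t (Cod C f) \<cdot> (FM ?F f \<cdot> \<kappa> (Dom C f)) = FM ?G f \<cdot> (NC t (Dom C f) \<cdot> \<kappa> (Dom C f))"
      using A.assoc_eq[OF Fun_naturality[OF t f], of "\<kappa> (Dom C f)"] by (subst A.assoc[symmetric]) auto
    then obtain l where "l \<in> Ar A" "Dom A l = Dom A (\<kappa> (Dom C f))" "Cod A l = Dom A (\<kappa> (Cod C f))"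
      "\<kappa> (Cod C f) \<cdot> l = FM ?F f \<cdot> \<kappa> (Dom C f)"
      using A.kernel_lift[OF \<kappa>[of "Cod C f"], of "FM ?F f \<cdot> \<kappa> (Dom C f)"] by auto
    then show ?thesis by auto
  qed
  then obtain \<mu> where \<mu>: "\<And>f. f \<in> Ar C \<Longrightarrow> \<mu> f \<in> Hom A (Dom A (\<kappa> (Dom C f))) (Dom A (\<kappa> (Cod C f)))"
    and \<mu>c[simp]: "\<And>f. f \<in> Ar C \<Longrightarrow> \<kappa> (Cod C f) \<cdot> \<mu> f = FM ?F f \<cdot> \<kappa> (Dom C f)" by metis
  note [simp] = \<mu>[simplified]
  let ?K = "mk_functor C (\<lambda>a. Dom A (\<kappa> a)) \<mu>"
  have K: "is_functor C A ?K"
  proof (rule C.mk_functorI)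
    fix a assume a[simp]: "a \<in> Ob C"
    show "\<mu> (Id C a) = Id A (Dom A (\<kappa> a))"
      by (rule \<kappa>m[of a]) (use \<mu>c[of "Id C a"] in auto)
  next
    fix f g assume fg[simp]: "f \<in> Ar C" "g \<in> Ar C" "Cod C f = Dom C g"
    show "\<mu> (g \<cdot>\<^bsub>C\<^esub> f) = \<mu> g \<cdot> \<mu> f"
    proof (rule \<kappa>m[of "Cod C g"])
      have "\<kappa> (Cod C g) \<cdot> (\<mu> g \<cdot> \<mu> f) = FM ?F g \<cdot> (\<kappa> (Dom C g) \<cdot> \<mu> f)"
        by (subst A.assoc_eq[OF \<mu>c]) auto
      also have "\<dots> = FM ?F g \<cdot> (FM ?F f \<cdot> \<kappa> (Dom C f))"
        using \<mu>c[of f] by simp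
      finally show "\<kappa> (Cod C g) \<cdot> \<mu> (g \<cdot>\<^bsub>C\<^esub> f) = \<kappa> (Cod C g) \<cdot> (\<mu> g \<cdot> \<mu> f)"
        using \<mu>c[of "g \<cdot>\<^bsub>C\<^esub> f"] by simp
    qed (use \<mu>[of "g \<cdot>\<^bsub>C\<^esub> f"] in auto)
  qed auto
  have "mk_nt C ?K ?F \<kappa> \<in> Ar (Fun C A)"
    by (rule mk_ntI) (auto intro: C.category_axioms K)
  then show ?thesis using that[of "mk_nt C ?K ?F \<kappa>"] \<kappa> by simp
qed

lemma pointwise_cokernel:
  assumes t: "t \<in> Ar (Fun C A)"
  obtains k where "k \<in> Ar (Fun C A)" "Dom (Fun C A) k = Cod (Fun C A) t"
    "\<And>a. a \<in> Ob C \<Longrightarrow> is_cokernel A (NC k a) (NC t a)"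
proof -
  let ?F = "Dom (Fun C A) t" and ?G = "Cod (Fun C A) t"
  note [simp] = Fun_Ar_simps[OF t] functor_simps[OF Fun_Ar_simps(1)[OF t]] functor_simps[OF Fun_Ar_simps(2)[OF t]]
  have "\<exists>k. is_cokernel A k (NC t a)" if "a \<in> Ob C" for a using that A.has_cokernels by simp
  then obtain \<kappa> where \<kappa>: "\<And>a. a \<in> Ob C \<Longrightarrow> is_cokernel A (\<kappa> a) (NC t a)" by metis
  have [simp]: "\<kappa> a \<in> Ar A" "Dom A (\<kappa> a) = FO ?G a"
    "\<kappa> a \<cdot> NC t a = HZero A (FO ?F a) (Cod A (\<kappa> a))" if "a \<in> Ob C" for a
    using A.cokernelD[OF \<kappa>[OF that]] that by auto
  note \<kappa>m = A.epicD[OF A.cokernel_epic[OF \<kappa>]]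
  have "\<exists>m. m \<in> Hom A (Cod A (\<kappa> (Dom C f))) (Cod A (\<kappa> (Cod C f))) \<and>
      m \<cdot> \<kappa> (Dom C f) = \<kappa> (Cod C f) \<cdot> FM ?G f" if f[simp]: "f \<in> Ar C" for f
  proof -
    have "(\<kappa> (Cod C f) \<cdot> FM ?G f) \<cdot> NC t (Dom C f) = \<kappa> (Cod C f) \<cdot> (NC t (Cod C f) \<cdot> FM ?F f)"
      using Fun_naturality[OF t f] by simp
    also have "\<dots> = HZero A (FO ?F (Dom C f)) (Cod A (\<kappa> (Cod C f)))"
      by (subst A.assoc[symmetric]) auto
    finally obtain l where "l \<in> Ar A" "Cod A l = Cod A (\<kappa> (Cod C f))" "Dom A l = Cod A (\<kappa> (Dom C f))"
      "l \<cdot> \<kappa> (Dom C f) = \<kappa> (Cod C f) \<cdot> FM ?G f"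
      using A.cokernel_lift[OF \<kappa>[of "Dom C f"], of "\<kappa> (Cod C f) \<cdot> FM ?G f"] by auto
    then show ?thesis by auto
  qed
  then obtain \<mu> where \<mu>: "\<And>f. f \<in> Ar C \<Longrightarrow> \<mu> f \<in> Hom A (Cod A (\<kappa> (Dom C f))) (Cod A (\<kappa> (Cod C f)))"
    and \<mu>c[simp]: "\<And>f. f \<in> Ar C \<Longrightarrow> \<mu> f \<cdot> \<kappa> (Dom C f) = \<kappa> (Cod C f) \<cdot> FM ?G f" by metis
  note [simp] = \<mu>[simplified]
  let ?K = "mk_functor C (\<lambda>a. Cod A (\<kappa> a)) \<mu>"
  have K: "is_functor C A ?K"
  proof (rule C.mk_functorI)
    fix a assume a[simp]: "a \<in> Ob C"
    show "\<mu> (Id C a) = Id A (Cod A (\<kappa> a))"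
      by (rule \<kappa>m[of a]) (use \<mu>c[of "Id C a"] in auto)
  next
    fix f g assume fg[simp]: "f \<in> Ar C" "g \<in> Ar C" "Cod C f = Dom C g"
    show "\<mu> (g \<cdot>\<^bsub>C\<^esub> f) = \<mu> g \<cdot> \<mu> f"
    proof (rule \<kappa>m[of "Dom C f"])
      have "(\<mu> g \<cdot> \<mu> f) \<cdot> \<kappa> (Dom C f) = \<mu> g \<cdot> (\<kappa> (Dom C g) \<cdot> FM ?G f)"
        using \<mu>c[of f] by simp
      also have "\<dots> = \<kappa> (Cod C g) \<cdot> (FM ?G g \<cdot> FM ?G f)"
        by (subst A.assoc_eq[OF \<mu>c]) auto
      finally show "\<mu> (g \<cdot>\<^bsub>C\<^esub> f) \<cdot> \<kappa> (Dom C f) = (\<mu> g \<cdot> \<mu> f) \<cdot> \<kappa> (Dom C f)"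
        using \<mu>c[of "g \<cdot>\<^bsub>C\<^esub> f"] by simp
    qed (use \<mu>[of "g \<cdot>\<^bsub>C\<^esub> f"] in auto)
  qed auto
  have "mk_nt C ?G ?K \<kappa> \<in> Ar (Fun C A)"
    by (rule mk_ntI) (auto intro: C.category_axioms K)
  then show ?thesis using that[of "mk_nt C ?G ?K \<kappa>"] \<kappa> by simp
qed

text \<open>A kernel in the functor category is isomorphic to the pointwise one, and an isomorphism
  of functors is an isomorphism in each component.\<close>

lemma Fun_kernelD:
  assumes k: "is_kernel (Fun C A) k t" and a: "a \<in> Ob C"
  shows "is_kernel A (NC k a) (NC t a)"
proof -
  note kD = Fun.kernelD[OF k]
  obtain k' where k': "k' \<in> Ar (Fun C A)" "Cod (Fun C A) k' = Dom (Fun C A) t"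
    "\<And>a. a \<in> Ob C \<Longrightarrow> is_kernel A (NC k' a) (NC t a)" using pointwise_kernel[OF kD(1)] by blast
  obtain i where i: "is_iso (Fun C A) i" "Dom (Fun C A) i = Dom (Fun C A) k" "Cod (Fun C A) i = Dom (Fun C A) k'"
    "k = k' \<cdot>\<^bsub>Fun C A\<^esub> i"
    using Fun.kernel_unique[OF Fun_is_kernel[OF k'(1) kD(1) k'(2,3)] k] by metis
  have i': "i \<in> Ar (Fun C A)" using i(1) by (simp add: is_iso_def)
  show ?thesis unfolding i(4)
    using A.kernel_iso[OF k'(3)[OF a] Fun_isoD[OF i(1) a]] a i(3) Fun_Ar_simps[OF i'] Fun_Ar_simps[OF k'(1)] by simp
qed

lemma Fun_cokernelD:
  assumes k: "is_cokernel (Fun C A) k t" and a: "a \<in> Ob C"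
  shows "is_cokernel A (NC k a) (NC t a)"
proof -
  note kD = Fun.cokernelD[OF k]
  obtain k' where k': "k' \<in> Ar (Fun C A)" "Dom (Fun C A) k' = Cod (Fun C A) t"
    "\<And>a. a \<in> Ob C \<Longrightarrow> is_cokernel A (NC k' a) (NC t a)" using pointwise_cokernel[OF kD(1)] by blast
  obtain i where i: "is_iso (Fun C A) i" "Cod (Fun C A) i = Cod (Fun C A) k" "Dom (Fun C A) i = Cod (Fun C A) k'"
    "k = i \<cdot>\<^bsub>Fun C A\<^esub> k'"
    using Fun.cokernel_unique[OF Fun_is_cokernel[OF k'(1) kD(1) k'(2,3)] k] by metis
  have i': "i \<in> Ar (Fun C A)" using i(1) by (simp add: is_iso_def)
  show ?thesis unfolding i(4)
    using A.cokernel_iso[OF k'(3)[OF a] Fun_isoD[OF i(1) a]] a i(3) Fun_Ar_simps[OF i'] Fun_Ar_simps[OF k'(1)] by simp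
qed

text \<open>The pointwise kernel of a monic transformation is zero, so each component has a zero
  kernel.\<close>

lemma Fun_monicD:
  assumes t: "monic (Fun C A) t" and a: "a \<in> Ob C"
  shows "monic A (NC t a)"
proof -
  have t': "t \<in> Ar (Fun C A)" using t by (simp add: monic_def)
  obtain k where k: "k \<in> Ar (Fun C A)" "Cod (Fun C A) k = Dom (Fun C A) t"
    "\<And>a. a \<in> Ob C \<Longrightarrow> is_kernel A (NC k a) (NC t a)" using pointwise_kernel[OF t'] by blast
  have "k = HZero (Fun C A) (Dom (Fun C A) k) (Dom (Fun C A) t)"
    by (rule Fun.monic_kernel_zero[OF t Fun_is_kernel[OF k(1) t' k(2,3)]])
  then have "NC k a = NC (HZero (Fun C A) (Dom (Fun C A) k) (Dom (Fun C A) t)) a" by simp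
  then have z: "NC k a = HZero A (FO (Dom (Fun C A) k) a) (Dom A (NC t a))"
    using a Fun_Ar_simps[OF t'] by simp
  show ?thesis
    by (rule A.zero_kernel_monic[of "FO (Dom (Fun C A) k) a"])
      (use k(3)[OF a] z functor_simps(1)[OF Fun_Ar_simps(1)[OF k(1)] a] in auto)
qed

lemma Fun_epicD:
  assumes t: "epic (Fun C A) t" and a: "a \<in> Ob C"
  shows "epic A (NC t a)"
proof -
  have t': "t \<in> Ar (Fun C A)" using t by (simp add: epic_def)
  obtain k where k: "k \<in> Ar (Fun C A)" "Dom (Fun C A) k = Cod (Fun C A) t"
    "\<And>a. a \<in> Ob C \<Longrightarrow> is_cokernel A (NC k a) (NC t a)" using pointwise_cokernel[OF t'] by blast
  have "k = HZero (Fun C A) (Cod (Fun C A) t) (Cod (Fun C A) k)"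
    by (rule Fun.epic_cokernel_zero[OF t Fun_is_cokernel[OF k(1) t' k(2,3)]])
  then have "NC k a = NC (HZero (Fun C A) (Cod (Fun C A) t) (Cod (Fun C A) k)) a" by simp
  then have z: "NC k a = HZero A (Cod A (NC t a)) (FO (Cod (Fun C A) k) a)"
    using a Fun_Ar_simps[OF t'] by simp
  show ?thesis
    by (rule A.zero_cokernel_epic[where a = "FO (Cod (Fun C A) k) a"])
      (use k(3)[OF a] z functor_simps(1)[OF Fun_Ar_simps(2)[OF k(1)] a] in auto)
qed

text \<open>The image and kernel witnesses of the functor category become, evaluated at
  \<open>a\<close>, those of the components. This lets exactness of products act on sequences of
  functors.\<close>

lemma Fun_short_exactD:
  assumes fg: "short_exact (Fun C A) f g" and a: "a \<in> Ob C"
  shows "short_exact A (NC f a) (NC g a)"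
proof -
  obtain m c where mc: "is_cokernel (Fun C A) c f" "is_kernel (Fun C A) m c" "is_kernel (Fun C A) m g"
    and f: "monic (Fun C A) f" and g: "epic (Fun C A) g" and cd: "Cod (Fun C A) f = Dom (Fun C A) g"
    using fg unfolding short_exact_def exact_at_def is_image_def by blast
  have fa: "f \<in> Ar (Fun C A)" "g \<in> Ar (Fun C A)" using f g by (auto simp: monic_def epic_def)
  show ?thesis unfolding short_exact_def exact_at_def is_image_def
    using Fun_cokernelD[OF mc(1) a] Fun_kernelD[OF mc(2) a] Fun_kernelD[OF mc(3) a] Fun_monicD[OF f a] Fun_epicD[OF g a]
      Fun_Ar_simps[OF fa(1)] Fun_Ar_simps[OF fa(2)] cd a by auto
qed

lemma Fun_short_exactI:
  assumes f: "f \<in> Ar (Fun C A)" and g: "g \<in> Ar (Fun C A)" and cd: "Cod (Fun C A) f = Dom (Fun C A) g"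
    and se: "\<And>a. a \<in> Ob C \<Longrightarrow> short_exact A (NC f a) (NC g a)"
  shows "short_exact (Fun C A) f g"
  by (intro Fun.short_exactI Fun_is_kernel Fun_is_cokernel f g cd cd[symmetric] A.short_exact_kernel se)

end

section \<open>Adjunctions through universal counits\<close>

text \<open>An adjunction expressed by universal arrows from \<open>F\<close>. For the Kan extension
  the components of these arrows are product projections, which the bijections of hom sets do not
  display.\<close>

definition universal_counit ::
  "('o, 'm, 'y) cat_scheme \<Rightarrow> ('p, 'n, 'z) cat_scheme \<Rightarrow> ('o, 'm, 'p, 'n) functor_data
    \<Rightarrow> ('p, 'n, 'o, 'm) functor_data \<Rightarrow> ('p \<Rightarrow> 'n) \<Rightarrow> bool" where
  "universal_counit X Y F G \<epsilon> \<longleftrightarrow>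
    (\<forall>y \<in> Ob Y. \<epsilon> y \<in> Hom Y (FO F (FO G y)) y \<and>
      (\<forall>x \<in> Ob X. \<forall>f \<in> Hom Y (FO F x) y. \<exists>!h. h \<in> Hom X x (FO G y) \<and> \<epsilon> y \<cdot>\<^bsub>Y\<^esub> FM F h = f)) \<and>
    (\<forall>b \<in> Ar Y. b \<cdot>\<^bsub>Y\<^esub> \<epsilon> (Dom Y b) = \<epsilon> (Cod Y b) \<cdot>\<^bsub>Y\<^esub> FM F (FM G b))"

lemma universal_counit_simps:
  assumes "universal_counit X Y F G \<epsilon>" "y \<in> Ob Y"
  shows "\<epsilon> y \<in> Ar Y" "Dom Y (\<epsilon> y) = FO F (FO G y)" "Cod Y (\<epsilon> y) = y"
proof -
  have "\<epsilon> y \<in> Hom Y (FO F (FO G y)) y" using assms unfolding universal_counit_def by blast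
  then show "\<epsilon> y \<in> Ar Y" "Dom Y (\<epsilon> y) = FO F (FO G y)" "Cod Y (\<epsilon> y) = y" by auto
qed

lemma universal_counit_natural:
  "universal_counit X Y F G \<epsilon> \<Longrightarrow> b \<in> Ar Y \<Longrightarrow>
    b \<cdot>\<^bsub>Y\<^esub> \<epsilon> (Dom Y b) = \<epsilon> (Cod Y b) \<cdot>\<^bsub>Y\<^esub> FM F (FM G b)"
  unfolding universal_counit_def by blast

lemma universal_counit_ex1:
  assumes "universal_counit X Y F G \<epsilon>" "y \<in> Ob Y" "x \<in> Ob X" "f \<in> Hom Y (FO F x) y"
  shows "\<exists>!h. h \<in> Hom X x (FO G y) \<and> \<epsilon> y \<cdot>\<^bsub>Y\<^esub> FM F h = f"
proof -
  have "\<forall>x \<in> Ob X. \<forall>f \<in> Hom Y (FO F x) y. \<exists>!h. h \<in> Hom X x (FO G y) \<and> \<epsilon> y \<cdot>\<^bsub>Y\<^esub> FM F h = f"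
    using assms(1,2) unfolding universal_counit_def by (elim conjE) (drule (1) bspec, elim conjE)
  then have "\<forall>f \<in> Hom Y (FO F x) y. \<exists>!h. h \<in> Hom X x (FO G y) \<and> \<epsilon> y \<cdot>\<^bsub>Y\<^esub> FM F h = f"
    by (rule bspec) (rule assms(3))
  then show ?thesis by (rule bspec) (rule assms(4))
qed

text \<open>The transpose of \<open>f\<close> is the unique arrow through which \<open>f\<close>
  factors over the counit; uniqueness also gives the naturality of transposition.\<close>

lemma counit_is_right_adjoint:
  assumes X: "category X" and Y: "category Y" and F: "is_functor X Y F" and G: "is_functor Y X G"
    and \<epsilon>: "universal_counit X Y F G \<epsilon>"
  shows "is_right_adjoint X Y F G"
proof -
  interpret X: category X by fact
  interpret Y: category Y by fact
  note [simp] = functor_simps[OF F] functor_simps[OF G] universal_counit_simps[OF \<epsilon>]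
  define \<phi> where "\<phi> x y f = (THE h. h \<in> Hom X x (FO G y) \<and> \<epsilon> y \<cdot>\<^bsub>Y\<^esub> FM F h = f)" for x y f
  have \<phi>: "\<phi> x y f \<in> Hom X x (FO G y) \<and> \<epsilon> y \<cdot>\<^bsub>Y\<^esub> FM F (\<phi> x y f) = f"
    if "x \<in> Ob X" "y \<in> Ob Y" "f \<in> Hom Y (FO F x) y" for x y f
    unfolding \<phi>_def by (rule theI') (rule universal_counit_ex1[OF \<epsilon> that(2,1,3)])
  have uniq: "\<phi> x y f = h" if "x \<in> Ob X" "y \<in> Ob Y" "h \<in> Hom X x (FO G y)" "\<epsilon> y \<cdot>\<^bsub>Y\<^esub> FM F h = f" for x y f h
  proof -
    have f: "f \<in> Hom Y (FO F x) y" using that by auto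
    show ?thesis unfolding \<phi>_def
      by (rule the1_equality[OF universal_counit_ex1[OF \<epsilon> that(2,1) f]]) (use that in blast)
  qed
  \<comment> \<open>The inverse of transposition applies \<open>F\<close> and then the
    counit.\<close>
  have bij: "bij_betw (\<phi> x y) (Hom Y (FO F x) y) (Hom X x (FO G y))" if "x \<in> Ob X" "y \<in> Ob Y" for x y
  proof (rule bij_betw_byWitness[where f' = "\<lambda>h. \<epsilon> y \<cdot>\<^bsub>Y\<^esub> FM F h"])
    show "\<forall>f\<in>Hom Y (FO F x) y. \<epsilon> y \<cdot>\<^bsub>Y\<^esub> FM F (\<phi> x y f) = f" using \<phi>[OF that] by blast
    show "\<forall>h\<in>Hom X x (FO G y). \<phi> x y (\<epsilon> y \<cdot>\<^bsub>Y\<^esub> FM F h) = h" using uniq[OF that] by blast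
    show "\<phi> x y ` Hom Y (FO F x) y \<subseteq> Hom X x (FO G y)" using \<phi>[OF that] by blast
    show "(\<lambda>h. \<epsilon> y \<cdot>\<^bsub>Y\<^esub> FM F h) ` Hom X x (FO G y) \<subseteq> Hom Y (FO F x) y" using that by auto
  qed
  have nat: "\<phi> (Dom X a) (Cod Y b) ((b \<cdot>\<^bsub>Y\<^esub> h) \<cdot>\<^bsub>Y\<^esub> FM F a)
      = (FM G b \<cdot>\<^bsub>X\<^esub> \<phi> (Cod X a) (Dom Y b) h) \<cdot>\<^bsub>X\<^esub> a"
    if ab: "a \<in> Ar X" "b \<in> Ar Y" and h: "h \<in> Hom Y (FO F (Cod X a)) (Dom Y b)" for a b h
  proof (rule uniq)
    let ?p = "\<phi> (Cod X a) (Dom Y b) h"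
    have p: "?p \<in> Ar X" "Dom X ?p = Cod X a" "Cod X ?p = FO G (Dom Y b)" "\<epsilon> (Dom Y b) \<cdot>\<^bsub>Y\<^esub> FM F ?p = h"
      using \<phi>[of "Cod X a" "Dom Y b" h] ab h by auto
    have "\<epsilon> (Cod Y b) \<cdot>\<^bsub>Y\<^esub> FM F ((FM G b \<cdot>\<^bsub>X\<^esub> ?p) \<cdot>\<^bsub>X\<^esub> a)
        = (\<epsilon> (Cod Y b) \<cdot>\<^bsub>Y\<^esub> FM F (FM G b)) \<cdot>\<^bsub>Y\<^esub> (FM F ?p \<cdot>\<^bsub>Y\<^esub> FM F a)"
      using ab p by simp
    also have "\<dots> = b \<cdot>\<^bsub>Y\<^esub> ((\<epsilon> (Dom Y b) \<cdot>\<^bsub>Y\<^esub> FM F ?p) \<cdot>\<^bsub>Y\<^esub> FM F a)"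
      unfolding universal_counit_natural[OF \<epsilon> ab(2), symmetric] using ab p(1-3) by simp
    also have "\<dots> = (b \<cdot>\<^bsub>Y\<^esub> h) \<cdot>\<^bsub>Y\<^esub> FM F a" unfolding p(4) using ab h by simp
    finally show "\<epsilon> (Cod Y b) \<cdot>\<^bsub>Y\<^esub> FM F ((FM G b \<cdot>\<^bsub>X\<^esub> ?p) \<cdot>\<^bsub>X\<^esub> a) = (b \<cdot>\<^bsub>Y\<^esub> h) \<cdot>\<^bsub>Y\<^esub> FM F a" .
    show "(FM G b \<cdot>\<^bsub>X\<^esub> ?p) \<cdot>\<^bsub>X\<^esub> a \<in> Hom X (Dom X a) (FO G (Cod Y b))" using ab p by simp
  qed (use ab in auto)
  show ?thesis unfolding is_right_adjoint_def using F G bij nat by blast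
qed

text \<open>The counit at \<open>y\<close> is the arrow whose transpose is the identity of
  \<open>FO G y\<close>.\<close>

lemma right_adjoint_counit:
  assumes X: "category X" and Y: "category Y" and adj: "is_right_adjoint X Y F G"
  obtains \<epsilon> where "universal_counit X Y F G \<epsilon>"
proof -
  interpret X: category X by fact
  interpret Y: category Y by fact
  obtain \<phi> where F: "is_functor X Y F" and G: "is_functor Y X G"
    and bij: "\<And>x y. x \<in> Ob X \<Longrightarrow> y \<in> Ob Y \<Longrightarrow> bij_betw (\<phi> x y) (Hom Y (FO F x) y) (Hom X x (FO G y))"
    and nat: "\<And>a b h. a \<in> Ar X \<Longrightarrow> b \<in> Ar Y \<Longrightarrow> h \<in> Hom Y (FO F (Cod X a)) (Dom Y b) \<Longrightarrow>
      \<phi> (Dom X a) (Cod Y b) ((b \<cdot>\<^bsub>Y\<^esub> h) \<cdot>\<^bsub>Y\<^esub> FM F a) = (FM G b \<cdot>\<^bsub>X\<^esub> \<phi> (Cod X a) (Dom Y b) h) \<cdot>\<^bsub>X\<^esub> a"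
    using adj unfolding is_right_adjoint_def by blast
  note [simp] = functor_simps[OF F] functor_simps[OF G]
  define \<epsilon> where "\<epsilon> y = inv_into (Hom Y (FO F (FO G y)) y) (\<phi> (FO G y) y) (Id X (FO G y))" for y
  have \<epsilon>: "\<epsilon> y \<in> Hom Y (FO F (FO G y)) y" "\<phi> (FO G y) y (\<epsilon> y) = Id X (FO G y)" if y: "y \<in> Ob Y" for y
  proof -
    have "Id X (FO G y) \<in> \<phi> (FO G y) y ` Hom Y (FO F (FO G y)) y"
      using bij[of "FO G y" y] y by (auto simp: bij_betw_def)
    then show "\<epsilon> y \<in> Hom Y (FO F (FO G y)) y" "\<phi> (FO G y) y (\<epsilon> y) = Id X (FO G y)"
      unfolding \<epsilon>_def by (rule inv_into_into, rule f_inv_into_f)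
  qed
  note [simp] = \<epsilon>(1)[simplified] \<epsilon>(2)
  have inj: "f = g" if "x \<in> Ob X" "y \<in> Ob Y" "f \<in> Hom Y (FO F x) y" "g \<in> Hom Y (FO F x) y" "\<phi> x y f = \<phi> x y g" for x y f g
    using bij[OF that(1,2)] that(3-5) by (auto simp: bij_betw_def inj_on_def)
  \<comment> \<open>Naturality of transposition at the counit itself. The universal property and the
    naturality of the counit both rest on this equation.\<close>
  have \<phi>\<epsilon>: "\<phi> (Dom X h) y (\<epsilon> y \<cdot>\<^bsub>Y\<^esub> FM F h) = h" if h: "h \<in> Ar X" "y \<in> Ob Y" "Cod X h = FO G y" for h y
    using nat[of h "Id Y y" "\<epsilon> y"] h by simp
  have ex1: "\<exists>!h. h \<in> Hom X x (FO G y) \<and> \<epsilon> y \<cdot>\<^bsub>Y\<^esub> FM F h = f"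
    if xy: "x \<in> Ob X" "y \<in> Ob Y" and f: "f \<in> Hom Y (FO F x) y" for x y f
  proof (rule ex1I[of _ "\<phi> x y f"])
    have p: "\<phi> x y f \<in> Hom X x (FO G y)" using bij_betwE[OF bij[OF xy]] f by blast
    have "\<epsilon> y \<cdot>\<^bsub>Y\<^esub> FM F (\<phi> x y f) = f"
      by (rule inj[of x y]) (use p f xy \<phi>\<epsilon>[of "\<phi> x y f" y] in auto)
    then show "\<phi> x y f \<in> Hom X x (FO G y) \<and> \<epsilon> y \<cdot>\<^bsub>Y\<^esub> FM F (\<phi> x y f) = f" using p by blast
    fix h assume "h \<in> Hom X x (FO G y) \<and> \<epsilon> y \<cdot>\<^bsub>Y\<^esub> FM F h = f"
    then show "h = \<phi> x y f" using \<phi>\<epsilon>[of h y] xy by auto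
  qed
  have "b \<cdot>\<^bsub>Y\<^esub> \<epsilon> (Dom Y b) = \<epsilon> (Cod Y b) \<cdot>\<^bsub>Y\<^esub> FM F (FM G b)" if b: "b \<in> Ar Y" for b
  proof (rule inj[of "FO G (Dom Y b)" "Cod Y b"])
    have "\<phi> (FO G (Dom Y b)) (Cod Y b) (b \<cdot>\<^bsub>Y\<^esub> \<epsilon> (Dom Y b)) = FM G b"
      using nat[of "Id X (FO G (Dom Y b))" b "\<epsilon> (Dom Y b)"] b by simp
    then show "\<phi> (FO G (Dom Y b)) (Cod Y b) (b \<cdot>\<^bsub>Y\<^esub> \<epsilon> (Dom Y b)) =
        \<phi> (FO G (Dom Y b)) (Cod Y b) (\<epsilon> (Cod Y b) \<cdot>\<^bsub>Y\<^esub> FM F (FM G b))"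
      using \<phi>\<epsilon>[of "FM G b" "Cod Y b"] b by simp
  qed (use b in auto)
  then have "universal_counit X Y F G \<epsilon>" unfolding universal_counit_def using \<epsilon>(1) ex1 by blast
  then show ?thesis by (rule that)
qed

text \<open>Each counit factors uniquely through the other. The composites of the two factors are
  endomorphisms over a counit, hence identities.\<close>

lemma counit_comparison:
  assumes X: "category X" and Y: "category Y" and F: "is_functor X Y F" and G: "is_functor Y X G" and G': "is_functor Y X G'"
    and \<epsilon>: "universal_counit X Y F G \<epsilon>" and \<epsilon>': "universal_counit X Y F G' \<epsilon>'" and y: "y \<in> Ob Y"
  obtains h where "is_iso X h" "Dom X h = FO G y" "Cod X h = FO G' y" "\<epsilon>' y \<cdot>\<^bsub>Y\<^esub> FM F h = \<epsilon> y"
proof -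
  interpret X: category X by fact
  interpret Y: category Y by fact
  note [simp] = functor_simps[OF F] functor_simps[OF G] functor_simps[OF G'] y
    universal_counit_simps[OF \<epsilon>] universal_counit_simps[OF \<epsilon>']
  obtain h where h: "h \<in> Hom X (FO G y) (FO G' y)" "\<epsilon>' y \<cdot>\<^bsub>Y\<^esub> FM F h = \<epsilon> y"
    using universal_counit_ex1[OF \<epsilon>' y, of "FO G y" "\<epsilon> y"] by auto
  obtain k where k: "k \<in> Hom X (FO G' y) (FO G y)" "\<epsilon> y \<cdot>\<^bsub>Y\<^esub> FM F k = \<epsilon>' y"
    using universal_counit_ex1[OF \<epsilon> y, of "FO G' y" "\<epsilon>' y"] by auto
  note [simp] = h(1)[simplified] k(1)[simplified]
  have "k \<cdot>\<^bsub>X\<^esub> h = Id X (FO G y)"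
  proof (rule ex1E[OF universal_counit_ex1[OF \<epsilon> y, of "FO G y" "\<epsilon> y"]])
    fix z assume z: "\<forall>h. h \<in> Hom X (FO G y) (FO G y) \<and> \<epsilon> y \<cdot>\<^bsub>Y\<^esub> FM F h = \<epsilon> y \<longrightarrow> h = z"
    have "k \<cdot>\<^bsub>X\<^esub> h = z" by (rule z[rule_format]) (simp add: Y.assoc_eq[OF k(2)] h(2))
    moreover have "Id X (FO G y) = z" by (rule z[rule_format]) simp
    ultimately show ?thesis by simp
  qed auto
  moreover have "h \<cdot>\<^bsub>X\<^esub> k = Id X (FO G' y)"
  proof (rule ex1E[OF universal_counit_ex1[OF \<epsilon>' y, of "FO G' y" "\<epsilon>' y"]])
    fix z assume z: "\<forall>h. h \<in> Hom X (FO G' y) (FO G' y) \<and> \<epsilon>' y \<cdot>\<^bsub>Y\<^esub> FM F h = \<epsilon>' y \<longrightarrow> h = z"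
    have "h \<cdot>\<^bsub>X\<^esub> k = z" by (rule z[rule_format]) (simp add: Y.assoc_eq[OF h(2)] k(2))
    moreover have "Id X (FO G' y) = z" by (rule z[rule_format]) simp
    ultimately show ?thesis by simp
  qed auto
  ultimately have "is_iso X h" using h(1) k(1) by (intro X.is_isoI[of h _ _ k]) auto
  then show ?thesis by (rule that) (use h in auto)
qed

section \<open>Right Kan extension along a discrete fibration\<close>

text \<open>Lifts have a prescribed codomain and are unique. So the fibres contain only identity
  arrows, and an arrow of \<open>C\<close> acts from the fibre over its codomain to the fibre over
  its domain.\<close>

locale discrete_fibration = D: category D + C: category C
  for D :: "('i, 'j) cat" and C :: "('k, 'l) cat" +
  fixes w :: "('i, 'j, 'k, 'l) functor_data"
  assumes w: "is_functor D C w"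
    and lift_ex1: "y \<in> Ob D \<Longrightarrow> a \<in> Ar C \<Longrightarrow> Cod C a = FO w y \<Longrightarrow>
      \<exists>!b. b \<in> Ar D \<and> Cod D b = y \<and> FM w b = a"
begin

definition fib :: "'k \<Rightarrow> 'i set" where
  "fib c = {x \<in> Ob D. FO w x = c}"

definition lift :: "'l \<Rightarrow> 'i \<Rightarrow> 'j" where
  "lift a y = (THE b. b \<in> Ar D \<and> Cod D b = y \<and> FM w b = a)"

lemma lift_simps [simp]:
  assumes "y \<in> Ob D" "a \<in> Ar C" "Cod C a = FO w y"
  shows "lift a y \<in> Ar D" "Cod D (lift a y) = y" "FM w (lift a y) = a"
    "FO w (Dom D (lift a y)) = Dom C a"
proof -
  show 1: "lift a y \<in> Ar D" "Cod D (lift a y) = y" "FM w (lift a y) = a"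
    using theI'[OF lift_ex1[OF assms]] unfolding lift_def by auto
  show "FO w (Dom D (lift a y)) = Dom C a"
    using functor_simps(3)[OF w 1(1)] 1(3) by simp
qed

lemma lift_eqI:
  assumes "b \<in> Ar D"
  shows "lift (FM w b) (Cod D b) = b"
  unfolding lift_def
  by (rule the1_equality[OF lift_ex1]) (use assms functor_simps[OF w] in auto)

lemma lift_eq:
  assumes "b \<in> Ar D" "Cod D b = y" "FM w b = a"
  shows "lift a y = b"
  using lift_eqI[OF assms(1)] assms(2,3) by simp

end

locale fibration_kan = discrete_fibration D C w + A: abelian_category A
  for D :: "('i, 'j) cat" and C :: "('k, 'l) cat" and w and A :: "('o, 'm) pcat" (structure) +
  fixes U :: "'u itself"
  assumes complete: "complete_category TYPE('u) A" and exact: "exact_products TYPE('u) A"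
    and small_fib: "small TYPE('u) (fib c)"
begin

sublocale FD: abelian_functor_category D A by unfold_locales
sublocale FC: abelian_functor_category C A by unfold_locales

lemma w_simps [simp]:
  "x \<in> Ob D \<Longrightarrow> FO w x \<in> Ob C" "f \<in> Ar D \<Longrightarrow> FM w f \<in> Ar C"
  "f \<in> Ar D \<Longrightarrow> Dom C (FM w f) = FO w (Dom D f)" "f \<in> Ar D \<Longrightarrow> Cod C (FM w f) = FO w (Cod D f)"
  using functor_simps[OF w] by auto

lemma fib_product: "(\<And>x. x \<in> fib c \<Longrightarrow> X x \<in> Ob A) \<Longrightarrow> \<exists>P \<pi>. is_product A (fib c) X P \<pi>"
  by (rule complete_has_product[OF A.category_axioms complete small_fib])

abbreviation W where "W \<equiv> precomp D C A w"

lemma W_simps [simp]: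
  "is_functor C A T \<Longrightarrow> FO W T = fcomp D T w"
  "t \<in> Ar (Fun C A) \<Longrightarrow> Dom (Fun D A) (FM W t) = fcomp D (Dom (Fun C A) t) w"
  "t \<in> Ar (Fun C A) \<Longrightarrow> Cod (Fun D A) (FM W t) = fcomp D (Cod (Fun C A) t) w"
  "t \<in> Ar (Fun C A) \<Longrightarrow> x \<in> Ob D \<Longrightarrow> NC (FM W t) x = NC t (FO w x)"
  by (simp_all add: precomp_def Fun_Ob) (simp_all add: Fun_def)

lemma W_Ar:
  assumes t: "t \<in> Ar (Fun C A)"
  shows "FM W t \<in> Ar (Fun D A)"
proof -
  note [simp] = Fun_Ar_simps[OF t]
  have "mk_nt D (fcomp D (Dom (Fun C A) t) w) (fcomp D (Cod (Fun C A) t) w) (\<lambda>x. NC t (FO w x)) \<in> Ar (Fun D A)"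
  proof (rule mk_ntI)
    show "NC t (FO w (Cod D f)) \<cdot> FM (fcomp D (Dom (Fun C A) t) w) f =
         FM (fcomp D (Cod (Fun C A) t) w) f \<cdot> NC t (FO w (Dom D f))" if "f \<in> Ar D" for f
      using Fun_naturality[OF t, of "FM w f"] that by simp
  qed (auto intro: D.category_axioms D.fcomp_functor[OF w])
  then show ?thesis using t by (simp add: precomp_def mk_nt_def restrict_def Fun_def)
qed

lemma W_functor: "is_functor (Fun C A) (Fun D A) W"
proof -
  have FM: "FM W \<in> Ar (Fun C A) \<rightarrow>\<^sub>E Ar (Fun D A)"
    using W_Ar by (auto simp: PiE_iff) (simp add: precomp_def)
  have FO: "FO W \<in> Ob (Fun C A) \<rightarrow>\<^sub>E Ob (Fun D A)"
    by (auto simp: Fun_Ob precomp_def intro: D.fcomp_functor[OF w])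
  show ?thesis unfolding is_functor_def
  proof (intro conjI FO FM ballI impI)
    fix f assume f: "f \<in> Ar (Fun C A)"
    note [simp] = Fun_Ar_simps[OF f]
    show "Dom (Fun D A) (FM W f) = FO W (Dom (Fun C A) f)" "Cod (Fun D A) (FM W f) = FO W (Cod (Fun C A) f)"
      using f by simp_all
    fix g assume g: "g \<in> Ar (Fun C A)" "Cod (Fun C A) f = Dom (Fun C A) g"
    show "FM W (g \<cdot>\<^bsub>Fun C A\<^esub> f) = FM W g \<cdot>\<^bsub>Fun D A\<^esub> FM W f"
      by (rule Fun_eqI[of _ D A]) (use f g in \<open>auto intro!: W_Ar FC.Fun_comp_Ar FD.Fun_comp_Ar\<close>)
  next
    fix T assume T: "T \<in> Ob (Fun C A)"
    then have T': "is_functor C A T" by (simp add: Fun_Ob)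
    show "FM W (Id (Fun C A) T) = Id (Fun D A) (FO W T)"
      by (rule Fun_eqI[of _ D A]) (use T' in \<open>auto intro!: W_Ar FD.Fun_Id_Ar D.fcomp_functor[OF w] simp: FC.Fun_Id_Ar\<close>)
  qed
qed

text \<open>The limit over the comma category under \<open>c\<close>, cut down to its initial part,
  the fibre over \<open>c\<close>. Fibres vary contravariantly, hence products over them
  covariantly: the component at \<open>y\<close> reads off the factor at the source of the lift that
  ends in \<open>y\<close>.\<close>

definition ran_ob :: "('i, 'j, 'o, 'm) functor_data \<Rightarrow> ('k, 'l, 'o, 'm) functor_data" where
  "ran_ob T = mk_functor C (\<lambda>c. prod_ob A (fib c) (FO T))
    (\<lambda>a. prod_tuple A (fib (Cod C a)) (FO T) (prod_ob A (fib (Dom C a)) (FO T))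
      (\<lambda>y. FM T (lift a y) \<cdot> prod_proj A (fib (Dom C a)) (FO T) (Dom D (lift a y))))"

definition ran_map :: "('i, 'j, 'o, 'm) nt_data \<Rightarrow> ('k, 'l, 'o, 'm) nt_data" where
  "ran_map t = mk_nt C (ran_ob (Dom (Fun D A) t)) (ran_ob (Cod (Fun D A) t))
    (\<lambda>c. prod_tuple A (fib c) (FO (Cod (Fun D A) t)) (prod_ob A (fib c) (FO (Dom (Fun D A) t)))
      (\<lambda>x. NC t x \<cdot> prod_proj A (fib c) (FO (Dom (Fun D A) t)) x))"

definition ran :: "(('i, 'j, 'o, 'm) functor_data, ('i, 'j, 'o, 'm) nt_data, ('k, 'l, 'o, 'm) functor_data,
    ('k, 'l, 'o, 'm) nt_data) functor_data" where
  "ran = mk_functor (Fun D A) ran_ob ran_map"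

definition ran_counit :: "('i, 'j, 'o, 'm) functor_data \<Rightarrow> ('i, 'j, 'o, 'm) nt_data" where
  "ran_counit T = mk_nt D (fcomp D (ran_ob T) w) T (\<lambda>x. prod_proj A (fib (FO w x)) (FO T) x)"

lemma fib_iff [simp]: "x \<in> fib c \<longleftrightarrow> x \<in> Ob D \<and> FO w x = c"
  by (auto simp: fib_def)

lemma fibD: "x \<in> fib c \<Longrightarrow> x \<in> Ob D" "x \<in> fib c \<Longrightarrow> FO w x = c"
  by (auto simp: fib_def)

context
  fixes T assumes T: "is_functor D A T"
begin

lemma ran_product: "is_product A (fib c) (FO T) (prod_ob A (fib c) (FO T)) (prod_proj A (fib c) (FO T))"
  by (intro A.prod_cone_is_product fib_product functor_simps[OF T]) auto

lemma ran_proj_simps [simp]: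
  "prod_ob A (fib c) (FO T) \<in> Ob A"
  "x \<in> fib c \<Longrightarrow> prod_proj A (fib c) (FO T) x \<in> Ar A"
  "x \<in> fib c \<Longrightarrow> Dom A (prod_proj A (fib c) (FO T) x) = prod_ob A (fib c) (FO T)"
  "x \<in> fib c \<Longrightarrow> Cod A (prod_proj A (fib c) (FO T) x) = FO T x"
  using A.product_simps[OF ran_product] by auto

lemma ran_tuple_simps:
  assumes "Q \<in> Ob A" "\<And>x. x \<in> fib c \<Longrightarrow> \<rho> x \<in> Hom A Q (FO T x)"
  shows "prod_tuple A (fib c) (FO T) Q \<rho> \<in> Ar A" "Dom A (prod_tuple A (fib c) (FO T) Q \<rho>) = Q"
    "Cod A (prod_tuple A (fib c) (FO T) Q \<rho>) = prod_ob A (fib c) (FO T)"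
    "x \<in> fib c \<Longrightarrow> prod_proj A (fib c) (FO T) x \<cdot> prod_tuple A (fib c) (FO T) Q \<rho> = \<rho> x"
proof -
  have "\<exists>P \<pi>. is_product A (fib c) (FO T) P \<pi>" using ran_product by blast
  note tt = A.prod_tuple[OF this assms]
  show "prod_tuple A (fib c) (FO T) Q \<rho> \<in> Ar A" "Dom A (prod_tuple A (fib c) (FO T) Q \<rho>) = Q"
    "Cod A (prod_tuple A (fib c) (FO T) Q \<rho>) = prod_ob A (fib c) (FO T)"
    "x \<in> fib c \<Longrightarrow> prod_proj A (fib c) (FO T) x \<cdot> prod_tuple A (fib c) (FO T) Q \<rho> = \<rho> x"
    using tt by auto
qed

lemma ran_ob_simps:
  shows "c \<in> Ob C \<Longrightarrow> FO (ran_ob T) c = prod_ob A (fib c) (FO T)"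
    "a \<in> Ar C \<Longrightarrow> FM (ran_ob T) a \<in> Ar A"
    "a \<in> Ar C \<Longrightarrow> Dom A (FM (ran_ob T) a) = prod_ob A (fib (Dom C a)) (FO T)"
    "a \<in> Ar C \<Longrightarrow> Cod A (FM (ran_ob T) a) = prod_ob A (fib (Cod C a)) (FO T)"
    "a \<in> Ar C \<Longrightarrow> y \<in> fib (Cod C a) \<Longrightarrow> prod_proj A (fib (Cod C a)) (FO T) y \<cdot> FM (ran_ob T) a =
      FM T (lift a y) \<cdot> prod_proj A (fib (Dom C a)) (FO T) (Dom D (lift a y))"
proof -
  note [simp] = functor_simps[OF T]
  show "c \<in> Ob C \<Longrightarrow> FO (ran_ob T) c = prod_ob A (fib c) (FO T)" by (simp add: ran_ob_def)
  have r: "FM T (lift a y) \<cdot> prod_proj A (fib (Dom C a)) (FO T) (Dom D (lift a y))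
      \<in> Hom A (prod_ob A (fib (Dom C a)) (FO T)) (FO T y)" if "a \<in> Ar C" "y \<in> fib (Cod C a)" for a y
    using that by simp
  note tt = ran_tuple_simps[where \<rho> = "\<lambda>y. FM T (lift a y) \<cdot> prod_proj A (fib (Dom C a)) (FO T) (Dom D (lift a y))",
    OF ran_proj_simps(1) r]
  assume a: "a \<in> Ar C"
  show "FM (ran_ob T) a \<in> Ar A" "Dom A (FM (ran_ob T) a) = prod_ob A (fib (Dom C a)) (FO T)"
    "Cod A (FM (ran_ob T) a) = prod_ob A (fib (Cod C a)) (FO T)"
    using tt(1-3)[OF a, of "Cod C a"] a by (auto simp: ran_ob_def)
  show "y \<in> fib (Cod C a) \<Longrightarrow> prod_proj A (fib (Cod C a)) (FO T) y \<cdot> FM (ran_ob T) a =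
      FM T (lift a y) \<cdot> prod_proj A (fib (Dom C a)) (FO T) (Dom D (lift a y))"
    using tt(4)[OF a, of "Cod C a" y] a by (auto simp: ran_ob_def)
qed

text \<open>By uniqueness, identities lift to identities and a composite lifts to the composite of
  the lifts; the equations are then checked on projections.\<close>

lemma ran_ob_functor: "is_functor C A (ran_ob T)"
proof -
  note [simp] = functor_simps[OF T] ran_ob_simps
  have eq: "ran_ob T = mk_functor C (\<lambda>c. prod_ob A (fib c) (FO T)) (FM (ran_ob T))"
    by (simp add: ran_ob_def mk_functor_def)
  show ?thesis
  proof (subst eq, rule C.mk_functorI)
    fix c assume c[simp]: "c \<in> Ob C"
    show "FM (ran_ob T) (Id C c) = Id A (prod_ob A (fib c) (FO T))"
    proof (rule A.product_ext[OF ran_product[of c], of _ "prod_ob A (fib c) (FO T)"])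
      fix x assume x[simp]: "x \<in> fib c"
      have "lift (Id C c) x = Id D x"
        by (rule lift_eq) (use functor_simps(5)[OF w] fibD[OF x] in auto)
      then show "prod_proj A (fib c) (FO T) x \<cdot> FM (ran_ob T) (Id C c) =
          prod_proj A (fib c) (FO T) x \<cdot> Id A (prod_ob A (fib c) (FO T))"
        using ran_ob_simps(5)[of "Id C c" x] fibD[OF x] by simp
    qed auto
  next
    fix f g assume fg[simp]: "f \<in> Ar C" "g \<in> Ar C" "Cod C f = Dom C g"
    show "FM (ran_ob T) (g \<cdot>\<^bsub>C\<^esub> f) = FM (ran_ob T) g \<cdot> FM (ran_ob T) f"
    proof (rule A.product_ext[OF ran_product[of "Cod C g"], of _ "prod_ob A (fib (Dom C f)) (FO T)"])
      fix y assume y[simp]: "y \<in> fib (Cod C g)"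
      have y'[simp]: "y \<in> Ob D" "FO w y = Cod C g" using fibD[OF y] by auto
      let ?b = "lift g y"
      have b[simp]: "?b \<in> Ar D" "Cod D ?b = y" "FM w ?b = g" "FO w (Dom D ?b) = Dom C g" using y' by auto
      let ?a = "lift f (Dom D ?b)"
      have a[simp]: "?a \<in> Ar D" "Cod D ?a = Dom D ?b" "FM w ?a = f" "FO w (Dom D ?a) = Dom C f" by auto
      have l: "lift (g \<cdot>\<^bsub>C\<^esub> f) y = ?b \<cdot>\<^bsub>D\<^esub> ?a"
        by (rule lift_eq) (auto simp: functor_simps(6)[OF w])
      have e: "prod_proj A (fib (Cod C g)) (FO T) y \<cdot> FM (ran_ob T) g =
          FM T ?b \<cdot> prod_proj A (fib (Dom C g)) (FO T) (Dom D ?b)"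
        by (rule ran_ob_simps(5)) auto
      have "prod_proj A (fib (Cod C g)) (FO T) y \<cdot> (FM (ran_ob T) g \<cdot> FM (ran_ob T) f)
          = FM T ?b \<cdot> (prod_proj A (fib (Cod C f)) (FO T) (Dom D ?b) \<cdot> FM (ran_ob T) f)"
        by (subst A.assoc_eq[OF e]) auto
      also have "\<dots> = FM T ?b \<cdot> (FM T ?a \<cdot> prod_proj A (fib (Dom C f)) (FO T) (Dom D ?a))"
        by (subst ran_ob_simps(5)) auto
      also have "\<dots> = prod_proj A (fib (Cod C g)) (FO T) y \<cdot> FM (ran_ob T) (g \<cdot>\<^bsub>C\<^esub> f)"
        using ran_ob_simps(5)[of "g \<cdot>\<^bsub>C\<^esub> f" y] l by simp
      finally show "prod_proj A (fib (Cod C g)) (FO T) y \<cdot> FM (ran_ob T) (g \<cdot>\<^bsub>C\<^esub> f) =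
          prod_proj A (fib (Cod C g)) (FO T) y \<cdot> (FM (ran_ob T) g \<cdot> FM (ran_ob T) f)" by simp
    qed auto
  qed auto
qed

text \<open>Every arrow of \<open>D\<close> is the lift of its own image, so the equation that
  describes \<open>ran_ob T\<close> on projections is already the naturality square.\<close>

lemma ran_counit_Ar: "ran_counit T \<in> Ar (Fun D A)"
  unfolding ran_counit_def
proof (rule mk_ntI)
  note [simp] = functor_simps[OF T] ran_ob_simps(1-4)
  show "is_functor D A (fcomp D (ran_ob T) w)" by (rule D.fcomp_functor[OF w ran_ob_functor])
  fix f assume f[simp]: "f \<in> Ar D"
  show "prod_proj A (fib (FO w (Cod D f))) (FO T) (Cod D f) \<cdot> FM (fcomp D (ran_ob T) w) f =
      FM T f \<cdot> prod_proj A (fib (FO w (Dom D f))) (FO T) (Dom D f)"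
    using ran_ob_simps(5)[of "FM w f" "Cod D f"] by (simp add: lift_eqI)
qed (use T ran_ob_simps in \<open>auto intro: D.category_axioms\<close>)

end

text \<open>On projections, naturality reduces to that of \<open>t\<close> along the lifts of arrows
  of \<open>C\<close>.\<close>

lemma ran_map_simps:
  assumes t: "t \<in> Ar (Fun D A)"
  shows "ran_map t \<in> Ar (Fun C A)" "Dom (Fun C A) (ran_map t) = ran_ob (Dom (Fun D A) t)"
    "Cod (Fun C A) (ran_map t) = ran_ob (Cod (Fun D A) t)"
    "x \<in> fib c \<Longrightarrow> prod_proj A (fib c) (FO (Cod (Fun D A) t)) x \<cdot> NC (ran_map t) c =
      NC t x \<cdot> prod_proj A (fib c) (FO (Dom (Fun D A) t)) x"
proof -
  let ?S = "Dom (Fun D A) t" and ?T = "Cod (Fun D A) t"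
  note S = Fun_Ar_simps(1)[OF t] and T = Fun_Ar_simps(2)[OF t]
  note [simp] = Fun_Ar_simps[OF t] functor_simps[OF S] functor_simps[OF T]
    ran_proj_simps[OF S] ran_proj_simps[OF T] ran_ob_simps(1-4)[OF S] ran_ob_simps(1-4)[OF T]
  have r: "NC t x \<cdot> prod_proj A (fib c) (FO ?S) x \<in> Hom A (prod_ob A (fib c) (FO ?S)) (FO ?T x)" if "x \<in> fib c" for x c
    using that by simp
  let ?tup = "\<lambda>c. prod_tuple A (fib c) (FO ?T) (prod_ob A (fib c) (FO ?S)) (\<lambda>x. NC t x \<cdot> prod_proj A (fib c) (FO ?S) x)"
  have tt: "?tup c \<in> Ar A" "Dom A (?tup c) = prod_ob A (fib c) (FO ?S)" "Cod A (?tup c) = prod_ob A (fib c) (FO ?T)"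
    "x \<in> fib c \<Longrightarrow> prod_proj A (fib c) (FO ?T) x \<cdot> ?tup c = NC t x \<cdot> prod_proj A (fib c) (FO ?S) x" for c x
    by (rule ran_tuple_simps[OF T ran_proj_simps(1)[OF S] r], assumption)+
  have nc: "NC (ran_map t) c = prod_tuple A (fib c) (FO ?T) (prod_ob A (fib c) (FO ?S))
      (\<lambda>x. NC t x \<cdot> prod_proj A (fib c) (FO ?S) x)" if "c \<in> Ob C" for c
    using that by (simp add: ran_map_def)
  \<comment> \<open>An element of the fibre forces \<open>c\<close> to be an object of
    \<open>C\<close>.\<close>
  have p: "prod_proj A (fib c) (FO ?T) x \<cdot> NC (ran_map t) c = NC t x \<cdot> prod_proj A (fib c) (FO ?S) x"
    if "x \<in> fib c" for x c
    using tt(4)[of x c] that nc[of c] w_simps(1)[of x] by (auto simp: fib_def)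
  show "x \<in> fib c \<Longrightarrow> prod_proj A (fib c) (FO ?T) x \<cdot> NC (ran_map t) c = NC t x \<cdot> prod_proj A (fib c) (FO ?S) x"
    by (rule p)
  show "Dom (Fun C A) (ran_map t) = ran_ob ?S" "Cod (Fun C A) (ran_map t) = ran_ob ?T"
    by (simp_all add: ran_map_def)
  have [simp]: "NC (ran_map t) c \<in> Ar A" "Dom A (NC (ran_map t) c) = prod_ob A (fib c) (FO ?S)"
    "Cod A (NC (ran_map t) c) = prod_ob A (fib c) (FO ?T)" if "c \<in> Ob C" for c
    using tt(1-3)[of c] nc[OF that] by auto
  have "mk_nt C (ran_ob ?S) (ran_ob ?T) (NC (ran_map t)) \<in> Ar (Fun C A)"
  proof (rule mk_ntI)
    fix a assume a[simp]: "a \<in> Ar C"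
    show "NC (ran_map t) (Cod C a) \<cdot> FM (ran_ob ?S) a = FM (ran_ob ?T) a \<cdot> NC (ran_map t) (Dom C a)"
    proof (rule A.product_ext[OF ran_product[OF T], of _ "prod_ob A (fib (Dom C a)) (FO ?S)" "Cod C a"])
      fix y assume y[simp]: "y \<in> fib (Cod C a)"
      have y'[simp]: "y \<in> Ob D" "FO w y = Cod C a" using fibD[OF y] by auto
      let ?b = "lift a y"
      have b[simp]: "?b \<in> Ar D" "Cod D ?b = y" "FM w ?b = a" "FO w (Dom D ?b) = Dom C a" using y' by auto
      have "prod_proj A (fib (Cod C a)) (FO ?T) y \<cdot> (NC (ran_map t) (Cod C a) \<cdot> FM (ran_ob ?S) a)
          = NC t y \<cdot> (prod_proj A (fib (Cod C a)) (FO ?S) y \<cdot> FM (ran_ob ?S) a)"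
        by (subst A.assoc_eq[OF p]) auto
      also have "\<dots> = NC t y \<cdot> (FM ?S ?b \<cdot> prod_proj A (fib (Dom C a)) (FO ?S) (Dom D ?b))"
        by (subst ran_ob_simps(5)[OF S]) auto
      also have "\<dots> = FM ?T ?b \<cdot> (NC t (Dom D ?b) \<cdot> prod_proj A (fib (Dom C a)) (FO ?S) (Dom D ?b))"
        using Fun_naturality[OF t b(1)] by (subst A.assoc_eq) auto
      also have "\<dots> = FM ?T ?b \<cdot> (prod_proj A (fib (Dom C a)) (FO ?T) (Dom D ?b) \<cdot> NC (ran_map t) (Dom C a))"
        by (subst p) auto
      also have "\<dots> = prod_proj A (fib (Cod C a)) (FO ?T) y \<cdot> (FM (ran_ob ?T) a \<cdot> NC (ran_map t) (Dom C a))"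
        by (subst A.assoc_eq[OF ran_ob_simps(5)[OF T]]) auto
      finally show "prod_proj A (fib (Cod C a)) (FO ?T) y \<cdot> (NC (ran_map t) (Cod C a) \<cdot> FM (ran_ob ?S) a) =
         prod_proj A (fib (Cod C a)) (FO ?T) y \<cdot> (FM (ran_ob ?T) a \<cdot> NC (ran_map t) (Dom C a))" .
    qed auto
  qed (use ran_ob_functor[OF S] ran_ob_functor[OF T] in \<open>auto intro: C.category_axioms\<close>)
  moreover have "mk_nt C (ran_ob ?S) (ran_ob ?T) (NC (ran_map t)) = ran_map t"
    by (simp add: ran_map_def mk_nt_def)
  ultimately show "ran_map t \<in> Ar (Fun C A)" by simp
qed

lemma ran_functor: "is_functor (Fun D A) (Fun C A) ran"
  unfolding ran_def
proof (rule FD.Fun.mk_functorI)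
  show "\<And>T. T \<in> Ob (Fun D A) \<Longrightarrow> ran_ob T \<in> Ob (Fun C A)" by (simp add: Fun_Ob ran_ob_functor)
  show "\<And>t. t \<in> Ar (Fun D A) \<Longrightarrow> ran_map t \<in> Hom (Fun C A) (ran_ob (Dom (Fun D A) t)) (ran_ob (Cod (Fun D A) t))"
    by (simp add: ran_map_simps)
  fix T assume T: "T \<in> Ob (Fun D A)"
  then have T': "is_functor D A T" by (simp add: Fun_Ob)
  have I: "Id (Fun D A) T \<in> Ar (Fun D A)" by (rule FD.Fun_Id_Ar[OF T'])
  note rI = ran_map_simps[OF I]
  note [simp] = Fun_Ar_simps[OF rI(1)] functor_simps[OF T'] ran_ob_simps(1)[OF T'] ran_proj_simps[OF T']
  show "ran_map (Id (Fun D A) T) = Id (Fun C A) (ran_ob T)"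
  proof (rule Fun_eqI[of _ C A])
    fix c assume c[simp]: "c \<in> Ob C"
    have [simp]: "NC (ran_map (Id (Fun D A) T)) c \<in> Ar A" "Dom A (NC (ran_map (Id (Fun D A) T)) c) = prod_ob A (fib c) (FO T)"
      "Cod A (NC (ran_map (Id (Fun D A) T)) c) = prod_ob A (fib c) (FO T)"
      using Fun_Ar_simps[OF rI(1)] rI(2,3) c by auto
    show "NC (ran_map (Id (Fun D A) T)) c = NC (Id (Fun C A) (ran_ob T)) c"
      by (rule A.product_ext[OF ran_product[OF T'], of _ "prod_ob A (fib c) (FO T)" c])
        (use rI(4) in auto)
  qed (use rI in \<open>auto intro!: FC.Fun_Id_Ar ran_ob_functor[OF T']\<close>)
next
  fix s t assume st: "s \<in> Ar (Fun D A)" "t \<in> Ar (Fun D A)" "Cod (Fun D A) s = Dom (Fun D A) t"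
  let ?S = "Dom (Fun D A) s" and ?T = "Dom (Fun D A) t" and ?V = "Cod (Fun D A) t"
  have ts: "t \<cdot>\<^bsub>Fun D A\<^esub> s \<in> Ar (Fun D A)" by (rule FD.Fun_comp_Ar) (use st in auto)
  note rs = ran_map_simps[OF st(1)] and rt = ran_map_simps[OF st(2)] and rts = ran_map_simps[OF ts]
  note S = Fun_Ar_simps(1)[OF st(1)] and T = Fun_Ar_simps(1)[OF st(2)] and V = Fun_Ar_simps(2)[OF st(2)]
  note [simp] = Fun_Ar_simps[OF st(1)] Fun_Ar_simps[OF st(2)] st(3)
    functor_simps[OF S] functor_simps[OF T] functor_simps[OF V]
    ran_proj_simps[OF S] ran_proj_simps[OF T] ran_proj_simps[OF V]
    ran_ob_simps(1)[OF S] ran_ob_simps(1)[OF T] ran_ob_simps(1)[OF V]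
    Fun_Ar_simps(3-5)[OF rs(1)] Fun_Ar_simps(3-5)[OF rt(1)] Fun_Ar_simps(3-5)[OF rts(1)]
  show "ran_map (t \<cdot>\<^bsub>Fun D A\<^esub> s) = ran_map t \<cdot>\<^bsub>Fun C A\<^esub> ran_map s"
  proof (rule Fun_eqI[of _ C A])
    fix c assume c[simp]: "c \<in> Ob C"
    show "NC (ran_map (t \<cdot>\<^bsub>Fun D A\<^esub> s)) c = NC (ran_map t \<cdot>\<^bsub>Fun C A\<^esub> ran_map s) c"
    proof (rule A.product_ext[OF ran_product[OF V], of _ "prod_ob A (fib c) (FO ?S)" c])
      fix x assume x: "x \<in> fib c"
      then have [simp]: "x \<in> Ob D" "FO w x = c" by auto
      have "prod_proj A (fib c) (FO ?V) x \<cdot> (NC (ran_map t) c \<cdot> NC (ran_map s) c)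
          = NC t x \<cdot> (prod_proj A (fib c) (FO ?T) x \<cdot> NC (ran_map s) c)"
        by (subst A.assoc_eq[OF rt(4)]) (auto simp: rs(2,3) rt(2,3))
      also have "\<dots> = NC t x \<cdot> (NC s x \<cdot> prod_proj A (fib c) (FO ?S) x)"
        using rs(4)[of x c] by simp
      finally show "prod_proj A (fib c) (FO ?V) x \<cdot> NC (ran_map (t \<cdot>\<^bsub>Fun D A\<^esub> s)) c =
         prod_proj A (fib c) (FO ?V) x \<cdot> NC (ran_map t \<cdot>\<^bsub>Fun C A\<^esub> ran_map s) c"
        using rts(4)[of x c] by simp
    qed (auto simp: rs(2,3) rt(2,3) rts(2,3))
  qed (use rs rt rts in \<open>auto intro!: FC.Fun_comp_Ar\<close>)
qed

lemma ran_simps [simp]: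
  "is_functor D A T \<Longrightarrow> FO ran T = ran_ob T" "t \<in> Ar (Fun D A) \<Longrightarrow> FM ran t = ran_map t"
  by (simp_all add: ran_def Fun_Ob)

text \<open>A transformation \<open>f\<close> from \<open>S \<circ> w\<close> to \<open>T\<close>
  restricts on the fibre over \<open>c\<close> to a family of arrows out of \<open>FO S c\<close>;
  its lift to the product is the component of \<open>h\<close> at \<open>c\<close>. Naturality of
  \<open>f\<close> along lifts gives naturality of \<open>h\<close>, and the projections determine
  \<open>h\<close>.\<close>

lemma ran_universal: "universal_counit (Fun C A) (Fun D A) W ran ran_counit"
  unfolding universal_counit_def
proof (intro conjI ballI)
  fix T assume "T \<in> Ob (Fun D A)"
  then have T: "is_functor D A T" by (simp add: Fun_Ob)
  note e = ran_counit_Ar[OF T]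
  have [simp]: "Dom (Fun D A) (ran_counit T) = fcomp D (ran_ob T) w" "Cod (Fun D A) (ran_counit T) = T"
    and eNC: "\<And>x. x \<in> Ob D \<Longrightarrow> NC (ran_counit T) x = prod_proj A (fib (FO w x)) (FO T) x"
    unfolding ran_counit_def by auto
  show "ran_counit T \<in> Hom (Fun D A) (FO W (FO ran T)) T"
    using e T ran_ob_functor[OF T] by simp
  fix S f assume "S \<in> Ob (Fun C A)" and f: "f \<in> Hom (Fun D A) (FO W S) T"
  then have S: "is_functor C A S" by (simp add: Fun_Ob)
  have f': "f \<in> Ar (Fun D A)" "Dom (Fun D A) f = fcomp D S w" "Cod (Fun D A) f = T" using f S by auto
  note [simp] = functor_simps[OF T] functor_simps[OF S] ran_proj_simps[OF T] ran_ob_simps(1-4)[OF T] f'(2,3)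
    Fun_Ar_simps(3-5)[OF f'(1)]
  have "\<exists>\<eta>. \<eta> \<in> Hom A (FO S c) (prod_ob A (fib c) (FO T)) \<and>
      (\<forall>x \<in> fib c. prod_proj A (fib c) (FO T) x \<cdot> \<eta> = NC f x)" if "c \<in> Ob C" for c
  proof -
    have "NC f x \<in> Hom A (FO S c) (FO T x)" if "x \<in> fib c" for x using fibD[OF that] by simp
    then show ?thesis
      using A.product_ex1[OF ran_product[OF T], of "FO S c" c "NC f"] that by auto
  qed
  then obtain \<eta> where \<eta>: "\<And>c. c \<in> Ob C \<Longrightarrow> \<eta> c \<in> Hom A (FO S c) (prod_ob A (fib c) (FO T))"
    "\<And>c x. c \<in> Ob C \<Longrightarrow> x \<in> fib c \<Longrightarrow> prod_proj A (fib c) (FO T) x \<cdot> \<eta> c = NC f x" by metis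
  note [simp] = \<eta>(1)[simplified]
  have h: "mk_nt C S (ran_ob T) \<eta> \<in> Ar (Fun C A)"
  proof (rule mk_ntI)
    fix a assume a[simp]: "a \<in> Ar C"
    show "\<eta> (Cod C a) \<cdot> FM S a = FM (ran_ob T) a \<cdot> \<eta> (Dom C a)"
    proof (rule A.product_ext[OF ran_product[OF T], of _ "FO S (Dom C a)" "Cod C a"])
      fix y assume y[simp]: "y \<in> fib (Cod C a)"
      have y'[simp]: "y \<in> Ob D" "FO w y = Cod C a" using fibD[OF y] by auto
      let ?b = "lift a y"
      have b[simp]: "?b \<in> Ar D" "Cod D ?b = y" "FM w ?b = a" "FO w (Dom D ?b) = Dom C a" using y' by auto
      have "prod_proj A (fib (Cod C a)) (FO T) y \<cdot> (\<eta> (Cod C a) \<cdot> FM S a) = NC f y \<cdot> FM S a"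
        by (rule A.assoc_eq[OF \<eta>(2)]) auto
      \<comment> \<open>Naturality of \<open>f\<close> along \<open>?b\<close>, whose image under
        \<open>w\<close> is \<open>a\<close>.\<close>
      also have "\<dots> = FM T ?b \<cdot> NC f (Dom D ?b)"
        using Fun_naturality[OF f'(1) b(1)] by simp
      also have "\<dots> = FM T ?b \<cdot> (prod_proj A (fib (Dom C a)) (FO T) (Dom D ?b) \<cdot> \<eta> (Dom C a))"
        by (subst \<eta>(2)) auto
      also have "\<dots> = prod_proj A (fib (Cod C a)) (FO T) y \<cdot> (FM (ran_ob T) a \<cdot> \<eta> (Dom C a))"
        by (subst A.assoc_eq[OF ran_ob_simps(5)[OF T]]) auto
      finally show "prod_proj A (fib (Cod C a)) (FO T) y \<cdot> (\<eta> (Cod C a) \<cdot> FM S a) =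
         prod_proj A (fib (Cod C a)) (FO T) y \<cdot> (FM (ran_ob T) a \<cdot> \<eta> (Dom C a))" .
    qed auto
  qed (use S ran_ob_functor[OF T] in \<open>auto intro: C.category_axioms\<close>)
  show "\<exists>!h. h \<in> Hom (Fun C A) S (FO ran T) \<and> ran_counit T \<cdot>\<^bsub>Fun D A\<^esub> FM W h = f"
  proof (rule ex1I[of _ "mk_nt C S (ran_ob T) \<eta>"])
    have "ran_counit T \<cdot>\<^bsub>Fun D A\<^esub> FM W (mk_nt C S (ran_ob T) \<eta>) = f"
      by (rule Fun_eqI[of _ D A]) (use h e f' W_Ar[OF h] in \<open>auto intro!: FD.Fun_comp_Ar simp: eNC \<eta>(2)\<close>)
    then show "mk_nt C S (ran_ob T) \<eta> \<in> Hom (Fun C A) S (FO ran T) \<and>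
        ran_counit T \<cdot>\<^bsub>Fun D A\<^esub> FM W (mk_nt C S (ran_ob T) \<eta>) = f"
      using h T by simp
  next
    fix k assume k: "k \<in> Hom (Fun C A) S (FO ran T) \<and> ran_counit T \<cdot>\<^bsub>Fun D A\<^esub> FM W k = f"
    then have k': "k \<in> Ar (Fun C A)" "Dom (Fun C A) k = S" "Cod (Fun C A) k = ran_ob T" using T by auto
    note [simp] = Fun_Ar_simps(3-5)[OF k'(1)] k'(2,3)
    show "k = mk_nt C S (ran_ob T) \<eta>"
    proof (rule Fun_eqI[OF k'(1) h])
      fix c assume c[simp]: "c \<in> Ob C"
      show "NC k c = NC (mk_nt C S (ran_ob T) \<eta>) c"
      proof (rule A.product_ext[OF ran_product[OF T], of _ "FO S c" c])
        fix x assume x[simp]: "x \<in> fib c"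
        then have x': "x \<in> Ob D" "FO w x = c" by (rule fibD)+
        have "NC (ran_counit T \<cdot>\<^bsub>Fun D A\<^esub> FM W k) x = NC f x" using k by simp
        then show "prod_proj A (fib c) (FO T) x \<cdot> NC k c = prod_proj A (fib c) (FO T) x \<cdot> NC (mk_nt C S (ran_ob T) \<eta>) c"
          using x' k' by (simp add: eNC \<eta>(2))
      qed auto
    qed auto
  qed
next
  fix t assume t: "t \<in> Ar (Fun D A)"
  let ?S = "Dom (Fun D A) t" and ?T = "Cod (Fun D A) t"
  note S = Fun_Ar_simps(1)[OF t] and T = Fun_Ar_simps(2)[OF t]
  note rt = ran_map_simps[OF t]
  note e = ran_counit_Ar[OF S] ran_counit_Ar[OF T]
  have eNC: "\<And>x T. x \<in> Ob D \<Longrightarrow> NC (ran_counit T) x = prod_proj A (fib (FO w x)) (FO T) x"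
    and [simp]: "\<And>T. Dom (Fun D A) (ran_counit T) = fcomp D (ran_ob T) w" "\<And>T. Cod (Fun D A) (ran_counit T) = T"
    unfolding ran_counit_def by auto
  show "t \<cdot>\<^bsub>Fun D A\<^esub> ran_counit ?S = ran_counit ?T \<cdot>\<^bsub>Fun D A\<^esub> FM W (FM ran t)"
    by (rule Fun_eqI[of _ D A])
      (use t e rt W_Ar[OF rt(1)] in \<open>auto intro!: FD.Fun_comp_Ar simp: eNC\<close>)
qed

lemma ran_is_right_adjoint: "is_right_adjoint (Fun C A) (Fun D A) W ran"
  by (rule counit_is_right_adjoint[OF FC.Fun_category FD.Fun_category W_functor ran_functor ran_universal])

text \<open>The given adjoint is compared with \<open>ran\<close> by an isomorphism compatible with
  the counits, so its own counit takes over the role of the product projections. Additivity,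
  exactness and the cochains of the given adjoint are all treated through this.\<close>

lemma right_adjoint_product:
  assumes R: "is_functor (Fun D A) (Fun C A) R" and \<epsilon>: "universal_counit (Fun C A) (Fun D A) W R \<epsilon>"
    and T: "is_functor D A T" and c: "c \<in> Ob C"
  shows "is_product A (fib c) (FO T) (FO (FO R T) c) (NC (\<epsilon> T))"
proof -
  have T': "T \<in> Ob (Fun D A)" using T by (simp add: Fun_Ob)
  obtain h where h: "is_iso (Fun C A) h" "Dom (Fun C A) h = FO R T" "Cod (Fun C A) h = FO ran T"
    "ran_counit T \<cdot>\<^bsub>Fun D A\<^esub> FM W h = \<epsilon> T"
    using counit_comparison[OF FC.Fun_category FD.Fun_category W_functor R ran_functor \<epsilon> ran_universal T'] by metis
  have h': "h \<in> Ar (Fun C A)" using h(1) by (simp add: is_iso_def)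
  have *: "is_product A (fib c) (FO T) (FO (FO R T) c) (\<lambda>x. prod_proj A (fib c) (FO T) x \<cdot> NC h c)"
    by (rule A.product_transport[OF ran_product[OF T] FC.Fun_isoD[OF h(1) c]])
      (use Fun_Ar_simps[OF h'] h T c in \<open>simp add: ran_ob_simps(1)[OF T]\<close>)
  have "NC (\<epsilon> T) x = prod_proj A (fib c) (FO T) x \<cdot> NC h c" if "x \<in> fib c" for x
    unfolding h(4)[symmetric] using fibD[OF that] h' by (simp add: ran_counit_def)
  then show ?thesis by (intro A.product_cong[OF *]) simp_all
qed

end

section \<open>Satellites of exact functors\<close>

context preadditive_category
begin

text \<open>\<open>f\<close> factors through its image, and that image is a kernel of
  \<open>g\<close>.\<close>

lemma exact_at_comp_zero:
  assumes "exact_at A f g" "g \<in> Ar A"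
  shows "g \<cdot> f = HZero A (Dom A f) (Cod A g)"
proof -
  obtain m c where c: "is_cokernel A c f" and mc: "is_kernel A m c" and mg: "is_kernel A m g"
    using assms(1) unfolding exact_at_def is_image_def by blast
  note [simp] = cokernelD[OF c] kernelD(2,3)[OF mc] kernelD(3)[OF mg, symmetric] kernelD(4)[OF mg] assms(2)
  have "\<exists>l. l \<in> Ar A \<and> Dom A l = Dom A f \<and> Cod A l = Dom A m \<and> m \<cdot> l = f"
    by (rule kernel_lift[OF mc, of f]) auto
  then obtain l where l: "l \<in> Ar A" "Dom A l = Dom A f" "Cod A l = Dom A m" "m \<cdot> l = f" by blast
  have "g \<cdot> (m \<cdot> l) = HZero A (Dom A m) (Cod A g) \<cdot> l"
    by (rule assoc_eq) (use l kernelD[OF mg] in auto)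
  then show ?thesis using l Dom_Ob[of m] by simp
qed

lemma to_zero_object_eq:
  assumes "is_zero_object A z" "f \<in> Ar A" "g \<in> Ar A" "Dom A f = Dom A g" "Cod A f = z" "Cod A g = z"
  shows "f = g"
  using zero_object_HZero(1)[OF assms(1)] assms(2-6) by metis

lemma from_zero_object_eq:
  assumes "is_zero_object A z" "f \<in> Ar A" "g \<in> Ar A" "Cod A f = Cod A g" "Dom A f = z" "Dom A g = z"
  shows "f = g"
  using zero_object_HZero(2)[OF assms(1)] assms(2-6) by metis

end

locale exact_functor = X: preadditive_category X + Y: preadditive_category Y
  for X :: "('o, 'm) pcat" and Y :: "('p, 'n) pcat" +
  fixes F z
  assumes additive: "additive_functor X Y F" and zero: "is_zero_object Y z"
    and exact: "short_exact X f g \<Longrightarrow> short_exact Y (FM F f) (FM F g)"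
begin

lemma F: "is_functor X Y F"
  using additive unfolding additive_functor_def by blast

sublocale XY: additive_functor_category X Y by unfold_locales

lemma z_Ob [simp]: "z \<in> Ob Y"
  by (rule Y.zero_object_Ob[OF zero])

definition zero_functor where
  "zero_functor = mk_functor X (\<lambda>_. z) (\<lambda>_. Id Y z)"

lemma zero_functor: "is_functor X Y zero_functor"
  unfolding zero_functor_def by (rule X.mk_functorI) auto

lemma zero_functor_simps [simp]:
  "x \<in> Ob X \<Longrightarrow> FO zero_functor x = z" "f \<in> Ar X \<Longrightarrow> FM zero_functor f = Id Y z"
  by (simp_all add: zero_functor_def)

lemma short_exact_simps:
  assumes "short_exact X f g"
  shows "f \<in> Ar X" "g \<in> Ar X" "Cod X f = Dom X g"
  using assms unfolding short_exact_def monic_def epic_def exact_at_def by auto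

definition sat :: "nat \<Rightarrow> ('o, 'm, 'p, 'n) functor_data" where
  "sat n = (if n = 0 then F else zero_functor)"

text \<open>A connecting morphism ends in positive degree, where all values are zero objects, so
  there is no other choice.\<close>

definition sat_delta :: "nat \<Rightarrow> 'm \<Rightarrow> 'm \<Rightarrow> 'n" where
  "sat_delta n f g = HZero Y (FO (sat n) (Cod X g)) z"

lemma sat_simps [simp]: "sat 0 = F" "sat (Suc n) = zero_functor"
  by (simp_all add: sat_def)

lemma sat_functor: "is_functor X Y (sat n)"
  unfolding sat_def using F zero_functor by simp

lemma sat_delta_simps [simp]:
  assumes "g \<in> Ar X"
  shows "sat_delta n f g \<in> Ar Y" "Dom Y (sat_delta n f g) = FO (sat n) (Cod X g)" "Cod Y (sat_delta n f g) = z"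
  using assms functor_simps(1)[OF sat_functor, of "Cod X g" n] unfolding sat_delta_def by auto

text \<open>In degree 0 exactness is that of \<open>F\<close>, and since \<open>F g\<close> is epic
  it may be followed by the zero connecting morphism. At all remaining places the middle object is
  zero.\<close>

lemma sat_delta_functor: "delta_functor X Y sat sat_delta"
  unfolding delta_functor_def
proof (intro conjI allI impI)
  note [simp] = functor_simps[OF F] functor_simps[OF zero_functor]
  have "additive_functor X Y zero_functor"
    unfolding additive_functor_def
    by (auto intro!: zero_functor Y.to_zero_object_eq[OF zero])
  then show "additive_functor X Y (sat n)" for n
    unfolding sat_def using additive by simp
  fix f g assume fg: "short_exact X f g"
  note s[simp] = short_exact_simps[OF fg]
  have e: "short_exact Y (FM F f) (FM F g)" by (rule exact[OF fg])
  show "monic Y (FM (sat 0) f)" using e by (simp add: short_exact_def)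
  fix n
  show "sat_delta n f g \<in> Hom Y (FO (sat n) (Cod X g)) (FO (sat (Suc n)) (Dom X f))" by simp
  show "exact_at Y (FM (sat n) f) (FM (sat n) g)"
  proof (cases n)
    case 0 then show ?thesis using e by (simp add: short_exact_def)
  next
    case (Suc m) then show ?thesis by (intro Y.exact_at_zero[OF zero]) auto
  qed
  show "exact_at Y (FM (sat n) g) (sat_delta n f g)"
  proof (cases n)
    case 0 then show ?thesis using e by (intro Y.exact_at_epic[OF _ zero]) (auto simp: short_exact_def)
  next
    case (Suc m) then show ?thesis by (intro Y.exact_at_zero[OF zero]) auto
  qed
  show "exact_at Y (sat_delta n f g) (FM (sat (Suc n)) f)"
    by (intro Y.exact_at_zero[OF zero]) auto
next
  note [simp] = functor_simps[OF sat_functor] functor_simps[OF zero_functor]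
  fix f g f' g' a b c n
  assume "short_exact X f g \<and> short_exact X f' g' \<and> a \<in> Hom X (Dom X f) (Dom X f') \<and>
    b \<in> Hom X (Cod X f) (Cod X f') \<and> c \<in> Hom X (Cod X g) (Cod X g') \<and> b \<cdot>\<^bsub>X\<^esub> f = f' \<cdot>\<^bsub>X\<^esub> a \<and> c \<cdot>\<^bsub>X\<^esub> g = g' \<cdot>\<^bsub>X\<^esub> b"
  then have fg: "short_exact X f g" "short_exact X f' g'" and ac: "a \<in> Ar X" "c \<in> Ar X" "Dom X a = Dom X f" "Cod X a = Dom X f'"
    "Dom X c = Cod X g" "Cod X c = Cod X g'" by auto
  note s = short_exact_simps[OF fg(1)] short_exact_simps[OF fg(2)]
  show "FM (sat (Suc n)) a \<cdot>\<^bsub>Y\<^esub> sat_delta n f g = sat_delta n f' g' \<cdot>\<^bsub>Y\<^esub> FM (sat n) c"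
    by (rule Y.to_zero_object_eq[OF zero]) (use s ac in auto)
qed

text \<open>In positive degrees the source is zero, so \<open>t\<close> can only be continued by
  zero arrows, and what needs proof is that these respect the connecting morphisms.\<close>

lemma sat_right_satellites: "right_satellites X Y F sat sat_delta"
  unfolding right_satellites_def
proof (intro conjI sat_delta_functor allI impI)
  show "sat 0 = F" by simp
  fix G \<gamma> t assume as: "delta_functor X Y G \<gamma> \<and> nat_trans X Y (sat 0) (G 0) t"
  then have d: "delta_functor X Y G \<gamma>" and t: "nat_trans X Y F (G 0) t" by auto
  have G: "is_functor X Y (G n)" for n
    using d unfolding delta_functor_def additive_functor_def by blast
  have t': "t \<in> Ar (Fun X Y)" "Dom (Fun X Y) t = F" "Cod (Fun X Y) t = G 0"
    using t unfolding Fun_Hom[symmetric] by auto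
  note [simp] = functor_simps[OF F] functor_simps[OF G] Fun_Ar_simps(3-5)[OF t'(1)] t'(2,3)
    functor_simps[OF zero_functor]
  define \<tau> where "\<tau> n = (if n = 0 then t else HZero (Fun X Y) zero_functor (G n))" for n
  have \<tau>n: "nat_trans X Y (sat n) (G n) (\<tau> n)" for n
  proof (cases n)
    case 0 then show ?thesis using t by (simp add: \<tau>_def)
  next
    case (Suc m) then show ?thesis unfolding Fun_Hom[symmetric]
      using XY.Fun_HZero_Ar[OF zero_functor G[of n]] by (simp add: \<tau>_def)
  qed
  have comm: "NC (\<tau> (Suc n)) (Dom X f) \<cdot>\<^bsub>Y\<^esub> sat_delta n f g = \<gamma> n f g \<cdot>\<^bsub>Y\<^esub> NC (\<tau> n) (Cod X g)"
    if fg: "short_exact X f g" for f g n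
  proof -
    note s[simp] = short_exact_simps[OF fg]
    have \<gamma>H: "\<gamma> n f g \<in> Hom Y (FO (G n) (Cod X g)) (FO (G (Suc n)) (Dom X f))"
      and ex: "exact_at Y (FM (G n) g) (\<gamma> n f g)"
      using d fg unfolding delta_functor_def by blast+
    note [simp] = \<gamma>H[simplified]
    have l: "NC (\<tau> (Suc n)) (Dom X f) \<cdot>\<^bsub>Y\<^esub> sat_delta n f g = HZero Y (FO (sat n) (Cod X g)) (FO (G (Suc n)) (Dom X f))"
      unfolding \<tau>_def by simp
    show ?thesis
    proof (cases n)
      case 0
      \<comment> \<open>The composite of \<open>\<gamma> 0 f g\<close> with \<open>t\<close> is
        shown to vanish after precomposition with the epic \<open>FM F g\<close>: naturality of
        \<open>t\<close> moves it past \<open>FM (G 0) g\<close>, which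
        \<open>\<gamma> 0 f g\<close> kills by exactness for \<open>G\<close>.\<close>
      have "(\<gamma> 0 f g \<cdot>\<^bsub>Y\<^esub> NC t (Cod X g)) \<cdot>\<^bsub>Y\<^esub> FM F g = \<gamma> 0 f g \<cdot>\<^bsub>Y\<^esub> (FM (G 0) g \<cdot>\<^bsub>Y\<^esub> NC t (Dom X g))"
        using Fun_naturality[OF t'(1) s(2)] 0 \<gamma>H by simp
      also have "\<dots> = HZero Y (FO F (Dom X g)) (FO (G (Suc 0)) (Dom X f))"
        using Y.exact_at_comp_zero[OF ex] 0 \<gamma>H
        by (subst Y.assoc_eq[of "\<gamma> 0 f g" "FM (G 0) g"]) auto
      finally have "\<gamma> 0 f g \<cdot>\<^bsub>Y\<^esub> NC t (Cod X g) = HZero Y (FO F (Cod X g)) (FO (G (Suc 0)) (Dom X f))"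
        using exact[OF fg] 0 \<gamma>H unfolding short_exact_def
        by (intro Y.epicD[of "FM F g" "\<gamma> 0 f g \<cdot>\<^bsub>Y\<^esub> NC t (Cod X g)" "HZero Y (FO F (Cod X g)) (FO (G (Suc 0)) (Dom X f))"]) auto
      then show ?thesis using l 0 by (simp add: \<tau>_def)
    next
      case (Suc m)
      then have "NC (\<tau> n) (Cod X g) = HZero Y z (FO (G n) (Cod X g))" by (simp add: \<tau>_def)
      then show ?thesis using l Suc \<gamma>H by simp
    qed
  qed
  show "\<exists>!\<tau>. \<tau> 0 = t \<and> (\<forall>n. nat_trans X Y (sat n) (G n) (\<tau> n)) \<and>
      (\<forall>f g n. short_exact X f g \<longrightarrow> NC (\<tau> (Suc n)) (Dom X f) \<cdot>\<^bsub>Y\<^esub> sat_delta n f g = \<gamma> n f g \<cdot>\<^bsub>Y\<^esub> NC (\<tau> n) (Cod X g))"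
  proof (rule ex1I[of _ \<tau>], goal_cases)
    case 1 show ?case using \<tau>n comm by (simp add: \<tau>_def)
  next
    case (2 \<sigma>)
    have "\<sigma> n = \<tau> n" for n
    proof (cases n)
      case 0 then show ?thesis using 2 by (simp add: \<tau>_def)
    next
      case (Suc m)
      have h: "\<sigma> n \<in> Hom (Fun X Y) zero_functor (G n)" "\<tau> n \<in> Hom (Fun X Y) zero_functor (G n)"
        unfolding Fun_Hom using 2 \<tau>n[of n] Suc by (auto dest: spec[of _ "Suc m"])
      show ?thesis
      proof (rule Fun_eqI[of _ X Y])
        fix x assume "x \<in> Ob X"
        then show "NC (\<sigma> n) x = NC (\<tau> n) x"
          using h Fun_Ar_simps(3-5)[of "\<sigma> n" X Y x] Fun_Ar_simps(3-5)[of "\<tau> n" X Y x]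
          by (intro Y.from_zero_object_eq[OF zero]) auto
      qed (use h in auto)
    qed
    then show ?case by blast
  qed
qed

text \<open>Uniqueness is applied with \<open>R\<close> as its own target: the identities, and the
  family that is the identity in degree 0 and zero above, both extend the identity of
  \<open>F\<close>. Hence they coincide, and the identities in positive degrees are zero.\<close>

lemma satellites_zero:
  assumes R: "right_satellites X Y F R \<delta>" and n: "n > 0" and x: "x \<in> Ob X"
  shows "is_zero_object Y (FO (R n) x)"
proof -
  have d: "delta_functor X Y R \<delta>" and R0: "R 0 = F"
    using R unfolding right_satellites_def by blast+
  have RF: "is_functor X Y (R n)" for n
    using d unfolding delta_functor_def additive_functor_def by blast
  note [simp] = functor_simps[OF RF]
  define \<sigma> where "\<sigma> n = Id (Fun X Y) (R n)" for n
  define \<tau> where "\<tau> n = (if n = 0 then Id (Fun X Y) (R n) else HZero (Fun X Y) (R n) (R n))" for n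
  have nat: "nat_trans X Y (R n) (R n) (\<sigma> n)" "nat_trans X Y (R n) (R n) (\<tau> n)" for n
    unfolding Fun_Hom[symmetric] \<sigma>_def \<tau>_def
    using XY.Fun_Id_Ar[OF RF[of n]] XY.Fun_HZero_Ar[OF RF[of n] RF[of n]] by auto
  have comm: "NC (\<sigma> (Suc n)) (Dom X f) \<cdot>\<^bsub>Y\<^esub> \<delta> n f g = \<delta> n f g \<cdot>\<^bsub>Y\<^esub> NC (\<sigma> n) (Cod X g)"
    "NC (\<tau> (Suc n)) (Dom X f) \<cdot>\<^bsub>Y\<^esub> \<delta> n f g = \<delta> n f g \<cdot>\<^bsub>Y\<^esub> NC (\<tau> n) (Cod X g)"
    if fg: "short_exact X f g" for f g n
  proof -
    note s[simp] = short_exact_simps[OF fg]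
    have \<delta>H: "\<delta> n f g \<in> Hom Y (FO (R n) (Cod X g)) (FO (R (Suc n)) (Dom X f))"
      and ex: "exact_at Y (FM (R n) g) (\<delta> n f g)"
      using d fg unfolding delta_functor_def by blast+
    note [simp] = \<delta>H[simplified]
    show "NC (\<sigma> (Suc n)) (Dom X f) \<cdot>\<^bsub>Y\<^esub> \<delta> n f g = \<delta> n f g \<cdot>\<^bsub>Y\<^esub> NC (\<sigma> n) (Cod X g)"
      by (simp add: \<sigma>_def)
    show "NC (\<tau> (Suc n)) (Dom X f) \<cdot>\<^bsub>Y\<^esub> \<delta> n f g = \<delta> n f g \<cdot>\<^bsub>Y\<^esub> NC (\<tau> n) (Cod X g)"
    proof (cases n)
      case 0
      \<comment> \<open>\<open>R 0\<close> is the exact functor \<open>F\<close>, so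
        \<open>FM F g\<close> is epic; as the connecting morphism out of degree 0 kills it, that
        morphism is zero. This makes the truncated family compatible where it switches from identity
        to zero.\<close>
      have "\<delta> 0 f g = HZero Y (FO (R 0) (Cod X g)) (FO (R (Suc 0)) (Dom X f))"
        using exact[OF fg] 0 \<delta>H R0 Y.exact_at_comp_zero[OF ex] unfolding short_exact_def
        by (intro Y.epicD[of "FM F g" "\<delta> 0 f g" "HZero Y (FO (R 0) (Cod X g)) (FO (R (Suc 0)) (Dom X f))"]) auto
      then show ?thesis using 0 by (simp add: \<tau>_def)
    next
      case (Suc m)
      then show ?thesis using \<delta>H by (simp add: \<tau>_def)
    qed
  qed
  have "nat_trans X Y (R 0) (R 0) (\<sigma> 0)" by (rule nat)
  with R d have "\<exists>!\<upsilon>. \<upsilon> 0 = \<sigma> 0 \<and> (\<forall>n. nat_trans X Y (R n) (R n) (\<upsilon> n)) \<and>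
      (\<forall>f g n. short_exact X f g \<longrightarrow> NC (\<upsilon> (Suc n)) (Dom X f) \<cdot>\<^bsub>Y\<^esub> \<delta> n f g = \<delta> n f g \<cdot>\<^bsub>Y\<^esub> NC (\<upsilon> n) (Cod X g))"
    unfolding right_satellites_def by blast
  moreover have "\<tau> 0 = \<sigma> 0" by (simp add: \<tau>_def \<sigma>_def)
  ultimately have "\<sigma> = \<tau>" using nat comm by (elim ex1E) (metis (no_types, lifting))
  then have "NC (\<sigma> n) x = NC (\<tau> n) x" by simp
  then show ?thesis using n x by (simp add: \<sigma>_def \<tau>_def Y.zero_object_iff)
qed

end

section \<open>Exactness of an arbitrary right Kan extension along a discrete fibration\<close>

context fibration_kan
begin

context
  fixes R \<epsilon>
  assumes R: "is_functor (Fun D A) (Fun C A) R"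
    and \<epsilon>: "universal_counit (Fun C A) (Fun D A) W R \<epsilon>"
begin

lemma R_Ob: "is_functor D A T \<Longrightarrow> is_functor C A (FO R T)"
  using functor_simps(1)[OF R, of T] by (simp add: Fun_Ob)

lemma R_Ar:
  assumes "t \<in> Ar (Fun D A)"
  shows "FM R t \<in> Ar (Fun C A)" "Dom (Fun C A) (FM R t) = FO R (Dom (Fun D A) t)"
    "Cod (Fun C A) (FM R t) = FO R (Cod (Fun D A) t)"
  using functor_simps(2-4)[OF R assms] by auto

lemma counit_Ar:
  assumes "is_functor D A T"
  shows "\<epsilon> T \<in> Ar (Fun D A)" "Dom (Fun D A) (\<epsilon> T) = fcomp D (FO R T) w" "Cod (Fun D A) (\<epsilon> T) = T"
  using universal_counit_simps[OF \<epsilon>, of T] assms R_Ob[OF assms] by (auto simp: Fun_Ob)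

text \<open>Naturality of the counit in \<open>T\<close>, evaluated at \<open>x\<close>; the next
  lemma is instead naturality of the single transformation \<open>\<epsilon> T\<close>.\<close>

lemma counit_natural:
  assumes t: "t \<in> Ar (Fun D A)" and x: "x \<in> Ob D"
  shows "NC t x \<cdot> NC (\<epsilon> (Dom (Fun D A) t)) x = NC (\<epsilon> (Cod (Fun D A) t)) x \<cdot> NC (FM R t) (FO w x)"
  using arg_cong[OF universal_counit_natural[OF \<epsilon> t], of "\<lambda>s. NC s x"] x R_Ar[OF t] by simp

lemma counit_naturality:
  assumes T: "is_functor D A T" and f: "f \<in> Ar D"
  shows "NC (\<epsilon> T) (Cod D f) \<cdot> FM (FO R T) (FM w f) = FM T f \<cdot> NC (\<epsilon> T) (Dom D f)"
  using Fun_naturality[OF counit_Ar(1)[OF T] f] counit_Ar[OF T] f by simp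

text \<open>Both sides agree after each projection \<open>NC (\<epsilon> ?T) x\<close>, by
  naturality of the counit and bilinearity of composition.\<close>

lemma R_additive: "additive_functor (Fun D A) (Fun C A) R"
  unfolding additive_functor_def
proof (intro conjI R ballI)
  fix s t assume s: "s \<in> Ar (Fun D A)" and t: "t \<in> Hom (Fun D A) (Dom (Fun D A) s) (Cod (Fun D A) s)"
  let ?S = "Dom (Fun D A) s" and ?T = "Cod (Fun D A) s"
  have t': "t \<in> Ar (Fun D A)" "Dom (Fun D A) t = ?S" "Cod (Fun D A) t = ?T" using t by auto
  have st: "HAdd (Fun D A) s t \<in> Ar (Fun D A)" by (rule FD.Fun_HAdd_Ar) (use s t' in auto)
  note S = Fun_Ar_simps(1)[OF s] and T = Fun_Ar_simps(2)[OF s]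
  note Rs = R_Ar[OF s] and Rt = R_Ar[OF t'(1)] and Rst = R_Ar[OF st]
  note [simp] = Fun_Ar_simps(3-5)[OF s] Fun_Ar_simps(3-5)[OF t'(1)] t'(2,3) Rs(2,3) Rt(2,3) Rst(2,3)
    Fun_Ar_simps(3-5)[OF Rs(1)] Fun_Ar_simps(3-5)[OF Rt(1)] Fun_Ar_simps(3-5)[OF Rst(1)]
    Fun_Ar_simps(3-5)[OF counit_Ar(1)[OF S]] Fun_Ar_simps(3-5)[OF counit_Ar(1)[OF T]]
    counit_Ar(2,3)[OF S] counit_Ar(2,3)[OF T]
  show "FM R (HAdd (Fun D A) s t) = HAdd (Fun C A) (FM R s) (FM R t)"
  proof (rule Fun_eqI[OF Rst(1) FC.Fun_HAdd_Ar])
    fix c assume c: "c \<in> Ob C"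
    note [simp] = c
    show "NC (FM R (HAdd (Fun D A) s t)) c = NC (HAdd (Fun C A) (FM R s) (FM R t)) c"
    proof (rule A.product_ext[OF right_adjoint_product[OF R \<epsilon> T c], of _ "FO (FO R ?S) c"])
      fix x assume "x \<in> fib c"
      then have x[simp]: "x \<in> Ob D" "FO w x = c" by auto
      have "NC (\<epsilon> ?T) x \<cdot> NC (FM R (HAdd (Fun D A) s t)) c = HAdd A (NC s x) (NC t x) \<cdot> NC (\<epsilon> ?S) x"
        using counit_natural[OF st x(1)] by simp
      also have "\<dots> = HAdd A (NC (\<epsilon> ?T) x \<cdot> NC (FM R s) c) (NC (\<epsilon> ?T) x \<cdot> NC (FM R t) c)"
        using counit_natural[OF s x(1)] counit_natural[OF t'(1) x(1)] by (subst A.HAdd_comp) auto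
      also have "\<dots> = NC (\<epsilon> ?T) x \<cdot> NC (HAdd (Fun C A) (FM R s) (FM R t)) c"
        by (simp add: A.comp_HAdd)
      finally show "NC (\<epsilon> ?T) x \<cdot> NC (FM R (HAdd (Fun D A) s t)) c = NC (\<epsilon> ?T) x \<cdot> NC (HAdd (Fun C A) (FM R s) (FM R t)) c" .
    qed auto
  qed (use Rs Rt in auto)
qed

text \<open>Over the fibre of \<open>c\<close> the sequence is a family of short exact sequences in
  \<open>A\<close>. The counit components are the projections of the three products, so exactness of
  products applies.\<close>

lemma R_exact:
  assumes fg: "short_exact (Fun D A) f g"
  shows "short_exact (Fun C A) (FM R f) (FM R g)"
proof -
  have f: "f \<in> Ar (Fun D A)" and g: "g \<in> Ar (Fun D A)" and cd: "Cod (Fun D A) f = Dom (Fun D A) g"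
    using fg unfolding short_exact_def monic_def epic_def exact_at_def by auto
  note Rf = R_Ar[OF f] and Rg = R_Ar[OF g]
  note S = Fun_Ar_simps(1)[OF f] and T = Fun_Ar_simps(1)[OF g] and V = Fun_Ar_simps(2)[OF g]
  show ?thesis
  proof (rule FC.Fun_short_exactI[OF Rf(1) Rg(1)])
    show "Cod (Fun C A) (FM R f) = Dom (Fun C A) (FM R g)" using Rf Rg cd by simp
    fix c assume c: "c \<in> Ob C"
    show "short_exact A (NC (FM R f) c) (NC (FM R g) c)"
    proof (rule exact_products_small[OF A.category_axioms exact small_fib,
        where P = "FO (FO R (Dom (Fun D A) f)) c" and \<pi> = "NC (\<epsilon> (Dom (Fun D A) f))"])
      show "is_product A (fib c) (FO (Dom (Fun D A) f)) (FO (FO R (Dom (Fun D A) f)) c) (NC (\<epsilon> (Dom (Fun D A) f)))"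
        by (rule right_adjoint_product[OF R \<epsilon> S c])
      show "is_product A (fib c) (FO (Dom (Fun D A) g)) (FO (FO R (Dom (Fun D A) g)) c) (NC (\<epsilon> (Dom (Fun D A) g)))"
        by (rule right_adjoint_product[OF R \<epsilon> T c])
      show "is_product A (fib c) (FO (Cod (Fun D A) g)) (FO (FO R (Cod (Fun D A) g)) c) (NC (\<epsilon> (Cod (Fun D A) g)))"
        by (rule right_adjoint_product[OF R \<epsilon> V c])
      show "NC f x \<in> Hom A (FO (Dom (Fun D A) f) x) (FO (Dom (Fun D A) g) x)"
        "NC g x \<in> Hom A (FO (Dom (Fun D A) g) x) (FO (Cod (Fun D A) g) x)"
        "short_exact A (NC f x) (NC g x)" if "x \<in> fib c" for x
        using Fun_Ar_simps[OF f] Fun_Ar_simps[OF g] cd FD.Fun_short_exactD[OF fg, of x] that by auto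
      show "NC (FM R f) c \<in> Hom A (FO (FO R (Dom (Fun D A) f)) c) (FO (FO R (Dom (Fun D A) g)) c)"
        "NC (FM R g) c \<in> Hom A (FO (FO R (Dom (Fun D A) g)) c) (FO (FO R (Cod (Fun D A) g)) c)"
        using Fun_Ar_simps[OF Rf(1)] Fun_Ar_simps[OF Rg(1)] Rf Rg cd c by auto
      show "NC (\<epsilon> (Dom (Fun D A) g)) x \<cdot> NC (FM R f) c = NC f x \<cdot> NC (\<epsilon> (Dom (Fun D A) f)) x"
        "NC (\<epsilon> (Cod (Fun D A) g)) x \<cdot> NC (FM R g) c = NC g x \<cdot> NC (\<epsilon> (Dom (Fun D A) g)) x" if "x \<in> fib c" for x
        using counit_natural[OF f, of x] counit_natural[OF g, of x] that cd by auto
    qed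
  qed
qed

lemma exact_functor_R:
  assumes z: "is_zero_object A z"
  shows "exact_functor (Fun D A) (Fun C A) R (mk_functor C (\<lambda>_. z) (\<lambda>_. Id A z))"
proof -
  have "is_functor C A (mk_functor C (\<lambda>_. z) (\<lambda>_. Id A z))"
    by (rule C.mk_functorI) (use A.zero_object_Ob[OF z] in auto)
  then have "is_zero_object (Fun C A) (mk_functor C (\<lambda>_. z) (\<lambda>_. Id A z))"
    by (rule FC.Fun_zero_object) (use z in auto)
  then show ?thesis
    by (intro exact_functor.intro exact_functor_axioms.intro FD.Fun_preadditive FC.Fun_preadditive R_additive R_exact)
qed

end

end

section \<open>The simplex category\<close>

lemma ord_cat_simps [simp]:
  "Ob (ord_cat n) = {..n}" "Dom (ord_cat n) = fst" "Cod (ord_cat n) = snd" "Id (ord_cat n) i = (i, i)"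
  "(i, j) \<in> Ar (ord_cat n) \<longleftrightarrow> i \<le> j \<and> j \<le> n" "g \<cdot>\<^bsub>ord_cat n\<^esub> f = (fst f, snd g)"
  by (simp_all add: ord_cat_def)

lemma ord_category: "category (ord_cat n)"
  by unfold_locales (auto simp: ord_cat_def)

lemma mono_mapsD:
  assumes "\<sigma> \<in> mono_maps n m"
  shows "i \<le> n \<Longrightarrow> \<sigma> i \<le> m" "i \<le> j \<Longrightarrow> j \<le> n \<Longrightarrow> \<sigma> i \<le> \<sigma> j" "\<sigma> \<in> extensional {..n}"
  using assms by (auto simp: mono_maps_def PiE_iff mono_on_def)

lemma mono_mapsI:
  assumes "\<And>i. i \<le> n \<Longrightarrow> \<sigma> i \<le> m" "\<And>i j. i \<le> j \<Longrightarrow> j \<le> n \<Longrightarrow> \<sigma> i \<le> \<sigma> j" "\<sigma> \<in> extensional {..n}"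
  shows "\<sigma> \<in> mono_maps n m"
  using assms by (auto simp: mono_maps_def PiE_iff mono_on_def)

lemma mono_maps_Id: "(\<lambda>i \<in> {..n}. i) \<in> mono_maps n n"
  by (rule mono_mapsI) auto

lemma mono_maps_compose:
  "\<sigma> \<in> mono_maps n m \<Longrightarrow> \<tau> \<in> mono_maps m k \<Longrightarrow> compose {..n} \<tau> \<sigma> \<in> mono_maps n k"
  by (rule mono_mapsI) (auto simp: compose_def mono_mapsD)

lemma skip_mono_maps: "skip n i \<in> mono_maps n (Suc n)"
  by (rule mono_mapsI) (auto simp: skip_def)

lemma ord_functor_is_functor:
  assumes "\<sigma> \<in> mono_maps n m"
  shows "is_functor (ord_cat n) (ord_cat m) (ord_functor n \<sigma>)"
proof -
  interpret category "ord_cat n" by (rule ord_category)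
  have "ord_functor n \<sigma> = mk_functor (ord_cat n) \<sigma> (map_prod \<sigma> \<sigma>)"
    by (simp add: ord_functor_def mk_functor_def)
  moreover have "is_functor (ord_cat n) (ord_cat m) (mk_functor (ord_cat n) \<sigma> (map_prod \<sigma> \<sigma>))"
    by (rule mk_functorI) (use mono_mapsD[OF assms] in \<open>auto simp: ord_cat_def\<close>)
  ultimately show ?thesis by simp
qed

lemma simplices_simps:
  assumes "f \<in> simplices C n"
  shows "i \<le> n \<Longrightarrow> FO f i \<in> Ob C" "i \<le> j \<Longrightarrow> j \<le> n \<Longrightarrow> FM f (i, j) \<in> Ar C"
    "i \<le> j \<Longrightarrow> j \<le> n \<Longrightarrow> Dom C (FM f (i, j)) = FO f i" "i \<le> j \<Longrightarrow> j \<le> n \<Longrightarrow> Cod C (FM f (i, j)) = FO f j"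
  using functor_simps(1)[of "ord_cat n" C f i] functor_simps(2-4)[of "ord_cat n" C f "(i, j)"] assms
  by (auto simp: simplices_def)

text \<open>Vertices are the domains of the images of the identity arrows \<open>(i, i)\<close>, so
  the images of the arrows alone determine a simplex.\<close>

lemma simplices_eqI:
  assumes f: "f \<in> simplices C n" and g: "g \<in> simplices C n"
    and eq: "\<And>i j. i \<le> j \<Longrightarrow> j \<le> n \<Longrightarrow> FM f (i, j) = FM g (i, j)"
  shows "f = g"
proof (rule functor_eqI[of "ord_cat n" C])
  show "FO f i = FO g i" if "i \<in> Ob (ord_cat n)" for i
    using that eq[of i i] simplices_simps(3)[OF f, of i i] simplices_simps(3)[OF g, of i i] by simp
  show "FM f p = FM g p" if "p \<in> Ar (ord_cat n)" for p
    using that eq by (cases p) auto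
qed (use f g in \<open>auto simp: simplices_def\<close>)

lemma fcomp_simplices:
  assumes "f \<in> simplices C n" "is_functor C D u"
  shows "fcomp (ord_cat n) u f \<in> simplices D n"
  using category.fcomp_functor[OF ord_category] assms by (auto simp: simplices_def)

lemma pull_simplices:
  assumes "\<sigma> \<in> mono_maps n m" "g \<in> simplices C m"
  shows "pull_simplex n \<sigma> g \<in> simplices C n"
  using category.fcomp_functor[OF ord_category ord_functor_is_functor[OF assms(1)]] assms(2)
  by (auto simp: simplices_def pull_simplex_def)

lemma pull_simplex_FM [simp]: "i \<le> j \<Longrightarrow> j \<le> n \<Longrightarrow> FM (pull_simplex n \<sigma> g) (i, j) = FM g (\<sigma> i, \<sigma> j)"
  by (simp add: pull_simplex_def ord_functor_def)

lemma pull_simplex_Id: "f \<in> simplices C n \<Longrightarrow> pull_simplex n (\<lambda>i \<in> {..n}. i) f = f"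
  by (rule simplices_eqI[of _ C n]) (auto intro: pull_simplices[OF mono_maps_Id])

lemma pull_simplex_compose:
  assumes "\<sigma> \<in> mono_maps n m" "\<tau> \<in> mono_maps m k" "g \<in> simplices C k"
  shows "pull_simplex n (compose {..n} \<tau> \<sigma>) g = pull_simplex n \<sigma> (pull_simplex m \<tau> g)"
  by (rule simplices_eqI[of _ C n, OF pull_simplices[OF mono_maps_compose[OF assms(1,2)] assms(3)]
        pull_simplices[OF assms(1) pull_simplices[OF assms(2,3)]]])
    (use mono_mapsD[OF assms(1)] in \<open>auto simp: compose_def\<close>)

lemma pull_simplex_fcomp:
  assumes "\<sigma> \<in> mono_maps n m" "g \<in> simplices C m" "is_functor C D u"
  shows "fcomp (ord_cat n) u (pull_simplex n \<sigma> g) = pull_simplex n \<sigma> (fcomp (ord_cat m) u g)"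
  by (rule simplices_eqI[of _ D n])
    (use assms mono_mapsD[OF assms(1)] in \<open>auto intro!: pull_simplices fcomp_simplices\<close>)

lemma simplex_cat_simps [simp]:
  "(n, f) \<in> Ob (simplex_cat C) \<longleftrightarrow> f \<in> simplices C n"
  "((n, f), \<sigma>, (m, g)) \<in> Ar (simplex_cat C) \<longleftrightarrow>
    f \<in> simplices C n \<and> g \<in> simplices C m \<and> \<sigma> \<in> mono_maps n m \<and> f = pull_simplex n \<sigma> g"
  "Dom (simplex_cat C) (x, \<sigma>, y) = x" "Cod (simplex_cat C) (x, \<sigma>, y) = y"
  "Id (simplex_cat C) x = (x, (\<lambda>i \<in> {..fst x}. i), x)"
  "(y, \<tau>, z) \<cdot>\<^bsub>simplex_cat C\<^esub> (x, \<sigma>, y') = (x, compose {..fst x} \<tau> \<sigma>, z)"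
  by (auto simp: simplex_cat_def)

lemma simplex_cat_category: "category (simplex_cat C)"
proof (unfold_locales, goal_cases)
  case (1 f) then show ?case by (cases f) auto
next
  case (2 f) then show ?case by (cases f) auto
next
  case (3 a) then show ?case by (cases a) (auto simp: mono_maps_Id pull_simplex_Id)
next
  case (4 f a b g c)
  then show ?case
    by (cases f; cases g; cases a; cases b; cases c) (auto simp: mono_maps_compose pull_simplex_compose)
next
  case (5 f a b g c h d)
  have "compose {..n} \<upsilon> (compose {..n} \<tau> \<sigma>) = compose {..n} (compose {..m} \<upsilon> \<tau>) \<sigma>" if "\<sigma> \<in> mono_maps n m" for n m \<sigma> \<tau> \<upsilon>
    using mono_mapsD[OF that] by (auto simp: compose_def)
  then show ?case using 5
    by (cases f; cases g; cases h; cases a; cases b; cases c; cases d) auto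
next
  case (6 f a b)
  have "compose {..n} (\<lambda>i \<in> {..m}. i) \<sigma> = \<sigma>" if "\<sigma> \<in> mono_maps n m" for n m \<sigma>
    using mono_mapsD[OF that] by (auto simp: compose_def fun_eq_iff extensional_def)
  then show ?case using 6 by (cases f; cases a; cases b) auto
next
  case (7 f a b)
  have "compose {..n} \<sigma> (\<lambda>i \<in> {..n}. i) = \<sigma>" if "\<sigma> \<in> mono_maps n m" for n m \<sigma>
    using mono_mapsD[OF that] by (auto simp: compose_def fun_eq_iff extensional_def)
  then show ?case using 7 by (cases f; cases a; cases b) auto
qed

lemma simplex_functor_FO [simp]:
  "f \<in> simplices E n \<Longrightarrow> FO (simplex_functor E u) (n, f) = (n, fcomp (ord_cat n) u f)"
  by (simp add: simplex_functor_def Let_def)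

lemma simplex_functor_FM [simp]:
  "((n, f), \<sigma>, (m, g)) \<in> Ar (simplex_cat E) \<Longrightarrow>
    FM (simplex_functor E u) ((n, f), \<sigma>, (m, g)) = ((n, fcomp (ord_cat n) u f), \<sigma>, (m, fcomp (ord_cat m) u g))"
  unfolding simplex_functor_def Let_def by (auto simp del: simplex_cat_simps(2))

lemma simplex_functor_is_functor:
  assumes u: "is_functor E B u"
  shows "is_functor (simplex_cat E) (simplex_cat B) (simplex_functor E u)"
  unfolding is_functor_def
proof (intro conjI ballI impI)
  show "FO (simplex_functor E u) \<in> Ob (simplex_cat E) \<rightarrow>\<^sub>E Ob (simplex_cat B)"
    by (auto simp: PiE_iff fcomp_simplices[OF _ u]) (simp add: simplex_functor_def Let_def)
  show "FM (simplex_functor E u) \<in> Ar (simplex_cat E) \<rightarrow>\<^sub>E Ar (simplex_cat B)"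
  proof (rule PiE_I)
    fix a assume "a \<in> Ar (simplex_cat E)"
    then show "FM (simplex_functor E u) a \<in> Ar (simplex_cat B)"
      by (cases a) (auto simp: fcomp_simplices[OF _ u] pull_simplex_fcomp[OF _ _ u])
  qed (simp add: simplex_functor_def Let_def)
next
  fix a assume "a \<in> Ob (simplex_cat E)"
  then show "FM (simplex_functor E u) (Id (simplex_cat E) a) = Id (simplex_cat B) (FO (simplex_functor E u) a)"
    by (cases a) (auto simp: mono_maps_Id pull_simplex_Id)
next
  fix f assume "f \<in> Ar (simplex_cat E)"
  then show "Dom (simplex_cat B) (FM (simplex_functor E u) f) = FO (simplex_functor E u) (Dom (simplex_cat E) f)"
    "Cod (simplex_cat B) (FM (simplex_functor E u) f) = FO (simplex_functor E u) (Cod (simplex_cat E) f)"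
    by (cases f; auto)+
next
  fix f g assume "f \<in> Ar (simplex_cat E)" "g \<in> Ar (simplex_cat E)" "Cod (simplex_cat E) f = Dom (simplex_cat E) g"
  then show "FM (simplex_functor E u) (g \<cdot>\<^bsub>simplex_cat E\<^esub> f) =
      FM (simplex_functor E u) g \<cdot>\<^bsub>simplex_cat B\<^esub> FM (simplex_functor E u) f"
    by (cases f; cases g) (auto simp: mono_maps_compose pull_simplex_compose)
qed

text \<open>An arrow of the simplex category is fixed by its codomain and its order map, since its
  domain is the pullback. A lift ending in \<open>g\<close> must therefore keep
  \<open>\<sigma>\<close> and start at the pullback of \<open>g\<close>; that it lies over
  \<open>a\<close> is \<open>pull_simplex_fcomp\<close>.\<close>

lemma simplex_functor_fibration:
  assumes u: "is_functor E B u"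
  shows "discrete_fibration (simplex_cat E) (simplex_cat B) (simplex_functor E u)"
proof (intro discrete_fibration.intro discrete_fibration_axioms.intro simplex_cat_category
    simplex_functor_is_functor[OF u])
  fix y a
  assume y: "y \<in> Ob (simplex_cat E)" and a: "a \<in> Ar (simplex_cat B)"
    and ya: "Cod (simplex_cat B) a = FO (simplex_functor E u) y"
  obtain m g where yg: "y = (m, g)" by (cases y)
  with y have g: "g \<in> simplices E m" by simp
  obtain n f \<sigma> where a': "a = ((n, f), \<sigma>, (m, fcomp (ord_cat m) u g))"
    using ya g yg by (cases a) auto
  with a have \<sigma>: "\<sigma> \<in> mono_maps n m" and f: "f = pull_simplex n \<sigma> (fcomp (ord_cat m) u g)" by auto
  show "\<exists>!b. b \<in> Ar (simplex_cat E) \<and> Cod (simplex_cat E) b = y \<and> FM (simplex_functor E u) b = a"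
  proof (rule ex1I[of _ "((n, pull_simplex n \<sigma> g), \<sigma>, (m, g))"])
    show "((n, pull_simplex n \<sigma> g), \<sigma>, m, g) \<in> Ar (simplex_cat E) \<and>
      Cod (simplex_cat E) ((n, pull_simplex n \<sigma> g), \<sigma>, m, g) = y \<and>
      FM (simplex_functor E u) ((n, pull_simplex n \<sigma> g), \<sigma>, m, g) = a"
      using g \<sigma> yg a' f by (simp add: pull_simplices pull_simplex_fcomp[OF \<sigma> g u])
    fix b assume b: "b \<in> Ar (simplex_cat E) \<and> Cod (simplex_cat E) b = y \<and> FM (simplex_functor E u) b = a"
    then obtain n' f' \<sigma>' where b': "b = ((n', f'), \<sigma>', (m, g))" using yg by (cases b) auto
    with b have ar: "((n', f'), \<sigma>', (m, g)) \<in> Ar (simplex_cat E)" by blast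
    show "b = ((n, pull_simplex n \<sigma> g), \<sigma>, (m, g))"
      using b ar unfolding b' a' by (simp only: simplex_functor_FM[OF ar]) auto
  qed
qed

text \<open>The square of an infinite set injects into the set; iterating such an injection encodes
  lists of a fixed length.\<close>

lemma small_lists:
  assumes "infinite (UNIV :: 'u set)"
  shows "small TYPE('u) {xs :: 'u list. length xs = k}"
proof (induction k)
  case 0
  show ?case unfolding small_def by (intro exI[of _ "\<lambda>_. undefined"]) (auto simp: inj_on_def)
next
  case (Suc k)
  have "(card_of (UNIV \<times> UNIV :: ('u \<times> 'u) set), card_of (UNIV :: 'u set)) \<in> ordLeq"
    using card_of_Times_same_infinite[OF assms] ordIso_iff_ordLeq by blast
  then obtain p :: "'u \<times> 'u \<Rightarrow> 'u" where p: "inj p" unfolding card_of_ordLeq[symmetric] by auto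
  obtain e :: "'u list \<Rightarrow> 'u" where e: "inj_on e {xs. length xs = k}" using Suc unfolding small_def by auto
  have "inj_on (\<lambda>xs. p (hd xs, e (tl xs))) {xs. length xs = Suc k}"
  proof (rule inj_onI)
    fix xs ys :: "'u list"
    assume "xs \<in> {xs. length xs = Suc k}" "ys \<in> {xs. length xs = Suc k}" "p (hd xs, e (tl xs)) = p (hd ys, e (tl ys))"
    then show "xs = ys" using inj_onD[OF e, of "tl xs" "tl ys"] injD[OF p]
      by (cases xs; cases ys) auto
  qed
  then show ?case unfolding small_def by blast
qed

lemma small_inj: "small TYPE('u) J \<Longrightarrow> inj_on h I \<Longrightarrow> h ` I \<subseteq> J \<Longrightarrow> small TYPE('u) I"
  unfolding small_def by (meson comp_inj_on inj_on_subset)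

text \<open>\<open>[n]\<close> has finitely many arrows, and a simplex is determined by the list of
  their images, a list of fixed length over the universe.\<close>

lemma small_simplices:
  fixes C :: "('u, 'u) cat"
  assumes "infinite (UNIV :: 'u set)"
  shows "small TYPE('u) (simplices C n)"
proof -
  have "Ar (ord_cat n) \<subseteq> {..n} \<times> {..n}" by (auto simp: ord_cat_def)
  then have "finite (Ar (ord_cat n))" by (rule finite_subset) simp
  then obtain L where L: "set L = Ar (ord_cat n)" using finite_list by blast
  have "inj_on (\<lambda>f. map (FM f) L) (simplices C n)"
  proof (rule inj_onI)
    fix f g assume fg: "f \<in> simplices C n" "g \<in> simplices C n" and eq: "map (FM f) L = map (FM g) L"
    have "FM f p = FM g p" if "p \<in> set L" for p using eq that by simp
    then show "f = g" by (intro simplices_eqI[OF fg]) (simp add: L)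
  qed
  then show ?thesis by (rule small_inj[OF small_lists[OF assms, of "length L"]]) auto
qed

section \<open>Cohomology objects\<close>

context abelian_category
begin

definition complex_at :: "'m \<Rightarrow> 'm \<Rightarrow> bool" where
  "complex_at f g \<longleftrightarrow> f \<in> Ar A \<and> g \<in> Ar A \<and> Cod A f = Dom A g \<and> g \<cdot> f = HZero A (Dom A f) (Cod A g)"

text \<open>\<open>coh_map\<close> depends on the middle component only, so the outer components of
  the morphism are merely required to exist.\<close>

definition complex_mor :: "'m \<Rightarrow> 'm \<Rightarrow> 'm \<Rightarrow> 'm \<Rightarrow> 'm \<Rightarrow> bool" where
  "complex_mor f g f' g' b \<longleftrightarrow> b \<in> Hom A (Cod A f) (Cod A f') \<and>
    (\<exists>a \<in> Hom A (Dom A f) (Dom A f'). b \<cdot> f = f' \<cdot> a) \<and>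
    (\<exists>c \<in> Hom A (Cod A g) (Cod A g'). c \<cdot> g = g' \<cdot> b)"

lemma coh_ker: "g \<in> Ar A \<Longrightarrow> is_kernel A (coh_ker A g) g"
  unfolding coh_ker_def using someI_ex[OF has_kernels] .

lemma coh_lift:
  assumes "complex_at f g"
  shows "coh_lift A f g \<in> Ar A" "Dom A (coh_lift A f g) = Dom A f"
    "Cod A (coh_lift A f g) = Dom A (coh_ker A g)" "coh_ker A g \<cdot> coh_lift A f g = f"
proof -
  have fg: "f \<in> Ar A" "g \<in> Ar A" "Cod A f = Dom A g" "g \<cdot> f = HZero A (Dom A f) (Cod A g)"
    using assms unfolding complex_at_def by auto
  have k: "is_kernel A (coh_ker A g) g" by (rule coh_ker[OF fg(2)])
  have "\<exists>!l. l \<in> Hom A (Dom A f) (Dom A (coh_ker A g)) \<and> coh_ker A g \<cdot> l = f"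
  proof -
    obtain l where l: "l \<in> Ar A" "Dom A l = Dom A f" "Cod A l = Dom A (coh_ker A g)" "coh_ker A g \<cdot> l = f"
      using kernel_lift[OF k fg(1,3,4)] by blast
    show ?thesis
    proof (rule ex1I[of _ l])
      fix l' assume "l' \<in> Hom A (Dom A f) (Dom A (coh_ker A g)) \<and> coh_ker A g \<cdot> l' = f"
      then show "l' = l" using monicD[OF kernel_monic[OF k], of l' l] l by simp
    qed (use l in simp)
  qed
  from theI'[OF this] show "coh_lift A f g \<in> Ar A" "Dom A (coh_lift A f g) = Dom A f"
    "Cod A (coh_lift A f g) = Dom A (coh_ker A g)" "coh_ker A g \<cdot> coh_lift A f g = f"
    unfolding coh_lift_def[symmetric] by auto
qed

lemma coh_quot: "complex_at f g \<Longrightarrow> is_cokernel A (coh_quot A f g) (coh_lift A f g)"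
  unfolding coh_quot_def using someI_ex[OF has_cokernels[OF coh_lift(1)]] .

lemma coh_simps:
  assumes "complex_at f g"
  shows "coh_ob A f g \<in> Ob A" "coh_ker A g \<in> Ar A" "Cod A (coh_ker A g) = Cod A f"
    "coh_quot A f g \<in> Ar A" "Dom A (coh_quot A f g) = Dom A (coh_ker A g)" "Cod A (coh_quot A f g) = coh_ob A f g"
  using cokernelD[OF coh_quot[OF assms]] kernelD[OF coh_ker[of g]] coh_lift[OF assms] assms
  unfolding coh_ob_def complex_at_def by auto

text \<open>Both definite descriptions in \<open>coh_map\<close> have at most one solution, the
  first because the kernel is monic, the second because the quotient is epic. Exhibiting solutions
  is thus enough.\<close>

lemma coh_map_eqI:
  assumes c: "complex_at f g" "complex_at f' g'"
    and z: "z \<in> Hom A (Dom A (coh_ker A g)) (Dom A (coh_ker A g'))" "coh_ker A g' \<cdot> z = b \<cdot> coh_ker A g"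
    and h: "h \<in> Hom A (coh_ob A f g) (coh_ob A f' g')" "h \<cdot> coh_quot A f g = coh_quot A f' g' \<cdot> z"
  shows "coh_map A f g f' g' b = h"
proof -
  have g': "g' \<in> Ar A" using c unfolding complex_at_def by auto
  have z': "(THE z. z \<in> Hom A (Dom A (coh_ker A g)) (Dom A (coh_ker A g')) \<and> coh_ker A g' \<cdot> z = b \<cdot> coh_ker A g) = z"
  proof (rule the_equality)
    fix y assume y: "y \<in> Hom A (Dom A (coh_ker A g)) (Dom A (coh_ker A g')) \<and> coh_ker A g' \<cdot> y = b \<cdot> coh_ker A g"
    show "y = z" by (rule monicD[OF kernel_monic[OF coh_ker[OF g']]]) (use y z in auto)
  qed (use z in blast)
  show ?thesis unfolding coh_map_def z' Let_def
  proof (rule the_equality)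
    fix k assume k: "k \<in> Hom A (coh_ob A f g) (coh_ob A f' g') \<and> k \<cdot> coh_quot A f g = coh_quot A f' g' \<cdot> z"
    show "k = h" by (rule epicD[OF cokernel_epic[OF coh_quot[OF c(1)]]]) (use k h coh_simps[OF c(1)] in auto)
  qed (use h in blast)
qed

text \<open>The square on the right makes \<open>b\<close> map kernel to kernel, and the square on
  the left lets this map \<open>z\<close> pass to the quotients.\<close>

lemma coh_map:
  assumes c: "complex_at f g" "complex_at f' g'" and b: "complex_mor f g f' g' b"
  obtains z where "z \<in> Hom A (Dom A (coh_ker A g)) (Dom A (coh_ker A g'))" "coh_ker A g' \<cdot> z = b \<cdot> coh_ker A g"
    "coh_map A f g f' g' b \<in> Hom A (coh_ob A f g) (coh_ob A f' g')"
    "coh_map A f g f' g' b \<cdot> coh_quot A f g = coh_quot A f' g' \<cdot> z"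
proof -
  have fg[simp]: "f \<in> Ar A" "g \<in> Ar A" "Cod A f = Dom A g" "f' \<in> Ar A" "g' \<in> Ar A" "Cod A f' = Dom A g'"
    using c unfolding complex_at_def by auto
  note [simp] = coh_simps[OF c(1)] coh_simps[OF c(2)] coh_lift(1-3)[OF c(1)] coh_lift(1-3)[OF c(2)]
  obtain a d where b'[simp]: "b \<in> Ar A" "Dom A b = Dom A g" "Cod A b = Dom A g'"
    and a: "a \<in> Ar A" "Dom A a = Dom A f" "Cod A a = Dom A f'" "b \<cdot> f = f' \<cdot> a"
    and d: "d \<in> Ar A" "Dom A d = Cod A g" "Cod A d = Cod A g'" "d \<cdot> g = g' \<cdot> b"
    using b unfolding complex_mor_def by auto
  note k = coh_ker[OF fg(2)] and k' = coh_ker[OF fg(5)]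
  have "g' \<cdot> (b \<cdot> coh_ker A g) = (d \<cdot> g) \<cdot> coh_ker A g"
    by (rule assoc_eq[OF d(4)[symmetric]]) auto
  also have "\<dots> = HZero A (Dom A (coh_ker A g)) (Cod A g')" using d(1-3) kernelD(4)[OF k] by simp
  finally have "g' \<cdot> (b \<cdot> coh_ker A g) = HZero A (Dom A (b \<cdot> coh_ker A g)) (Cod A g')" by simp
  then obtain z where z: "z \<in> Ar A" "Dom A z = Dom A (coh_ker A g)" "Cod A z = Dom A (coh_ker A g')"
    "coh_ker A g' \<cdot> z = b \<cdot> coh_ker A g"
    using kernel_lift[OF k', of "b \<cdot> coh_ker A g"] by auto
  \<comment> \<open>Compatibility of \<open>z\<close> with the lifts of \<open>f\<close> and
    \<open>f'\<close> is tested after the monic kernel of \<open>g'\<close>.\<close>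
  have zl: "z \<cdot> coh_lift A f g = coh_lift A f' g' \<cdot> a"
  proof (rule monicD[OF kernel_monic[OF k']])
    have "coh_ker A g' \<cdot> (z \<cdot> coh_lift A f g) = (b \<cdot> coh_ker A g) \<cdot> coh_lift A f g"
      by (rule assoc_eq[OF z(4)]) (use z in auto)
    also have "\<dots> = b \<cdot> f" using coh_lift(4)[OF c(1)] by simp
    also have "\<dots> = coh_ker A g' \<cdot> (coh_lift A f' g' \<cdot> a)"
      using assoc_eq[OF coh_lift(4)[OF c(2)], of a] a by simp
    finally show "coh_ker A g' \<cdot> (z \<cdot> coh_lift A f g) = coh_ker A g' \<cdot> (coh_lift A f' g' \<cdot> a)" .
  qed (use z a in auto)
  have "(coh_quot A f' g' \<cdot> z) \<cdot> coh_lift A f g = (coh_quot A f' g' \<cdot> coh_lift A f' g') \<cdot> a"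
    using z zl a by simp
  also have "\<dots> = HZero A (Dom A f) (coh_ob A f' g')"
    using cokernelD(4)[OF coh_quot[OF c(2)]] a by simp
  finally obtain h where h: "h \<in> Ar A" "Cod A h = coh_ob A f' g'" "Dom A h = coh_ob A f g" "h \<cdot> coh_quot A f g = coh_quot A f' g' \<cdot> z"
    using cokernel_lift[OF coh_quot[OF c(1)], of "coh_quot A f' g' \<cdot> z"] z by auto
  have "coh_map A f g f' g' b = h" by (rule coh_map_eqI[OF c]) (use z h in auto)
  then show ?thesis using that[of z] z h by simp
qed

lemma coh_map_Id:
  assumes c: "complex_at f g"
  shows "coh_map A f g f g (Id A (Cod A f)) = Id A (coh_ob A f g)"
  by (rule coh_map_eqI[OF c c, of "Id A (Dom A (coh_ker A g))"]) (use coh_simps[OF c] in auto)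

lemma coh_map_comp:
  assumes c: "complex_at f g" "complex_at f' g'" "complex_at f'' g''"
    and b: "complex_mor f g f' g' b" and b': "complex_mor f' g' f'' g'' b'"
  shows "coh_map A f' g' f'' g'' b' \<cdot> coh_map A f g f' g' b = coh_map A f g f'' g'' (b' \<cdot> b)"
proof -
  let ?h = "coh_map A f g f' g' b" and ?h' = "coh_map A f' g' f'' g'' b'"
  obtain z where z: "z \<in> Hom A (Dom A (coh_ker A g)) (Dom A (coh_ker A g'))" "coh_ker A g' \<cdot> z = b \<cdot> coh_ker A g"
    "?h \<in> Hom A (coh_ob A f g) (coh_ob A f' g')"
    "?h \<cdot> coh_quot A f g = coh_quot A f' g' \<cdot> z" using coh_map[OF c(1,2) b] by blast
  obtain z' where z': "z' \<in> Hom A (Dom A (coh_ker A g')) (Dom A (coh_ker A g''))" "coh_ker A g'' \<cdot> z' = b' \<cdot> coh_ker A g'"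
    "?h' \<in> Hom A (coh_ob A f' g') (coh_ob A f'' g'')"
    "?h' \<cdot> coh_quot A f' g' = coh_quot A f'' g'' \<cdot> z'" using coh_map[OF c(2,3) b'] by blast
  have bb[simp]: "b \<in> Ar A" "Dom A b = Cod A f" "Cod A b = Cod A f'" "b' \<in> Ar A" "Dom A b' = Cod A f'" "Cod A b' = Cod A f''"
    using b b' unfolding complex_mor_def by auto
  note [simp] = coh_simps[OF c(1)] coh_simps[OF c(2)] coh_simps[OF c(3)] z(1,3)[simplified] z'(1,3)[simplified]
  have "coh_ker A g'' \<cdot> (z' \<cdot> z) = (b' \<cdot> coh_ker A g') \<cdot> z" by (rule assoc_eq[OF z'(2)]) auto
  also have "\<dots> = (b' \<cdot> b) \<cdot> coh_ker A g" using z(2) by simp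
  finally have 1: "coh_ker A g'' \<cdot> (z' \<cdot> z) = (b' \<cdot> b) \<cdot> coh_ker A g" .
  have "(?h' \<cdot> ?h) \<cdot> coh_quot A f g = ?h' \<cdot> (coh_quot A f' g' \<cdot> z)" using z(4) by simp
  also have "\<dots> = (coh_quot A f'' g'' \<cdot> z') \<cdot> z" by (rule assoc_eq[OF z'(4)]) auto
  also have "\<dots> = coh_quot A f'' g'' \<cdot> (z' \<cdot> z)" by simp
  finally have 2: "(?h' \<cdot> ?h) \<cdot> coh_quot A f g = coh_quot A f'' g'' \<cdot> (z' \<cdot> z)" .
  show ?thesis by (rule coh_map_eqI[OF c(1,3) _ 1 _ 2, symmetric]) auto
qed

lemma coh_map_simps:
  assumes "complex_at f g" "complex_at f' g'" "complex_mor f g f' g' b"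
  shows "coh_map A f g f' g' b \<in> Ar A" "Dom A (coh_map A f g f' g' b) = coh_ob A f g"
    "Cod A (coh_map A f g f' g' b) = coh_ob A f' g'"
  using coh_map[OF assms] by auto

lemma coh_map_iso:
  assumes c: "complex_at f g" "complex_at f' g'"
    and b: "complex_mor f g f' g' b" and b': "complex_mor f' g' f g b'"
    and inv: "b' \<cdot> b = Id A (Cod A f)" "b \<cdot> b' = Id A (Cod A f')"
  shows "is_iso A (coh_map A f g f' g' b)"
  by (rule is_isoI[of _ "coh_ob A f g" "coh_ob A f' g'" "coh_map A f' g' f g b'"])
    (use coh_map_simps[OF c b] coh_map_simps[OF c(2,1) b'] coh_map_comp[OF c c(1) b b'] coh_map_comp[OF c(2,1,2) b' b]
       coh_map_Id[OF c(1)] coh_map_Id[OF c(2)] inv in auto)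

text \<open>The kernel is a subobject of a zero object, and a quotient of zero is zero.\<close>

lemma coh_ob_zero:
  assumes c: "complex_at f g" and z: "is_zero_object A (Cod A f)"
  shows "is_zero_object A (coh_ob A f g)"
proof -
  note [simp] = coh_simps[OF c]
  have g: "g \<in> Ar A" using c by (simp add: complex_at_def)
  let ?K = "Dom A (coh_ker A g)"
  have "Id A ?K = HZero A ?K ?K"
    by (rule monicD[OF kernel_monic[OF coh_ker[OF g]]])
      (use Dom_Ob[of "coh_ker A g"] zero_object_HZero(1)[OF z, of "coh_ker A g"] zero_object_Ob[OF z] in auto)
  then have "is_zero_object A ?K" using Dom_Ob[of "coh_ker A g"] by (simp add: zero_object_iff)
  then have q: "coh_quot A f g = HZero A ?K (coh_ob A f g)" using zero_object_HZero(2)[of ?K "coh_quot A f g"] by simp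
  have "Id A (coh_ob A f g) = HZero A (coh_ob A f g) (coh_ob A f g)"
    by (rule epicD[OF cokernel_epic[OF coh_quot[OF c]]])
      (use q Dom_Ob[of "coh_ker A g"] in auto)
  then show ?thesis by (simp add: zero_object_iff)
qed

section \<open>Alternating sums\<close>

text \<open>The formula of \<open>Th_diff\<close> for an arbitrary family, so that facts on signs
  and sums can be proved apart from cochains.\<close>

definition altsum :: "'o \<Rightarrow> 'o \<Rightarrow> nat \<Rightarrow> (nat \<Rightarrow> 'm) \<Rightarrow> 'm" where
  "altsum a b m F = (\<Otimes>\<^bsub>hom_group A a b\<^esub>i \<in> {..m}. if even i then F i else inv\<^bsub>hom_group A a b\<^esub> F i)"

end

lemma (in group_hom) hom_finprod:
  assumes "comm_group G" "comm_group H" "finite I" "\<And>i. i \<in> I \<Longrightarrow> f i \<in> carrier G"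
  shows "h (finprod G f I) = finprod H (\<lambda>i. h (f i)) I"
proof -
  interpret G: comm_group G by fact
  interpret H: comm_group H by fact
  show ?thesis using assms(3,4)
  proof (induction I rule: finite_induct)
    case empty then show ?case by simp
  next
    case (insert i I)
    have "h (finprod G f (insert i I)) = h (f i \<otimes>\<^bsub>G\<^esub> finprod G f I)"
      using insert by (subst G.finprod_insert) auto
    also have "\<dots> = h (f i) \<otimes>\<^bsub>H\<^esub> finprod H (\<lambda>i. h (f i)) I"
      using insert by (subst hom_mult) (auto intro: G.finprod_closed)
    also have "\<dots> = finprod H (\<lambda>i. h (f i)) (insert i I)"
      using insert by (subst H.finprod_insert) auto
    finally show ?case .
  qed
qed

text \<open>The induction step adds one row and one column, which cancel against each other.\<close>

lemma (in comm_group) finprod_cancel: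
  assumes "\<And>i j. i < j \<Longrightarrow> j \<le> Suc m \<Longrightarrow> e j i \<otimes> e i (j - 1) = \<one>"
    and "\<And>i j. j \<le> Suc m \<Longrightarrow> i \<le> m \<Longrightarrow> e j i \<in> carrier G"
  shows "finprod G (\<lambda>j. finprod G (e j) {..m}) {..Suc m} = \<one>"
  using assms
proof (induction m)
  case 0
  then have "e 0 0 \<otimes> e 1 0 = \<one>" using "0.prems"(1)[of 0 1] "0.prems"(2)[of 0 0] "0.prems"(2)[of 1 0] m_comm by simp
  moreover have "{..Suc 0} = {0, 1}" by auto
  ultimately show ?case using 0 m_comm by simp
next
  case (Suc m)
  have car: "\<And>i j. j \<le> Suc (Suc m) \<Longrightarrow> i \<le> Suc m \<Longrightarrow> e j i \<in> carrier G" by (rule Suc.prems(2))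
  have IH: "finprod G (\<lambda>j. finprod G (e j) {..m}) {..Suc m} = \<one>"
    by (rule Suc.IH) (use Suc.prems in auto)
  have row: "finprod G (e j) {..Suc m} = finprod G (e j) {..m} \<otimes> e j (Suc m)" if "j \<le> Suc (Suc m)" for j
  proof -
    have c: "e j \<in> {..m} \<rightarrow> carrier G" "e j (Suc m) \<in> carrier G" using that car by auto
    then have "finprod G (e j) {..Suc m} = e j (Suc m) \<otimes> finprod G (e j) {..m}"
      by (intro finprod_Suc) (auto simp: atMost_Suc)
    then show ?thesis using c by (simp add: m_comm finprod_closed)
  qed
  have "finprod G (\<lambda>j. finprod G (e j) {..Suc m}) {..Suc (Suc m)} =
      finprod G (e (Suc (Suc m))) {..Suc m} \<otimes> finprod G (\<lambda>j. finprod G (e j) {..Suc m}) {..Suc m}"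
    using car by (subst finprod_Suc) (auto intro!: finprod_closed)
  also have "finprod G (\<lambda>j. finprod G (e j) {..Suc m}) {..Suc m}
      = finprod G (\<lambda>j. finprod G (e j) {..m} \<otimes> e j (Suc m)) {..Suc m}"
    using car row by (intro finprod_cong') (auto intro!: finprod_closed)
  also have "\<dots> = finprod G (\<lambda>j. finprod G (e j) {..m}) {..Suc m} \<otimes> finprod G (\<lambda>j. e j (Suc m)) {..Suc m}"
    using car by (intro finprod_multf) (auto intro!: finprod_closed)
  also have "\<dots> = finprod G (\<lambda>j. e j (Suc m)) {..Suc m}"
    unfolding IH using car by (intro l_one finprod_closed) auto
  also have "finprod G (e (Suc (Suc m))) {..Suc m} \<otimes> finprod G (\<lambda>j. e j (Suc m)) {..Suc m}
      = finprod G (\<lambda>i. e (Suc (Suc m)) i \<otimes> e i (Suc m)) {..Suc m}"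
    using car by (intro finprod_multf[symmetric]) auto
  also have "\<dots> = finprod G (\<lambda>i. \<one>) {..Suc m}"
    using Suc.prems(1)[of _ "Suc (Suc m)"] by (intro finprod_cong') auto
  finally show ?case by simp
qed

context abelian_category
begin

lemma altsum_simps:
  assumes "a \<in> Ob A" "b \<in> Ob A" "\<And>i. i \<le> m \<Longrightarrow> F i \<in> Hom A a b"
  shows "altsum a b m F \<in> Ar A" "Dom A (altsum a b m F) = a" "Cod A (altsum a b m F) = b"
proof -
  interpret H: comm_group "hom_group A a b" by (rule hom_comm_group[OF assms(1,2)])
  have "altsum a b m F \<in> carrier (hom_group A a b)" unfolding altsum_def
    by (rule H.finprod_closed) (use assms(3) H.inv_closed in \<open>auto simp del: Hom_iff\<close>)
  then show "altsum a b m F \<in> Ar A" "Dom A (altsum a b m F) = a" "Cod A (altsum a b m F) = b" by auto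
qed

lemma altsum_cong:
  assumes "a \<in> Ob A" "b \<in> Ob A" "\<And>i. i \<le> m \<Longrightarrow> G i \<in> Hom A a b" "\<And>i. i \<le> m \<Longrightarrow> F i = G i"
  shows "altsum a b m F = altsum a b m G"
proof -
  interpret H: comm_group "hom_group A a b" by (rule hom_comm_group[OF assms(1,2)])
  have "\<And>i. i \<le> m \<Longrightarrow> G i \<in> carrier (hom_group A a b)" using assms(3) by simp
  then show ?thesis unfolding altsum_def
    by (intro H.finprod_cong') (use assms(4) H.inv_closed in \<open>auto simp del: hom_group_simps\<close>)
qed

text \<open>A homomorphism of abelian groups commutes with signs and sums; composition with a fixed
  arrow on either side gives the two cases of interest.\<close>

lemma altsum_hom:
  assumes h: "group_hom (hom_group A a b) (hom_group A a' b') h" and ob: "a \<in> Ob A" "b \<in> Ob A" "a' \<in> Ob A" "b' \<in> Ob A"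
    and F: "\<And>i. i \<le> m \<Longrightarrow> F i \<in> Hom A a b"
  shows "h (altsum a b m F) = altsum a' b' m (\<lambda>i. h (F i))"
proof -
  interpret h: group_hom "hom_group A a b" "hom_group A a' b'" h by fact
  interpret H': comm_group "hom_group A a' b'" by (rule hom_comm_group[OF ob(3,4)])
  have F': "\<And>i. i \<le> m \<Longrightarrow> F i \<in> carrier (hom_group A a b)" using F by simp
  show ?thesis unfolding altsum_def
    by (subst h.hom_finprod[OF hom_comm_group hom_comm_group])
      (use ob F' h.hom_inv h.G.inv_closed h.hom_closed in
        \<open>auto intro!: H'.finprod_cong' h.H.inv_closed simp del: hom_group_simps\<close>)
qed

lemma comp_altsum:
  assumes "g \<in> Ar A" "a \<in> Ob A" "Dom A g = b" "\<And>i. i \<le> m \<Longrightarrow> F i \<in> Hom A a b"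
  shows "g \<cdot> altsum a b m F = altsum a (Cod A g) m (\<lambda>i. g \<cdot> F i)"
  by (rule altsum_hom) (use comp_hom[OF assms(1,2)] assms in auto)

lemma altsum_comp:
  assumes "f \<in> Ar A" "c \<in> Ob A" "Cod A f = b" "\<And>i. i \<le> m \<Longrightarrow> F i \<in> Hom A b c"
  shows "altsum b c m F \<cdot> f = altsum (Dom A f) c m (\<lambda>i. F i \<cdot> f)"
  by (rule altsum_hom[where h = "\<lambda>g. g \<cdot> f"]) (use hom_comp[OF assms(1,2)] assms in auto)

text \<open>The assumption \<open>eq\<close> is the cosimplicial identity. For \<open>i < j\<close>
  the terms at \<open>(j, i)\<close> and \<open>(i, j - 1)\<close> are equal arrows with opposite
  signs, as the index sums differ by one.\<close>

lemma altsum_altsum_zero: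
  assumes ob: "a \<in> Ob A" "b \<in> Ob A"
    and D: "\<And>i j. j \<le> Suc m \<Longrightarrow> i \<le> m \<Longrightarrow> D j i \<in> Hom A a b"
    and eq: "\<And>i j. i < j \<Longrightarrow> j \<le> Suc m \<Longrightarrow> D j i = D i (j - 1)"
  shows "altsum a b (Suc m) (\<lambda>j. altsum a b m (D j)) = HZero A a b"
proof -
  let ?H = "hom_group A a b"
  interpret H: comm_group ?H by (rule hom_comm_group[OF ob])
  have inv: "group_hom ?H ?H (\<lambda>x. inv\<^bsub>?H\<^esub> x)"
    by unfold_locales (auto simp: hom_def H.inv_mult simp del: hom_group_simps)
  \<comment> \<open>The terms with their signs: the inner one comes from \<open>i\<close>, the outer
    one from \<open>j\<close>.\<close>
  define e where "e j i = (let x = (if even i then D j i else inv\<^bsub>?H\<^esub> D j i) in if even j then x else inv\<^bsub>?H\<^esub> x)" for j i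
  have D': "\<And>i j. j \<le> Suc m \<Longrightarrow> i \<le> m \<Longrightarrow> D j i \<in> carrier ?H" using D by simp
  have car: "e j i \<in> carrier ?H" if "j \<le> Suc m" "i \<le> m" for j i
    using D'[OF that] unfolding e_def Let_def by (auto simp del: hom_group_simps)
  have "finprod ?H (\<lambda>j. finprod ?H (e j) {..m}) {..Suc m} = \<one>\<^bsub>?H\<^esub>"
  proof (rule H.finprod_cancel[OF _ car])
    fix i j assume ij: "i < j" "j \<le> Suc m"
    then obtain k where k: "j = Suc k" by (cases j) auto
    have "D j i \<in> carrier ?H" "D i (j - 1) = D j i" using D'[of j i] ij eq[of i j] by (auto simp del: hom_group_simps)
    then show "e j i \<otimes>\<^bsub>?H\<^esub> e i (j - 1) = \<one>\<^bsub>?H\<^esub>"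
      unfolding e_def Let_def k using H.l_inv H.r_inv by (auto simp del: hom_group_simps)
  qed
  moreover have "altsum a b (Suc m) (\<lambda>j. altsum a b m (D j)) = finprod ?H (\<lambda>j. finprod ?H (e j) {..m}) {..Suc m}"
    unfolding altsum_def[of a b "Suc m"]
  proof (rule H.finprod_cong')
    fix j assume "j \<in> {..Suc m}"
    then have j: "j \<le> Suc m" by simp
    show "(if even j then altsum a b m (D j) else inv\<^bsub>?H\<^esub> altsum a b m (D j)) = finprod ?H (e j) {..m}"
    proof (cases "even j")
      case True
      then show ?thesis unfolding altsum_def e_def by simp
    next
      case False
      have "inv\<^bsub>?H\<^esub> altsum a b m (D j) = finprod ?H (\<lambda>i. inv\<^bsub>?H\<^esub> (if even i then D j i else inv\<^bsub>?H\<^esub> D j i)) {..m}"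
        unfolding altsum_def
        by (rule group_hom.hom_finprod[OF inv H.comm_group_axioms H.comm_group_axioms])
          (use D'[OF j] in \<open>auto simp del: hom_group_simps\<close>)
      then show ?thesis using False unfolding e_def Let_def by simp
    qed
  qed (use car in \<open>auto intro!: H.finprod_closed simp del: hom_group_simps\<close>)
  ultimately show ?thesis by simp
qed

end

section \<open>Thomason cohomology\<close>

locale thomason = abelian_category A
  for A :: "('o, 'm) pcat" (structure) +
  fixes C :: "('v, 'w) cat" and U :: "'u itself"
  assumes complete: "complete_category TYPE('u) A"
    and small: "small TYPE('u) (simplices C n)"
begin

sublocale S: functor_category "simplex_cat C" A
  by (intro functor_category.intro simplex_cat_category category_axioms)

abbreviation face :: "nat \<Rightarrow> (nat \<Rightarrow> nat) \<Rightarrow> nat \<Rightarrow> (nat, nat \<times> nat, 'v, 'w) functor_data \<Rightarrow> ('v, 'w) simplex_arrow" where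
  "face n \<sigma> m g \<equiv> ((n, pull_simplex n \<sigma> g), \<sigma>, (m, g))"

context
  fixes T assumes T: "is_functor (simplex_cat C) A T"
begin

lemma T_simps [simp]:
  "f \<in> simplices C n \<Longrightarrow> FO T (n, f) \<in> Ob A"
  "\<sigma> \<in> mono_maps n m \<Longrightarrow> g \<in> simplices C m \<Longrightarrow> FM T (face n \<sigma> m g) \<in> Ar A"
  "\<sigma> \<in> mono_maps n m \<Longrightarrow> g \<in> simplices C m \<Longrightarrow> Dom A (FM T (face n \<sigma> m g)) = FO T (n, pull_simplex n \<sigma> g)"
  "\<sigma> \<in> mono_maps n m \<Longrightarrow> g \<in> simplices C m \<Longrightarrow> Cod A (FM T (face n \<sigma> m g)) = FO T (m, g)"
  using functor_simps(1)[OF T, of "(n, f)"] functor_simps(2-4)[OF T, of "face n \<sigma> m g"]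
  by (auto simp: pull_simplices)

lemma Th_product: "is_product A (simplices C n) (\<lambda>f. FO T (n, f)) (Th_ob A C T n) (Th_proj A C T n)"
  unfolding Th_ob_def Th_proj_def
  by (intro prod_cone_is_product complete_has_product[OF category_axioms complete small]) simp

lemma Th_simps [simp]:
  "Th_ob A C T n \<in> Ob A" "f \<in> simplices C n \<Longrightarrow> Th_proj A C T n f \<in> Ar A"
  "f \<in> simplices C n \<Longrightarrow> Dom A (Th_proj A C T n f) = Th_ob A C T n"
  "f \<in> simplices C n \<Longrightarrow> Cod A (Th_proj A C T n f) = FO T (n, f)"
  using product_simps[OF Th_product] by auto

lemma Th_tuple:
  assumes "Q \<in> Ob A" "\<And>f. f \<in> simplices C n \<Longrightarrow> \<rho> f \<in> Hom A Q (FO T (n, f))"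
  shows "Th_tuple A C T n Q \<rho> \<in> Ar A" "Dom A (Th_tuple A C T n Q \<rho>) = Q" "Cod A (Th_tuple A C T n Q \<rho>) = Th_ob A C T n"
    "f \<in> simplices C n \<Longrightarrow> Th_proj A C T n f \<cdot> Th_tuple A C T n Q \<rho> = \<rho> f"
proof -
  have "\<exists>P \<pi>. is_product A (simplices C n) (\<lambda>f. FO T (n, f)) P \<pi>" using Th_product by blast
  from prod_tuple[OF this assms] show "Th_tuple A C T n Q \<rho> \<in> Ar A" "Dom A (Th_tuple A C T n Q \<rho>) = Q"
    "Cod A (Th_tuple A C T n Q \<rho>) = Th_ob A C T n"
    "f \<in> simplices C n \<Longrightarrow> Th_proj A C T n f \<cdot> Th_tuple A C T n Q \<rho> = \<rho> f"
    unfolding Th_tuple_def Th_ob_def Th_proj_def by auto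
qed

lemma Th_ext:
  assumes "h \<in> Hom A Q (Th_ob A C T n)" "k \<in> Hom A Q (Th_ob A C T n)"
    "\<And>f. f \<in> simplices C n \<Longrightarrow> Th_proj A C T n f \<cdot> h = Th_proj A C T n f \<cdot> k"
  shows "h = k"
  by (rule product_ext[OF Th_product assms(1,2)]) (rule assms(3))

lemma Th_coface:
  shows Th_coface_simps [simp]: "Th_coface A C T n i \<in> Ar A" "Dom A (Th_coface A C T n i) = Th_ob A C T n"
    "Cod A (Th_coface A C T n i) = Th_ob A C T (Suc n)"
    and Th_proj_coface: "g \<in> simplices C (Suc n) \<Longrightarrow> Th_proj A C T (Suc n) g \<cdot> Th_coface A C T n i =
      FM T (face n (skip n i) (Suc n) g) \<cdot> Th_proj A C T n (pull_simplex n (skip n i) g)"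
proof -
  note sk[simp] = skip_mono_maps[of n i] pull_simplices[OF skip_mono_maps[of n i]]
  have r: "FM T (face n (skip n i) (Suc n) g) \<cdot> Th_proj A C T n (pull_simplex n (skip n i) g)
      \<in> Hom A (Th_ob A C T n) (FO T (Suc n, g))" if "g \<in> simplices C (Suc n)" for g
    using that by simp
  note tt = Th_tuple[OF Th_simps(1) r]
  show "Th_coface A C T n i \<in> Ar A" "Dom A (Th_coface A C T n i) = Th_ob A C T n"
    "Cod A (Th_coface A C T n i) = Th_ob A C T (Suc n)"
    using tt(1-3) unfolding Th_coface_def Let_def by auto
  show "g \<in> simplices C (Suc n) \<Longrightarrow> Th_proj A C T (Suc n) g \<cdot> Th_coface A C T n i =
      FM T (face n (skip n i) (Suc n) g) \<cdot> Th_proj A C T n (pull_simplex n (skip n i) g)"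
    using tt(4) unfolding Th_coface_def Let_def by auto
qed

lemma Th_diff_altsum: "Th_diff A C T n = altsum (Th_ob A C T n) (Th_ob A C T (Suc n)) (Suc n) (Th_coface A C T n)"
  unfolding Th_diff_def altsum_def Let_def ..

lemma Th_diff_simps [simp]:
  "Th_diff A C T n \<in> Ar A" "Dom A (Th_diff A C T n) = Th_ob A C T n" "Cod A (Th_diff A C T n) = Th_ob A C T (Suc n)"
  unfolding Th_diff_altsum using altsum_simps[of "Th_ob A C T n" "Th_ob A C T (Suc n)" "Suc n" "Th_coface A C T n"] by auto

lemma T_face_comp:
  assumes \<sigma>: "\<sigma> \<in> mono_maps n m" and \<tau>: "\<tau> \<in> mono_maps m k" and g: "g \<in> simplices C k"
  shows "FM T (face m \<tau> k g) \<cdot> FM T (face n \<sigma> m (pull_simplex m \<tau> g)) = FM T (face n (compose {..n} \<tau> \<sigma>) k g)"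
  using functor_simps(6)[OF T, of "face n \<sigma> m (pull_simplex m \<tau> g)" "face m \<tau> k g"] assms
  by (simp add: pull_simplices pull_simplex_compose)

text \<open>By functoriality of \<open>T\<close>, two cofaces in succession depend only on the
  composite order map \<open>\<theta>\<close>. Identities between cofaces thereby reduce to
  identities between maps of ordinals.\<close>

lemma Th_proj_coface_coface:
  assumes g: "g \<in> simplices C (Suc (Suc n))" and \<theta>_def: "\<theta> = compose {..n} (skip (Suc n) j) (skip n i)"
  shows "Th_proj A C T (Suc (Suc n)) g \<cdot> (Th_coface A C T (Suc n) j \<cdot> Th_coface A C T n i) =
    FM T (face n \<theta> (Suc (Suc n)) g) \<cdot> Th_proj A C T n (pull_simplex n \<theta> g)"
proof -
  note sk[simp] = skip_mono_maps pull_simplices[OF skip_mono_maps] g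
  let ?g = "pull_simplex (Suc n) (skip (Suc n) j) g"
  have "Th_proj A C T (Suc (Suc n)) g \<cdot> (Th_coface A C T (Suc n) j \<cdot> Th_coface A C T n i)
      = FM T (face (Suc n) (skip (Suc n) j) (Suc (Suc n)) g) \<cdot> (Th_proj A C T (Suc n) ?g \<cdot> Th_coface A C T n i)"
    by (subst assoc_eq[OF Th_proj_coface[OF g]]) auto
  also have "\<dots> = FM T (face (Suc n) (skip (Suc n) j) (Suc (Suc n)) g) \<cdot>
      (FM T (face n (skip n i) (Suc n) ?g) \<cdot> Th_proj A C T n (pull_simplex n (skip n i) ?g))"
    by (subst Th_proj_coface) auto
  also have "\<dots> = FM T (face n \<theta> (Suc (Suc n)) g) \<cdot> Th_proj A C T n (pull_simplex n (skip n i) ?g)"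
    unfolding \<theta>_def by (rule assoc_eq[OF T_face_comp]) auto
  also have "pull_simplex n (skip n i) ?g = pull_simplex n \<theta> g"
    unfolding \<theta>_def by (rule pull_simplex_compose[OF _ _ g, symmetric]) auto
  finally show ?thesis .
qed

text \<open>The cosimplicial relation among the injections omitting one value, in the index form
  that \<open>altsum_altsum_zero\<close> expects.\<close>

lemma skip_skip:
  assumes "i < j" "j \<le> Suc (Suc n)"
  shows "compose {..n} (skip (Suc n) j) (skip n i) = compose {..n} (skip (Suc n) i) (skip n (j - 1))"
  using assms by (auto simp: compose_def skip_def fun_eq_iff)

text \<open>Bilinearity turns the composite into a double alternating sum of composed cofaces, which
  cancels in pairs.\<close>

lemma Th_diff_diff: "Th_diff A C T (Suc n) \<cdot> Th_diff A C T n = HZero A (Th_ob A C T n) (Th_ob A C T (Suc (Suc n)))"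
proof -
  let ?a = "Th_ob A C T n" and ?b = "Th_ob A C T (Suc n)" and ?c = "Th_ob A C T (Suc (Suc n))"
  have "Th_diff A C T (Suc n) \<cdot> Th_diff A C T n =
      altsum ?a ?c (Suc (Suc n)) (\<lambda>j. Th_coface A C T (Suc n) j \<cdot> Th_diff A C T n)"
    unfolding Th_diff_altsum[of "Suc n"] by (subst altsum_comp) auto
  also have "\<dots> = altsum ?a ?c (Suc (Suc n)) (\<lambda>j. altsum ?a ?c (Suc n) (\<lambda>i. Th_coface A C T (Suc n) j \<cdot> Th_coface A C T n i))"
    unfolding Th_diff_altsum[of n] by (subst comp_altsum) auto
  also have "\<dots> = HZero A ?a ?c"
  proof (rule altsum_altsum_zero)
    fix i j :: nat assume ij: "i < j" "j \<le> Suc (Suc n)"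
    show "Th_coface A C T (Suc n) j \<cdot> Th_coface A C T n i = Th_coface A C T (Suc n) i \<cdot> Th_coface A C T n (j - 1)"
      by (rule Th_ext[of _ ?a]) (auto simp: Th_proj_coface_coface[OF _ refl] skip_skip[OF ij])
  qed auto
  finally show ?thesis .
qed

lemma Th_incoming_simps [simp]:
  "Th_incoming A C T n \<in> Ar A" "Cod A (Th_incoming A C T n) = Th_ob A C T n"
  "Th_incoming A C T (Suc n) = Th_diff A C T n" "Th_incoming A C T 0 = HZero A (Th_ob A C T 0) (Th_ob A C T 0)"
  by (cases n; simp add: Th_incoming_def)+

lemma Th_complex: "complex_at (Th_incoming A C T n) (Th_diff A C T n)"
  by (cases n) (auto simp: complex_at_def Th_diff_diff)

end

end

text \<open>Compatibility with each coface passes to the alternating sums. Two base categories are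
  allowed, so that both the maps induced by transformations and the comparison of cochains on
  \<open>B\<close> with those on \<open>E\<close> are covered.\<close>

lemma cochain_mor:
  assumes C: "thomason TYPE('u) A C" and C': "thomason TYPE('u) A C'"
    and T: "is_functor (simplex_cat C) A T" and T': "is_functor (simplex_cat C') A T'"
    and h: "\<And>n. h n \<in> Hom A (Th_ob A C T n) (Th_ob A C' T' n)"
    and comm: "\<And>n i. i \<le> Suc n \<Longrightarrow> h (Suc n) \<cdot>\<^bsub>A\<^esub> Th_coface A C T n i = Th_coface A C' T' n i \<cdot>\<^bsub>A\<^esub> h n"
  shows "abelian_category.complex_mor A (Th_incoming A C T n) (Th_diff A C T n) (Th_incoming A C' T' n) (Th_diff A C' T' n) (h n)"
proof -
  interpret C: thomason A C "TYPE('u)" by fact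
  interpret C': thomason A C' "TYPE('u)" by fact
  note [simp] = C.Th_simps[OF T] C'.Th_simps[OF T'] h[simplified] C.Th_coface_simps[OF T] C'.Th_coface_simps[OF T']
    C.Th_diff_simps[OF T] C'.Th_diff_simps[OF T'] C.Th_incoming_simps[OF T] C'.Th_incoming_simps[OF T']
  have d: "h (Suc n) \<cdot>\<^bsub>A\<^esub> Th_diff A C T n = Th_diff A C' T' n \<cdot>\<^bsub>A\<^esub> h n" for n
  proof -
    have "h (Suc n) \<cdot>\<^bsub>A\<^esub> Th_diff A C T n = C.altsum (Th_ob A C T n) (Th_ob A C' T' (Suc n)) (Suc n) (\<lambda>i. h (Suc n) \<cdot>\<^bsub>A\<^esub> Th_coface A C T n i)"
      unfolding C.Th_diff_altsum[OF T] by (subst C.comp_altsum) auto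
    also have "\<dots> = C.altsum (Th_ob A C T n) (Th_ob A C' T' (Suc n)) (Suc n) (\<lambda>i. Th_coface A C' T' n i \<cdot>\<^bsub>A\<^esub> h n)"
      by (rule C.altsum_cong) (use comm in auto)
    also have "\<dots> = Th_diff A C' T' n \<cdot>\<^bsub>A\<^esub> h n"
      unfolding C'.Th_diff_altsum[OF T'] by (subst C.altsum_comp) auto
    finally show ?thesis .
  qed
  show ?thesis unfolding C.complex_mor_def
  proof (intro conjI)
    show "\<exists>c\<in>Hom A (Cod A (Th_diff A C T n)) (Cod A (Th_diff A C' T' n)). c \<cdot>\<^bsub>A\<^esub> Th_diff A C T n = Th_diff A C' T' n \<cdot>\<^bsub>A\<^esub> h n"
      using d[of n] by (intro bexI[of _ "h (Suc n)"]) auto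
    show "\<exists>a\<in>Hom A (Dom A (Th_incoming A C T n)) (Dom A (Th_incoming A C' T' n)). h n \<cdot>\<^bsub>A\<^esub> Th_incoming A C T n = Th_incoming A C' T' n \<cdot>\<^bsub>A\<^esub> a"
    proof (cases n)
      \<comment> \<open>In degree 0 the incoming arrows are zero endomorphisms of the cochains, so
        \<open>h 0\<close> itself completes the square.\<close>
      case 0 then show ?thesis by (intro bexI[of _ "h 0"]) auto
    next
      case (Suc m) then show ?thesis using d[of m] by (intro bexI[of _ "h m"]) auto
    qed
  qed simp
qed

section \<open>Functoriality of Thomason cohomology\<close>

context thomason
begin

lemma Th_map:
  assumes t: "t \<in> Ar (Fun (simplex_cat C) A)"
  defines "S \<equiv> Dom (Fun (simplex_cat C) A) t" and "T \<equiv> Cod (Fun (simplex_cat C) A) t"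
  shows "Th_map A C t n \<in> Ar A" "Dom A (Th_map A C t n) = Th_ob A C S n" "Cod A (Th_map A C t n) = Th_ob A C T n"
    "f \<in> simplices C n \<Longrightarrow> Th_proj A C T n f \<cdot> Th_map A C t n = NC t (n, f) \<cdot> Th_proj A C S n f"
proof -
  have S: "is_functor (simplex_cat C) A S" and T: "is_functor (simplex_cat C) A T"
    using Fun_Ar_simps[OF t] unfolding S_def T_def by auto
  have nd: "NDom t = S" "NCod t = T" unfolding S_def T_def by (auto simp: Fun_def)
  have r: "NC t (n, f) \<cdot> Th_proj A C S n f \<in> Hom A (Th_ob A C S n) (FO T (n, f))" if "f \<in> simplices C n" for f
    using that Fun_Ar_simps(3-5)[OF t, of "(n, f)"] Th_simps[OF S] unfolding S_def T_def by auto
  note tt = Th_tuple[OF T Th_simps(1)[OF S] r]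
  show "Th_map A C t n \<in> Ar A" "Dom A (Th_map A C t n) = Th_ob A C S n" "Cod A (Th_map A C t n) = Th_ob A C T n"
    "f \<in> simplices C n \<Longrightarrow> Th_proj A C T n f \<cdot> Th_map A C t n = NC t (n, f) \<cdot> Th_proj A C S n f"
    using tt unfolding Th_map_def nd by auto
qed

text \<open>After projection to the factor of \<open>g\<close>, this is naturality of
  \<open>t\<close> along the face inclusion into \<open>g\<close>.\<close>

lemma Th_map_coface:
  assumes t: "t \<in> Ar (Fun (simplex_cat C) A)"
  defines "S \<equiv> Dom (Fun (simplex_cat C) A) t" and "T \<equiv> Cod (Fun (simplex_cat C) A) t"
  shows "Th_map A C t (Suc n) \<cdot> Th_coface A C S n i = Th_coface A C T n i \<cdot> Th_map A C t n"
proof -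
  have S: "is_functor (simplex_cat C) A S" and T: "is_functor (simplex_cat C) A T"
    using Fun_Ar_simps[OF t] unfolding S_def T_def by auto
  note tm = Th_map[OF t, folded S_def T_def]
  have NC: "NC t (n, f) \<in> Ar A" "Dom A (NC t (n, f)) = FO S (n, f)" "Cod A (NC t (n, f)) = FO T (n, f)"
    if "f \<in> simplices C n" for n f
    using that Fun_Ar_simps(3-5)[OF t, of "(n, f)"] unfolding S_def T_def by auto
  note [simp] = tm(1-3) Th_simps[OF S] Th_simps[OF T] Th_coface_simps[OF S] Th_coface_simps[OF T] NC
    T_simps[OF S] T_simps[OF T] skip_mono_maps pull_simplices[OF skip_mono_maps]
  show ?thesis
  proof (rule Th_ext[OF T, of _ "Th_ob A C S n"])
    fix g assume g[simp]: "g \<in> simplices C (Suc n)"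
    let ?g = "pull_simplex n (skip n i) g"
    have nat: "NC t (Suc n, g) \<cdot> FM S (face n (skip n i) (Suc n) g) = FM T (face n (skip n i) (Suc n) g) \<cdot> NC t (n, ?g)"
      using Fun_naturality[OF t, of "face n (skip n i) (Suc n) g"] unfolding S_def T_def by simp
    have "Th_proj A C T (Suc n) g \<cdot> (Th_map A C t (Suc n) \<cdot> Th_coface A C S n i)
        = NC t (Suc n, g) \<cdot> (Th_proj A C S (Suc n) g \<cdot> Th_coface A C S n i)"
      by (subst assoc_eq[OF tm(4)]) auto
    also have "\<dots> = NC t (Suc n, g) \<cdot> (FM S (face n (skip n i) (Suc n) g) \<cdot> Th_proj A C S n ?g)"
      by (subst Th_proj_coface[OF S g]) simp
    also have "\<dots> = FM T (face n (skip n i) (Suc n) g) \<cdot> (NC t (n, ?g) \<cdot> Th_proj A C S n ?g)"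
      by (subst assoc_eq[OF nat]) auto
    also have "\<dots> = FM T (face n (skip n i) (Suc n) g) \<cdot> (Th_proj A C T n ?g \<cdot> Th_map A C t n)"
      by (subst tm(4)) auto
    also have "\<dots> = Th_proj A C T (Suc n) g \<cdot> (Th_coface A C T n i \<cdot> Th_map A C t n)"
      by (subst assoc_eq[OF Th_proj_coface[OF T g]]) auto
    finally show "Th_proj A C T (Suc n) g \<cdot> (Th_map A C t (Suc n) \<cdot> Th_coface A C S n i) =
        Th_proj A C T (Suc n) g \<cdot> (Th_coface A C T n i \<cdot> Th_map A C t n)" .
  qed auto
qed

lemma Th_map_mor:
  assumes t: "t \<in> Ar (Fun (simplex_cat C) A)"
  defines "S \<equiv> Dom (Fun (simplex_cat C) A) t" and "T \<equiv> Cod (Fun (simplex_cat C) A) t"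
  shows "complex_mor (Th_incoming A C S n) (Th_diff A C S n) (Th_incoming A C T n) (Th_diff A C T n) (Th_map A C t n)"
  unfolding S_def T_def
  by (rule cochain_mor[OF thomason_axioms thomason_axioms, of _ _ "Th_map A C t"])
    (use Fun_Ar_simps[OF t] Th_map[OF t] Th_map_coface[OF t] in auto)

lemma Th_map_Id:
  assumes T: "is_functor (simplex_cat C) A T"
  shows "Th_map A C (Id (Fun (simplex_cat C) A) T) n = Id A (Th_ob A C T n)"
proof -
  have I: "Id (Fun (simplex_cat C) A) T \<in> Ar (Fun (simplex_cat C) A)" by (rule S.Fun_Id_Ar[OF T])
  note [simp] = Th_simps[OF T] T_simps[OF T]
  show ?thesis
    by (rule Th_ext[OF T, of _ "Th_ob A C T n"]) (use Th_map[OF I] in auto)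
qed

lemma Th_map_comp:
  assumes s: "s \<in> Ar (Fun (simplex_cat C) A)" and t: "t \<in> Ar (Fun (simplex_cat C) A)"
    and st: "Cod (Fun (simplex_cat C) A) s = Dom (Fun (simplex_cat C) A) t"
  shows "Th_map A C (t \<cdot>\<^bsub>Fun (simplex_cat C) A\<^esub> s) n = Th_map A C t n \<cdot> Th_map A C s n"
proof -
  have ts: "t \<cdot>\<^bsub>Fun (simplex_cat C) A\<^esub> s \<in> Ar (Fun (simplex_cat C) A)" by (rule S.Fun_comp_Ar[OF t s st])
  let ?S = "Dom (Fun (simplex_cat C) A) s" and ?T = "Dom (Fun (simplex_cat C) A) t" and ?V = "Cod (Fun (simplex_cat C) A) t"
  note S = Fun_Ar_simps(1)[OF s] and T = Fun_Ar_simps(1)[OF t] and V = Fun_Ar_simps(2)[OF t]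
  note ms = Th_map[OF s] and mt = Th_map[OF t] and mts = Th_map[OF ts]
  note [simp] = Th_simps[OF S] Th_simps[OF T] Th_simps[OF V] ms(1-3) mt(1-3) mts(1-3) st
    Fun_Ar_simps(3-5)[OF s] Fun_Ar_simps(3-5)[OF t]
  show ?thesis
  proof (rule Th_ext[OF V, of _ "Th_ob A C ?S n"])
    fix f assume f[simp]: "f \<in> simplices C n"
    have "Th_proj A C ?V n f \<cdot> (Th_map A C t n \<cdot> Th_map A C s n) = NC t (n, f) \<cdot> (Th_proj A C ?T n f \<cdot> Th_map A C s n)"
      by (subst assoc_eq[OF mt(4)]) auto
    also have "\<dots> = NC t (n, f) \<cdot> (NC s (n, f) \<cdot> Th_proj A C ?S n f)"
      using ms(4)[OF f] by simp
    finally show "Th_proj A C ?V n f \<cdot> Th_map A C (t \<cdot>\<^bsub>Fun (simplex_cat C) A\<^esub> s) n =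
      Th_proj A C ?V n f \<cdot> (Th_map A C t n \<cdot> Th_map A C s n)"
      using mts(4)[OF f] by simp
  qed auto
qed

lemma Th_cohomology_simps [simp]:
  "is_functor (simplex_cat C) A T \<Longrightarrow> FO (Th_cohomology A C n) T = coh_ob A (Th_incoming A C T n) (Th_diff A C T n)"
  "t \<in> Ar (Fun (simplex_cat C) A) \<Longrightarrow> FM (Th_cohomology A C n) t =
    coh_map A (Th_incoming A C (Dom (Fun (simplex_cat C) A) t) n) (Th_diff A C (Dom (Fun (simplex_cat C) A) t) n)
      (Th_incoming A C (Cod (Fun (simplex_cat C) A) t) n) (Th_diff A C (Cod (Fun (simplex_cat C) A) t) n) (Th_map A C t n)"
  by (simp add: Th_cohomology_def Fun_Ob) (simp add: Th_cohomology_def Fun_def)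

lemma Th_cohomology_functor: "is_functor (Fun (simplex_cat C) A) A (Th_cohomology A C n)"
proof -
  have "is_functor (Fun (simplex_cat C) A) A (mk_functor (Fun (simplex_cat C) A) (FO (Th_cohomology A C n)) (FM (Th_cohomology A C n)))"
  proof (rule S.Fun.mk_functorI)
    fix T assume "T \<in> Ob (Fun (simplex_cat C) A)"
    then have T: "is_functor (simplex_cat C) A T" by (simp add: Fun_Ob)
    note c = Th_complex[OF T, of n]
    show "FO (Th_cohomology A C n) T \<in> Ob A" using coh_simps[OF c] T by simp
    show "FM (Th_cohomology A C n) (Id (Fun (simplex_cat C) A) T) = Id A (FO (Th_cohomology A C n) T)"
      using coh_map_Id[OF c] T S.Fun_Id_Ar[OF T] Th_map_Id[OF T] Th_incoming_simps[OF T] by simp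
  next
    fix t assume t: "t \<in> Ar (Fun (simplex_cat C) A)"
    show "FM (Th_cohomology A C n) t \<in> Hom A (FO (Th_cohomology A C n) (Dom (Fun (simplex_cat C) A) t))
        (FO (Th_cohomology A C n) (Cod (Fun (simplex_cat C) A) t))"
      using t coh_map_simps[OF Th_complex Th_complex Th_map_mor[OF t], OF Fun_Ar_simps(1,2)[OF t]] Fun_Ar_simps(1,2)[OF t]
      by simp
  next
    fix s t assume s: "s \<in> Ar (Fun (simplex_cat C) A)" and t: "t \<in> Ar (Fun (simplex_cat C) A)"
      and st: "Cod (Fun (simplex_cat C) A) s = Dom (Fun (simplex_cat C) A) t"
    note c = Th_complex[OF Fun_Ar_simps(1)[OF s]] Th_complex[OF Fun_Ar_simps(2)[OF s]] Th_complex[OF Fun_Ar_simps(2)[OF t]]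
    show "FM (Th_cohomology A C n) (t \<cdot>\<^bsub>Fun (simplex_cat C) A\<^esub> s) = FM (Th_cohomology A C n) t \<cdot> FM (Th_cohomology A C n) s"
      using coh_map_comp[OF c Th_map_mor[OF s] Th_map_mor[OF t, folded st]] s t st S.Fun_comp_Ar[OF t s st]
      by (simp add: Th_map_comp)
  qed
  moreover have "mk_functor (Fun (simplex_cat C) A) (FO (Th_cohomology A C n)) (FM (Th_cohomology A C n)) = Th_cohomology A C n"
    by (simp add: mk_functor_def Th_cohomology_def)
  ultimately show ?thesis by simp
qed

text \<open>The cochains in degree \<open>n\<close> are a product of zero objects, hence zero. This
  settles the rows \<open>q > 0\<close>.\<close>

lemma Th_cohomology_zero:
  assumes T: "is_functor (simplex_cat C) A T"
    and z: "\<And>f. f \<in> simplices C n \<Longrightarrow> is_zero_object A (FO T (n, f))"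
  shows "is_zero_object A (FO (Th_cohomology A C n) T)"
proof -
  note [simp] = Th_simps[OF T]
  have "Id A (Th_ob A C T n) = HZero A (Th_ob A C T n) (Th_ob A C T n)"
  proof (rule Th_ext[OF T])
    fix f assume f: "f \<in> simplices C n"
    show "Th_proj A C T n f \<cdot> Id A (Th_ob A C T n) = Th_proj A C T n f \<cdot> HZero A (Th_ob A C T n) (Th_ob A C T n)"
      by (rule to_zero_object_eq[OF z[OF f]]) (use f T_simps[OF T] in auto)
  qed auto
  then have "is_zero_object A (Th_ob A C T n)" by (simp add: zero_object_iff)
  then show ?thesis using T coh_ob_zero[OF Th_complex[OF T, of n]] Th_incoming_simps[OF T] by simp
qed

end

section \<open>Natural isomorphisms\<close>

lemma naturally_isomorphicI:
  assumes "category X" "is_functor X A F" "is_functor X A G"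
    and "\<And>a. a \<in> Ob X \<Longrightarrow> \<eta> a \<in> Hom A (FO F a) (FO G a)" "\<And>a. a \<in> Ob X \<Longrightarrow> is_iso A (\<eta> a)"
    and "\<And>f. f \<in> Ar X \<Longrightarrow> \<eta> (Cod X f) \<cdot>\<^bsub>A\<^esub> FM F f = FM G f \<cdot>\<^bsub>A\<^esub> \<eta> (Dom X f)"
  shows "naturally_isomorphic X (A :: ('o, 'm, 'z) pcat_scheme) F G"
proof -
  have "mk_nt X F G \<eta> \<in> Hom (Fun X A) F G" using mk_ntI[of X A F G \<eta>] assms by simp
  then have "nat_trans X A F G (mk_nt X F G \<eta>)" by (simp only: Fun_Hom)
  then show ?thesis unfolding naturally_isomorphic_def using assms(5)
    by (intro exI[of _ "mk_nt X F G \<eta>"]) simp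
qed

lemma (in functor_category) naturally_isomorphic_sym:
  assumes "naturally_isomorphic C A F G"
  shows "naturally_isomorphic C A G F"
proof -
  obtain t where t: "t \<in> Hom (Fun C A) F G" and iso: "\<And>a. a \<in> Ob C \<Longrightarrow> is_iso A (NC t a)"
    using assms unfolding naturally_isomorphic_def Fun_Hom by blast
  have t': "t \<in> Ar (Fun C A)" using t by simp
  obtain s where s: "s \<in> Ar (Fun C A)" "Dom (Fun C A) s = G" "Cod (Fun C A) s = F"
    "s \<cdot>\<^bsub>Fun C A\<^esub> t = Id (Fun C A) F" "t \<cdot>\<^bsub>Fun C A\<^esub> s = Id (Fun C A) G"
    using Fun.is_isoE[OF Fun_isoI[OF t' iso]] t by auto
  have "is_iso (Fun C A) s" by (rule Fun.is_isoI[of _ _ _ t]) (use s t in auto)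
  then show ?thesis unfolding naturally_isomorphic_def
    using Fun_isoD s(1-3) by (intro exI[of _ s]) (auto simp: Fun_Hom[symmetric])
qed

lemma (in preadditive_category) naturally_isomorphic_zero:
  assumes X: "category X" and F: "is_functor X A F" and G: "is_functor X A G"
    and zF: "\<And>a. a \<in> Ob X \<Longrightarrow> is_zero_object A (FO F a)" and zG: "\<And>a. a \<in> Ob X \<Longrightarrow> is_zero_object A (FO G a)"
  shows "naturally_isomorphic X A F G"
proof -
  interpret X: category X by fact
  note [simp] = functor_simps[OF F] functor_simps[OF G]
  show ?thesis
  proof (rule naturally_isomorphicI[OF X F G, of "\<lambda>a. HZero A (FO F a) (FO G a)"])
    show "is_iso A (HZero A (FO F a) (FO G a))" if "a \<in> Ob X" for a
      by (rule is_isoI[of _ "FO F a" "FO G a" "HZero A (FO G a) (FO F a)"])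
        (use that zF[OF that] zG[OF that] in \<open>auto simp: zero_object_iff\<close>)
  qed auto
qed

section \<open>Cochains of a right Kan extension\<close>

text \<open>\<open>R\<close> stands for any right adjoint together with its counit, not for the
  model \<open>ran\<close>, since the result concerns every choice of Kan extension.\<close>

locale thomason_ran = abelian_category A
  for A :: "('o, 'm) pcat" (structure) +
  fixes E B :: "('u, 'u) cat" and u :: "('u, 'u, 'u, 'u) functor_data"
    and R :: "(('u, 'u, 'o, 'm) natural_system, ('u, 'u, 'o, 'm) natural_system_map,
      ('u, 'u, 'o, 'm) natural_system, ('u, 'u, 'o, 'm) natural_system_map) functor_data"
    and \<epsilon> :: "('u, 'u, 'o, 'm) natural_system \<Rightarrow> ('u, 'u, 'o, 'm) natural_system_map"
  assumes infinite: "infinite (UNIV :: 'u set)" and u: "is_functor E B u"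
    and complete: "complete_category TYPE('u) A" and exact: "exact_products TYPE('u) A"
    and R: "is_functor (Fun (simplex_cat E) A) (Fun (simplex_cat B) A) R"
    and \<epsilon>: "universal_counit (Fun (simplex_cat B) A) (Fun (simplex_cat E) A)
      (precomp (simplex_cat E) (simplex_cat B) A (simplex_functor E u)) R \<epsilon>"

text \<open>The fibre over \<open>(n, g)\<close> contains \<open>n\<close>-simplices only, so it
  injects into the small set \<open>simplices E n\<close>.\<close>

lemma simplex_fibration_kan:
  fixes E B :: "('u, 'u) cat"
  assumes "infinite (UNIV :: 'u set)" and u: "is_functor E B u" and "abelian_category A"
    and "complete_category TYPE('u) A" and "exact_products TYPE('u) A"
  shows "fibration_kan TYPE('u) (simplex_cat E) (simplex_cat B) (simplex_functor E u) A"
proof -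
  interpret F: discrete_fibration "simplex_cat E" "simplex_cat B" "simplex_functor E u"
    by (rule simplex_functor_fibration[OF u])
  have "small TYPE('u) (F.fib c)" for c
  proof (cases c)
    case (Pair n g)
    have fst: "fst x = n" if "x \<in> F.fib c" for x
      using that Pair by (cases x) (auto simp: F.fib_def)
    show ?thesis
    proof (rule small_inj[OF small_simplices[OF assms(1), of E n], of snd])
      show "inj_on snd (F.fib c)" using fst by (auto simp: inj_on_def prod_eq_iff)
      show "snd ` F.fib c \<subseteq> simplices E n" using fst by (fastforce simp: F.fib_def)
    qed
  qed
  then show ?thesis
    by (intro fibration_kan.intro fibration_kan_axioms.intro F.discrete_fibration_axioms assms)
qed

context thomason_ran
begin

sublocale K: fibration_kan "simplex_cat E" "simplex_cat B" "simplex_functor E u" A "TYPE('u)"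
  by (rule simplex_fibration_kan[OF infinite u abelian_category_axioms complete exact])

sublocale E: thomason A E "TYPE('u)"
  by unfold_locales (rule complete, rule small_simplices[OF infinite])

sublocale B: thomason A B "TYPE('u)"
  by unfold_locales (rule complete, rule small_simplices[OF infinite])

abbreviation uf where "uf n f \<equiv> fcomp (ord_cat n) u f"

lemma uf: "f \<in> simplices E n \<Longrightarrow> uf n f \<in> simplices B n"
  by (rule fcomp_simplices[OF _ u])

text \<open>The identification of an iterated product with the product over all simplices of
  \<open>E\<close>: the factor of \<open>f\<close> is reached through the factor of its image in
  \<open>B\<close>, whose own projections are the counit components.\<close>

definition cmp :: "('u, 'u, 'o, 'm) natural_system \<Rightarrow> nat \<Rightarrow> 'm" where
  "cmp T n = Th_tuple A E T n (Th_ob A B (FO R T) n) (\<lambda>f. NC (\<epsilon> T) (n, f) \<cdot> Th_proj A B (FO R T) n (uf n f))"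

context
  fixes T assumes T: "is_functor (simplex_cat E) A T"
begin

lemma RT: "is_functor (simplex_cat B) A (FO R T)"
  by (rule K.R_Ob[OF R \<epsilon> T])

lemma counit_NC [simp]:
  assumes "f \<in> simplices E n"
  shows "NC (\<epsilon> T) (n, f) \<in> Ar A" "Dom A (NC (\<epsilon> T) (n, f)) = FO (FO R T) (n, uf n f)"
    "Cod A (NC (\<epsilon> T) (n, f)) = FO T (n, f)"
  using Fun_Ar_simps(3-5)[OF K.counit_Ar(1)[OF R \<epsilon> T], of "(n, f)"] K.counit_Ar(2,3)[OF R \<epsilon> T] assms by auto

text \<open>Objects of the fibre are pairs with first entry \<open>n\<close>; dropping that entry
  turns the product given by the Kan extension into one over simplices.\<close>

lemma fibre_product:
  assumes "g \<in> simplices B n"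
  shows "is_product A {f \<in> simplices E n. uf n f = g} (\<lambda>f. FO T (n, f)) (FO (FO R T) (n, g)) (\<lambda>f. NC (\<epsilon> T) (n, f))"
proof -
  have "bij_betw (Pair n) {f \<in> simplices E n. uf n f = g} (K.fib (n, g))"
  proof (rule bij_betw_imageI)
    show "Pair n ` {f \<in> simplices E n. uf n f = g} = K.fib (n, g)"
      by (force simp: K.fib_def)
  qed (simp add: inj_on_def)
  moreover have "is_product A (K.fib (n, g)) (FO T) (FO (FO R T) (n, g)) (NC (\<epsilon> T))"
    by (rule K.right_adjoint_product[OF R \<epsilon> T]) (simp add: assms)
  ultimately show ?thesis by (rule product_reindex)
qed

text \<open>Every simplex of \<open>E\<close> lies over exactly one simplex of \<open>B\<close>, so
  the products over the fibres combine to a product over all of them.\<close>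

lemma total_product:
  "is_product A (simplices E n) (\<lambda>f. FO T (n, f)) (Th_ob A B (FO R T) n)
    (\<lambda>f. NC (\<epsilon> T) (n, f) \<cdot> Th_proj A B (FO R T) n (uf n f))"
  by (rule product_of_products[OF B.Th_product[OF RT] fibre_product]) (auto intro: uf)

lemma cmp_simps [simp]:
  "cmp T n \<in> Ar A" "Dom A (cmp T n) = Th_ob A B (FO R T) n" "Cod A (cmp T n) = Th_ob A E T n"
  and cmp_proj: "f \<in> simplices E n \<Longrightarrow>
    Th_proj A E T n f \<cdot> cmp T n = NC (\<epsilon> T) (n, f) \<cdot> Th_proj A B (FO R T) n (uf n f)"
proof -
  have r: "NC (\<epsilon> T) (n, f) \<cdot> Th_proj A B (FO R T) n (uf n f) \<in> Hom A (Th_ob A B (FO R T) n) (FO T (n, f))"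
    if "f \<in> simplices E n" for f
    using product_simps[OF total_product] that by simp
  note tt = E.Th_tuple[OF T B.Th_simps(1)[OF RT] r]
  show "cmp T n \<in> Ar A" "Dom A (cmp T n) = Th_ob A B (FO R T) n" "Cod A (cmp T n) = Th_ob A E T n"
    "f \<in> simplices E n \<Longrightarrow> Th_proj A E T n f \<cdot> cmp T n = NC (\<epsilon> T) (n, f) \<cdot> Th_proj A B (FO R T) n (uf n f)"
    using tt unfolding cmp_def by auto
qed

lemma cmp_iso: "is_iso A (cmp T n)"
  by (rule product_unique[OF total_product E.Th_product[OF T]]) (auto simp: cmp_proj)

text \<open>Taking faces commutes with \<open>u\<close>, so after projection to \<open>f\<close> the
  equation reduces to naturality of \<open>\<epsilon> T\<close> along the face inclusion into
  \<open>f\<close>.\<close>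

lemma cmp_coface: "cmp T (Suc n) \<cdot> Th_coface A B (FO R T) n i = Th_coface A E T n i \<cdot> cmp T n"
proof -
  note [simp] = E.Th_simps[OF T] B.Th_simps[OF RT] E.Th_coface_simps[OF T] B.Th_coface_simps[OF RT]
    E.T_simps[OF T] B.T_simps[OF RT] skip_mono_maps pull_simplices[OF skip_mono_maps] uf
  show ?thesis
  proof (rule E.Th_ext[OF T, of _ "Th_ob A B (FO R T) n"])
    fix f assume f[simp]: "f \<in> simplices E (Suc n)"
    let ?f = "pull_simplex n (skip n i) f"
    have u': "pull_simplex n (skip n i) (uf (Suc n) f) = uf n ?f"
      by (rule pull_simplex_fcomp[OF skip_mono_maps f u, symmetric])
    have [simp]: "FM (FO R T) ((n, uf n ?f), skip n i, Suc n, uf (Suc n) f) \<in> Ar A"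
      "Dom A (FM (FO R T) ((n, uf n ?f), skip n i, Suc n, uf (Suc n) f)) = FO (FO R T) (n, uf n ?f)"
      "Cod A (FM (FO R T) ((n, uf n ?f), skip n i, Suc n, uf (Suc n) f)) = FO (FO R T) (Suc n, uf (Suc n) f)"
      using B.T_simps(2-4)[OF RT skip_mono_maps, of "uf (Suc n) f" n i] by (simp_all add: u')
    have nat: "NC (\<epsilon> T) (Suc n, f) \<cdot> FM (FO R T) (B.face n (skip n i) (Suc n) (uf (Suc n) f))
        = FM T (E.face n (skip n i) (Suc n) f) \<cdot> NC (\<epsilon> T) (n, ?f)"
      using K.counit_naturality[OF R \<epsilon> T, of "E.face n (skip n i) (Suc n) f"] by (simp add: u')
    have "Th_proj A E T (Suc n) f \<cdot> (cmp T (Suc n) \<cdot> Th_coface A B (FO R T) n i)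
        = NC (\<epsilon> T) (Suc n, f) \<cdot> (Th_proj A B (FO R T) (Suc n) (uf (Suc n) f) \<cdot> Th_coface A B (FO R T) n i)"
      by (subst assoc_eq[OF cmp_proj]) auto
    also have "\<dots> = NC (\<epsilon> T) (Suc n, f) \<cdot> (FM (FO R T) (B.face n (skip n i) (Suc n) (uf (Suc n) f)) \<cdot>
        Th_proj A B (FO R T) n (uf n ?f))"
      by (subst B.Th_proj_coface[OF RT]) (auto simp: u')
    also have "\<dots> = FM T (E.face n (skip n i) (Suc n) f) \<cdot> (NC (\<epsilon> T) (n, ?f) \<cdot> Th_proj A B (FO R T) n (uf n ?f))"
      by (subst assoc_eq[OF nat]) (auto simp: u')
    also have "\<dots> = FM T (E.face n (skip n i) (Suc n) f) \<cdot> (Th_proj A E T n ?f \<cdot> cmp T n)"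
      by (subst cmp_proj) auto
    also have "\<dots> = Th_proj A E T (Suc n) f \<cdot> (Th_coface A E T n i \<cdot> cmp T n)"
      by (subst assoc_eq[OF E.Th_proj_coface[OF T f]]) auto
    finally show "Th_proj A E T (Suc n) f \<cdot> (cmp T (Suc n) \<cdot> Th_coface A B (FO R T) n i) =
        Th_proj A E T (Suc n) f \<cdot> (Th_coface A E T n i \<cdot> cmp T n)" .
  qed auto
qed

lemma cmp_mor:
  "complex_mor (Th_incoming A B (FO R T) n) (Th_diff A B (FO R T) n) (Th_incoming A E T n) (Th_diff A E T n) (cmp T n)"
  by (rule cochain_mor[OF B.thomason_axioms E.thomason_axioms RT T]) (auto simp: cmp_coface)

text \<open>The inverses of the comparison maps commute with the cofaces as well, by conjugating
  \<open>cmp_coface\<close>, and so induce the inverse on cohomology.\<close>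

lemma cmp_coh_iso:
  "is_iso A (coh_map A (Th_incoming A B (FO R T) n) (Th_diff A B (FO R T) n) (Th_incoming A E T n) (Th_diff A E T n) (cmp T n))"
proof -
  note [simp] = E.Th_simps[OF T] B.Th_simps[OF RT] E.Th_coface_simps[OF T] B.Th_coface_simps[OF RT]
  \<comment> \<open>Inverses are chosen in all degrees at once, since compatibility with a coface
    involves two neighbouring degrees.\<close>
  have "\<exists>g. g \<in> Hom A (Th_ob A E T n) (Th_ob A B (FO R T) n) \<and> g \<cdot> cmp T n = Id A (Th_ob A B (FO R T) n) \<and>
    cmp T n \<cdot> g = Id A (Th_ob A E T n)" for n
    using is_isoE[OF cmp_iso[of n]] by auto
  then obtain \<phi> where \<phi>: "\<And>n. \<phi> n \<in> Hom A (Th_ob A E T n) (Th_ob A B (FO R T) n)"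
    "\<And>n. \<phi> n \<cdot> cmp T n = Id A (Th_ob A B (FO R T) n)" "\<And>n. cmp T n \<cdot> \<phi> n = Id A (Th_ob A E T n)" by metis
  note [simp] = \<phi>(1)[simplified]
  have "\<phi> (Suc n) \<cdot> Th_coface A E T n i = Th_coface A B (FO R T) n i \<cdot> \<phi> n" for n i
  proof -
    have "\<phi> (Suc n) \<cdot> Th_coface A E T n i = \<phi> (Suc n) \<cdot> (Th_coface A E T n i \<cdot> (cmp T n \<cdot> \<phi> n))"
      by (simp add: \<phi>(3))
    also have "\<dots> = \<phi> (Suc n) \<cdot> (cmp T (Suc n) \<cdot> (Th_coface A B (FO R T) n i \<cdot> \<phi> n))"
      by (subst assoc_eq[OF cmp_coface[symmetric]]) auto
    also have "\<dots> = Th_coface A B (FO R T) n i \<cdot> \<phi> n"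
      by (subst assoc_eq[OF \<phi>(2)]) auto
    finally show ?thesis .
  qed
  then have "complex_mor (Th_incoming A E T n) (Th_diff A E T n) (Th_incoming A B (FO R T) n) (Th_diff A B (FO R T) n) (\<phi> n)"
    by (intro cochain_mor[OF E.thomason_axioms B.thomason_axioms T RT]) auto
  then show ?thesis
    by (rule coh_map_iso[OF B.Th_complex[OF RT] E.Th_complex[OF T] cmp_mor])
      (simp_all add: \<phi> E.Th_incoming_simps[OF T] B.Th_incoming_simps[OF RT])
qed

end

text \<open>After projection to \<open>f\<close> this is naturality of the counit in the natural
  system.\<close>

lemma cmp_natural:
  assumes t: "t \<in> Ar (Fun (simplex_cat E) A)"
  defines "S \<equiv> Dom (Fun (simplex_cat E) A) t" and "T \<equiv> Cod (Fun (simplex_cat E) A) t"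
  shows "cmp T n \<cdot> Th_map A B (FM R t) n = Th_map A E t n \<cdot> cmp S n"
proof -
  have S: "is_functor (simplex_cat E) A S" and T: "is_functor (simplex_cat E) A T"
    using Fun_Ar_simps[OF t] unfolding S_def T_def by auto
  note Rt = K.R_Ar[OF R \<epsilon> t, folded S_def T_def]
  note me = E.Th_map[OF t, folded S_def T_def] and mb = B.Th_map[OF Rt(1), unfolded Rt(2,3)]
  have NCt: "NC t (n, f) \<in> Ar A" "Dom A (NC t (n, f)) = FO S (n, f)" "Cod A (NC t (n, f)) = FO T (n, f)" if "f \<in> simplices E n" for f
    using Fun_Ar_simps(3-5)[OF t, of "(n, f)"] that unfolding S_def T_def by auto
  have NCR: "NC (FM R t) (n, g) \<in> Ar A" "Dom A (NC (FM R t) (n, g)) = FO (FO R S) (n, g)"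
    "Cod A (NC (FM R t) (n, g)) = FO (FO R T) (n, g)" if "g \<in> simplices B n" for g
    using Fun_Ar_simps(3-5)[OF Rt(1), of "(n, g)"] that Rt by auto
  note [simp] = E.Th_simps[OF S] E.Th_simps[OF T] B.Th_simps[OF RT[OF S]] B.Th_simps[OF RT[OF T]]
    cmp_simps[OF S] cmp_simps[OF T] counit_NC[OF S] counit_NC[OF T] me(1-3) mb(1-3) NCt NCR uf
  show ?thesis
  proof (rule E.Th_ext[OF T, of _ "Th_ob A B (FO R S) n"])
    fix f assume f[simp]: "f \<in> simplices E n"
    have nat: "NC (\<epsilon> T) (n, f) \<cdot> NC (FM R t) (n, uf n f) = NC t (n, f) \<cdot> NC (\<epsilon> S) (n, f)"
      using K.counit_natural[OF R \<epsilon> t, of "(n, f)"] unfolding S_def T_def by simp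
    have "Th_proj A E T n f \<cdot> (cmp T n \<cdot> Th_map A B (FM R t) n)
        = NC (\<epsilon> T) (n, f) \<cdot> (Th_proj A B (FO R T) n (uf n f) \<cdot> Th_map A B (FM R t) n)"
      by (subst assoc_eq[OF cmp_proj[OF T f]]) auto
    also have "\<dots> = NC (\<epsilon> T) (n, f) \<cdot> (NC (FM R t) (n, uf n f) \<cdot> Th_proj A B (FO R S) n (uf n f))"
      by (subst mb(4)) auto
    also have "\<dots> = NC t (n, f) \<cdot> (NC (\<epsilon> S) (n, f) \<cdot> Th_proj A B (FO R S) n (uf n f))"
      by (subst assoc_eq[OF nat]) auto
    also have "\<dots> = NC t (n, f) \<cdot> (Th_proj A E S n f \<cdot> cmp S n)"
      by (subst cmp_proj[OF S f]) auto
    also have "\<dots> = Th_proj A E T n f \<cdot> (Th_map A E t n \<cdot> cmp S n)"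
      by (subst assoc_eq[OF me(4)[OF f]]) auto
    finally show "Th_proj A E T n f \<cdot> (cmp T n \<cdot> Th_map A B (FM R t) n) = Th_proj A E T n f \<cdot> (Th_map A E t n \<cdot> cmp S n)" .
  qed auto
qed

text \<open>The comparison maps lead from the cohomology of \<open>B\<close> to that of
  \<open>E\<close>; the isomorphism is built in that direction and then inverted.\<close>

lemma cohomology_ran_iso:
  "naturally_isomorphic (Fun (simplex_cat E) A) A (Th_cohomology A E n) (fcomp (Fun (simplex_cat E) A) (Th_cohomology A B n) R)"
proof -
  let ?X = "Fun (simplex_cat E) A"
  interpret XA: functor_category ?X A by unfold_locales
  let ?\<eta> = "\<lambda>T. coh_map A (Th_incoming A B (FO R T) n) (Th_diff A B (FO R T) n) (Th_incoming A E T n) (Th_diff A E T n) (cmp T n)"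
  have "naturally_isomorphic ?X A (fcomp ?X (Th_cohomology A B n) R) (Th_cohomology A E n)"
  proof (rule naturally_isomorphicI[of _ _ _ _ ?\<eta>])
    show "category ?X" by (rule K.FD.Fun_category)
    show "is_functor ?X A (fcomp ?X (Th_cohomology A B n) R)"
      by (rule K.FD.Fun.fcomp_functor[OF R B.Th_cohomology_functor])
    show "is_functor ?X A (Th_cohomology A E n)" by (rule E.Th_cohomology_functor)
    fix T assume TO: "T \<in> Ob ?X"
    then have T: "is_functor (simplex_cat E) A T" by (simp add: Fun_Ob)
    show "is_iso A (?\<eta> T)" by (rule cmp_coh_iso[OF T])
    show "?\<eta> T \<in> Hom A (FO (fcomp ?X (Th_cohomology A B n) R) T) (FO (Th_cohomology A E n) T)"
      using coh_map_simps[OF B.Th_complex[OF RT[OF T]] E.Th_complex[OF T] cmp_mor[OF T]] TO T RT[OF T] by simp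
  next
    fix t assume t: "t \<in> Ar ?X"
    let ?S = "Dom ?X t" and ?T = "Cod ?X t"
    note S = Fun_Ar_simps(1)[OF t] and T = Fun_Ar_simps(2)[OF t]
    note Rt = K.R_Ar[OF R \<epsilon> t]
    show "?\<eta> ?T \<cdot> FM (fcomp ?X (Th_cohomology A B n) R) t = FM (Th_cohomology A E n) t \<cdot> ?\<eta> ?S"
      using coh_map_comp[OF B.Th_complex[OF RT[OF S]] B.Th_complex[OF RT[OF T]] E.Th_complex[OF T]
          B.Th_map_mor[OF Rt(1), unfolded Rt(2,3)] cmp_mor[OF T]]
        coh_map_comp[OF B.Th_complex[OF RT[OF S]] E.Th_complex[OF S] E.Th_complex[OF T] cmp_mor[OF S] E.Th_map_mor[OF t]]
        cmp_natural[OF t] t Rt by simp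
  qed
  then show ?thesis by (rule XA.naturally_isomorphic_sym)
qed

end

section \<open>Spectral sequences concentrated in one row\<close>

context abelian_category
begin

text \<open>For zero arrows the cohomology is the middle object only up to isomorphism, as kernel
  and quotient are arbitrary choices. This canonical isomorphism serves as the structure map between
  equal pages.\<close>

definition zero_coh_iso :: "'m \<Rightarrow> 'm \<Rightarrow> 'm" where
  "zero_coh_iso f g = (THE h. h \<in> Hom A (coh_ob A f g) (Dom A g) \<and> h \<cdot> coh_quot A f g = coh_ker A g)"

lemma is_kernel_Id:
  assumes "x \<in> Ob A" "b \<in> Ob A"
  shows "is_kernel A (Id A x) (HZero A x b)"
proof (rule kernelI)
  show "monic A (Id A x)" using assms unfolding monic_def by auto
  show "\<exists>l. l \<in> Hom A (Dom A h) (Dom A (Id A x)) \<and> Id A x \<cdot> l = h" if "h \<in> Ar A" "Cod A h = Dom A (HZero A x b)" for h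
    using that assms by (intro exI[of _ h]) auto
qed (use assms in auto)

lemma is_cokernel_Id:
  assumes "x \<in> Ob A" "b \<in> Ob A"
  shows "is_cokernel A (Id A x) (HZero A b x)"
proof (rule cokernelI)
  show "epic A (Id A x)" using assms unfolding epic_def by auto
  show "\<exists>l. l \<in> Ar A \<and> Cod A l = Cod A h \<and> Dom A l = Cod A (Id A x) \<and> l \<cdot> Id A x = h" if "h \<in> Ar A" "Dom A h = Cod A (HZero A b x)" for h
    using that assms by (intro exI[of _ h]) auto
qed (use assms in auto)

context
  fixes a x b assumes ob [simp]: "a \<in> Ob A" "x \<in> Ob A" "b \<in> Ob A"
begin

lemma zero_complex: "complex_at (HZero A a x) (HZero A x b)"
  by (simp add: complex_at_def)

text \<open>The chosen kernel and the chosen quotient are isomorphisms, since identities are also a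
  kernel and a cokernel of zero arrows. The map is the inverse of the quotient followed by the
  kernel.\<close>

lemma zero_coh_iso:
  defines "f \<equiv> HZero A a x" and "g \<equiv> HZero A x b"
  shows "zero_coh_iso f g \<in> Ar A" "Dom A (zero_coh_iso f g) = coh_ob A f g" "Cod A (zero_coh_iso f g) = x"
    "zero_coh_iso f g \<cdot> coh_quot A f g = coh_ker A g" "is_iso A (zero_coh_iso f g)"
proof -
  have c: "complex_at f g" unfolding f_def g_def by (rule zero_complex)
  have g: "g \<in> Ar A" "Dom A g = x" "Cod A f = x" unfolding f_def g_def by auto
  note [simp] = coh_simps[OF c] g coh_lift(1-3)[OF c]
  note k = coh_ker[OF g(1)]
  obtain i where i: "is_iso A i" "Dom A i = Dom A (coh_ker A g)" "Cod A i = x" "coh_ker A g = Id A x \<cdot> i"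
    using kernel_unique[OF is_kernel_Id[OF ob(2,3), folded g_def] k] by auto
  have "Id A x \<cdot> i = i" by (rule Comp_Id_left) (use i(1,3) in \<open>auto simp: is_iso_def\<close>)
  then have ki: "is_iso A (coh_ker A g)" using i(1,4) by (simp only:)
  have l0: "coh_lift A f g = HZero A a (Dom A (coh_ker A g))"
    by (rule monicD[OF kernel_monic[OF k]]) (use coh_lift[OF c] Dom_Ob[of "coh_ker A g"] in \<open>auto simp: f_def\<close>)
  have q: "is_cokernel A (coh_quot A f g) (HZero A a (Dom A (coh_ker A g)))" using coh_quot[OF c] unfolding l0 .
  have K: "Dom A (coh_ker A g) \<in> Ob A" by simp
  obtain j where j: "is_iso A j" "Dom A j = Cod A (Id A (Dom A (coh_ker A g)))" "coh_quot A f g = j \<cdot> Id A (Dom A (coh_ker A g))"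
    using cokernel_unique[OF is_cokernel_Id[OF K ob(1)] q] by blast
  have "j \<cdot> Id A (Dom A (coh_ker A g)) = j" by (rule Comp_Id_right) (use j(1,2) in \<open>auto simp: is_iso_def\<close>)
  then have "is_iso A (coh_quot A f g)" using j(1,3) by (simp only:)
  then obtain r where r: "r \<in> Ar A" "Dom A r = coh_ob A f g" "Cod A r = Dom A (coh_ker A g)"
    "r \<cdot> coh_quot A f g = Id A (Dom A (coh_ker A g))" "coh_quot A f g \<cdot> r = Id A (coh_ob A f g)"
    using is_isoE[of "coh_quot A f g"] by auto
  obtain s where s: "s \<in> Ar A" "Dom A s = x" "Cod A s = Dom A (coh_ker A g)"
    "s \<cdot> coh_ker A g = Id A (Dom A (coh_ker A g))" "coh_ker A g \<cdot> s = Id A x"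
    using is_isoE[OF ki] by auto
  have zc: "zero_coh_iso f g = coh_ker A g \<cdot> r" unfolding zero_coh_iso_def
  proof (rule the_equality)
    show "coh_ker A g \<cdot> r \<in> Hom A (coh_ob A f g) (Dom A g) \<and> (coh_ker A g \<cdot> r) \<cdot> coh_quot A f g = coh_ker A g"
      using r by simp
    fix h assume h: "h \<in> Hom A (coh_ob A f g) (Dom A g) \<and> h \<cdot> coh_quot A f g = coh_ker A g"
    then show "h = coh_ker A g \<cdot> r" using assoc_eq[of h "coh_quot A f g" "coh_ker A g" r] r by simp
  qed
  show "zero_coh_iso f g \<in> Ar A" "Dom A (zero_coh_iso f g) = coh_ob A f g" "Cod A (zero_coh_iso f g) = x"
    "zero_coh_iso f g \<cdot> coh_quot A f g = coh_ker A g"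
    unfolding zc using r by simp_all
  show "is_iso A (zero_coh_iso f g)" unfolding zc
    by (rule is_isoI[of _ "coh_ob A f g" x "coh_quot A f g \<cdot> s"])
      (use r s assoc_eq[OF s(4), of r] assoc_eq[OF r(4), of s] in auto)
qed

lemma zero_complex_mor:
  assumes ob': "a' \<in> Ob A" "x' \<in> Ob A" "b' \<in> Ob A" and m: "m \<in> Hom A x x'"
  shows "complex_mor (HZero A a x) (HZero A x b) (HZero A a' x') (HZero A x' b') m"
  unfolding complex_mor_def
proof (intro conjI)
  show "\<exists>k\<in>Hom A (Dom A (HZero A a x)) (Dom A (HZero A a' x')). m \<cdot> HZero A a x = HZero A a' x' \<cdot> k"
    by (rule bexI[of _ "HZero A a a'"]) (use ob' m in auto)
  show "\<exists>k\<in>Hom A (Cod A (HZero A x b)) (Cod A (HZero A x' b')). k \<cdot> HZero A x b = HZero A x' b' \<cdot> m"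
    by (rule bexI[of _ "HZero A b b'"]) (use ob' m in auto)
qed (use ob' m in auto)

end

text \<open>Tested after the epic quotient, both sides become \<open>m\<close> composed with the
  chosen kernel.\<close>

lemma zero_coh_iso_natural:
  assumes ob: "a \<in> Ob A" "x \<in> Ob A" "b \<in> Ob A" and ob': "a' \<in> Ob A" "x' \<in> Ob A" "b' \<in> Ob A" and m: "m \<in> Hom A x x'"
  shows "m \<cdot> zero_coh_iso (HZero A a x) (HZero A x b) = zero_coh_iso (HZero A a' x') (HZero A x' b') \<cdot>
    coh_map A (HZero A a x) (HZero A x b) (HZero A a' x') (HZero A x' b') m"
proof -
  let ?f = "HZero A a x" and ?g = "HZero A x b" and ?f' = "HZero A a' x'" and ?g' = "HZero A x' b'"
  note c = zero_complex[OF ob] zero_complex[OF ob']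
  note z1 = zero_coh_iso[OF ob] and z2 = zero_coh_iso[OF ob']
  obtain y where y: "y \<in> Hom A (Dom A (coh_ker A ?g)) (Dom A (coh_ker A ?g'))" "coh_ker A ?g' \<cdot> y = m \<cdot> coh_ker A ?g"
    "coh_map A ?f ?g ?f' ?g' m \<in> Hom A (coh_ob A ?f ?g) (coh_ob A ?f' ?g')"
    "coh_map A ?f ?g ?f' ?g' m \<cdot> coh_quot A ?f ?g = coh_quot A ?f' ?g' \<cdot> y"
    using coh_map[OF c zero_complex_mor[OF ob ob' m]] by blast
  note [simp] = coh_simps[OF c(1)] coh_simps[OF c(2)] z1(1-3) z2(1-3) y(1,3)[simplified] m[simplified] ob ob'
  show ?thesis
  proof (rule epicD[OF cokernel_epic[OF coh_quot[OF c(1)]]])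
    have "(zero_coh_iso ?f' ?g' \<cdot> coh_map A ?f ?g ?f' ?g' m) \<cdot> coh_quot A ?f ?g
        = zero_coh_iso ?f' ?g' \<cdot> (coh_quot A ?f' ?g' \<cdot> y)" using y(4) by simp
    also have "\<dots> = m \<cdot> coh_ker A ?g" by (subst assoc_eq[OF z2(4)]) (auto simp: y(2))
    also have "\<dots> = (m \<cdot> zero_coh_iso ?f ?g) \<cdot> coh_quot A ?f ?g" using z1(4) by simp
    finally show "(m \<cdot> zero_coh_iso ?f ?g) \<cdot> coh_quot A ?f ?g =
      (zero_coh_iso ?f' ?g' \<cdot> coh_map A ?f ?g ?f' ?g' m) \<cdot> coh_quot A ?f ?g" ..
  qed auto
qed

end

section \<open>The one-row spectral sequence and its filtration\<close>

locale one_row = abelian_category A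
  for A :: "('o, 'm) pcat" (structure) +
  fixes z :: 'o
  assumes z: "is_zero_object A z"
begin

lemma z_Ob [simp]: "z \<in> Ob A"
  by (rule zero_object_Ob[OF z])

definition row :: "(nat \<Rightarrow> 'o) \<Rightarrow> int \<Rightarrow> int \<Rightarrow> 'o" where
  "row X p q = (if q = 0 \<and> 0 \<le> p then X (nat p) else z)"

definition row_map :: "(nat \<Rightarrow> 'm) \<Rightarrow> int \<Rightarrow> int \<Rightarrow> 'm" where
  "row_map x p q = (if q = 0 \<and> 0 \<le> p then x (nat p) else Id A z)"

text \<open>From page 2 on a differential changes \<open>q\<close>, so one of its ends is off the
  row and it must vanish; hence all pages can be taken equal.\<close>

definition row_ss :: "(nat \<Rightarrow> 'o) \<Rightarrow> ('o, 'm) specseq" where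
  "row_ss X = \<lparr>SE = (\<lambda>r. row X),
    Sd = (\<lambda>r p q. HZero A (row X p q) (row X (p + int r) (q - int r + 1))),
    Si = (\<lambda>r p q. zero_coh_iso (HZero A (row X (p - int r) (q + int r - 1)) (row X p q))
      (HZero A (row X p q) (row X (p + int r) (q - int r + 1))))\<rparr>"

definition row_ss_map :: "(nat \<Rightarrow> 'o) \<Rightarrow> (nat \<Rightarrow> 'o) \<Rightarrow> (nat \<Rightarrow> 'm) \<Rightarrow> ('o, 'm) ss_arrow" where
  "row_ss_map X Y x = \<lparr>MDom = row_ss X, MCod = row_ss Y, MC = (\<lambda>r \<in> {2..}. row_map x)\<rparr>"

text \<open>With only the row \<open>q = 0\<close> present, the filtration in degree
  \<open>n\<close> has its single jump at \<open>p = n\<close>: it is the whole object up to there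
  and zero at \<open>p = n + 1\<close>, and the position \<open>(n, 0)\<close> receives the whole
  quotient.\<close>

definition row_filtration :: "(nat \<Rightarrow> 'o) \<Rightarrow> ('o, 'm) filtration" where
  "row_filtration X = \<lparr>Fob = (\<lambda>n p. if p \<le> n then X n else z),
    Finc = (\<lambda>n p. if p \<le> n then Id A (X n) else HZero A z (X n)),
    Fstep = (\<lambda>n p. if p < n then Id A (X n) else HZero A z (X n)),
    Fproj = (\<lambda>n p. if p = n then Id A (X n) else HZero A (X n) z)\<rparr>"

lemma row_Ob: "(\<And>p. X p \<in> Ob A) \<Longrightarrow> row X p q \<in> Ob A"
  by (simp add: row_def)

lemma row_map_Hom:
  assumes "\<And>p. x p \<in> Hom A (X p) (Y p)"
  shows "row_map x p q \<in> Hom A (row X p q) (row Y p q)"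
  using assms by (auto simp: row_def row_map_def)

lemma row_ss_simps [simp]:
  "SE (row_ss X) r p q = row X p q"
  "Sd (row_ss X) r p q = HZero A (row X p q) (row X (p + int r) (q - int r + 1))"
  "Si (row_ss X) r p q = zero_coh_iso (HZero A (row X (p - int r) (q + int r - 1)) (row X p q))
      (HZero A (row X p q) (row X (p + int r) (q - int r + 1)))"
  by (simp_all add: row_ss_def)

lemma row_spectral_sequence:
  assumes "\<And>p. X p \<in> Ob A"
  shows "spectral_sequence A (row_ss X)"
  unfolding spectral_sequence_def using row_Ob[OF assms] zero_coh_iso by auto

lemma row_first_quadrant: "first_quadrant A (row_ss X)"
  unfolding first_quadrant_def using z by (auto simp: row_def)

text \<open>Compatibility with the structure isomorphisms is the naturality of
  \<open>zero_coh_iso\<close>.\<close>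

lemma row_ss_morphism:
  assumes X: "\<And>p. X p \<in> Ob A" and Y: "\<And>p. Y p \<in> Ob A" and x: "\<And>p. x p \<in> Hom A (X p) (Y p)"
  shows "ss_morphism A (row_ss_map X Y x)"
proof -
  note [simp] = row_Ob[OF X] row_Ob[OF Y] row_map_Hom[OF x, simplified]
  show ?thesis
    unfolding ss_morphism_def Let_def row_ss_map_def
    by (auto simp: row_spectral_sequence X Y zero_coh_iso_natural)
qed

lemma short_exact_Id_zero: "x \<in> Ob A \<Longrightarrow> short_exact A (Id A x) (HZero A x z)"
proof (rule short_exactI)
  assume x: "x \<in> Ob A"
  show "is_kernel A (Id A x) (HZero A x z)" by (rule is_kernel_Id[OF x z_Ob])
  show "is_cokernel A (HZero A x z) (Id A x)"
  proof (rule cokernelI)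
    show "epic A (HZero A x z)"
      by (rule epicI) (use x zero_object_HZero(2)[OF z] in auto)
    show "\<exists>l. l \<in> Ar A \<and> Cod A l = Cod A h \<and> Dom A l = Cod A (HZero A x z) \<and> l \<cdot> HZero A x z = h"
      if "h \<in> Ar A" "Dom A h = Cod A (Id A x)" "h \<cdot> Id A x = HZero A (Dom A (Id A x)) (Cod A h)" for h
      using that x by (intro exI[of _ "HZero A z (Cod A h)"]) auto
  qed (use x in auto)
qed

lemma short_exact_zero_Id: "x \<in> Ob A \<Longrightarrow> short_exact A (HZero A z x) (Id A x)"
proof (rule short_exactI)
  assume x: "x \<in> Ob A"
  show "is_cokernel A (Id A x) (HZero A z x)" by (rule is_cokernel_Id[OF x z_Ob])
  show "is_kernel A (HZero A z x) (Id A x)"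
  proof (rule kernelI)
    show "monic A (HZero A z x)"
      by (rule monicI) (use x zero_object_HZero(1)[OF z] in auto)
    show "\<exists>l. l \<in> Hom A (Dom A h) (Dom A (HZero A z x)) \<and> HZero A z x \<cdot> l = h"
      if "h \<in> Ar A" "Cod A h = Dom A (Id A x)" "Id A x \<cdot> h = HZero A (Dom A h) (Cod A (Id A x))" for h
      using that x by (intro exI[of _ "HZero A (Dom A h) z"]) auto
  qed (use x in auto)
qed

lemma row_converges:
  assumes X: "\<And>p. X p \<in> Ob A"
  shows "converges_to A (row_ss X) X (row_filtration X)"
  unfolding converges_to_def
proof (intro conjI allI impI row_spectral_sequence row_first_quadrant X)
  note [simp] = X
  fix n
  show "is_iso A (Finc (row_filtration X) n 0)" by (simp add: row_filtration_def)
  show "is_zero_object A (Fob (row_filtration X) n (Suc n))" by (simp add: row_filtration_def z)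
  fix p
  show "Finc (row_filtration X) n p \<in> Hom A (Fob (row_filtration X) n p) (X n)"
    by (simp add: row_filtration_def)
  have "monic A (Id A (X n))" by (rule kernel_monic[OF is_kernel_Id[OF X z_Ob]])
  moreover have "monic A (HZero A z (X n))" using short_exact_zero_Id[OF X] by (simp add: short_exact_def)
  ultimately show "monic A (Finc (row_filtration X) n p)" by (simp add: row_filtration_def)
next
  note [simp] = X
  fix n p :: nat assume p: "p \<le> n"
  \<comment> \<open>\<open>n - p\<close> is a subtraction of naturals; under
    \<open>p \<le> n\<close> it vanishes only for \<open>p = n\<close>, the one place where the
    quotient survives.\<close>
  have E: "E_infty (row_ss X) p (n - p) = (if p = n then X n else z)"
    using p by (auto simp: E_infty_def row_def)
  show "Fstep (row_filtration X) n p \<in> Hom A (Fob (row_filtration X) n (Suc p)) (Fob (row_filtration X) n p)"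
    using p by (auto simp: row_filtration_def)
  show "Finc (row_filtration X) n p \<cdot> Fstep (row_filtration X) n p = Finc (row_filtration X) n (Suc p)"
    using p by (auto simp: row_filtration_def)
  show "Fproj (row_filtration X) n p \<in> Hom A (Fob (row_filtration X) n p) (E_infty (row_ss X) p (n - p))"
    unfolding E using p by (auto simp: row_filtration_def)
  show "short_exact A (Fstep (row_filtration X) n p) (Fproj (row_filtration X) n p)"
    using p short_exact_Id_zero[OF X, of n] short_exact_zero_Id[OF X, of n] by (auto simp: row_filtration_def)
qed

lemma row_convergence_compatible:
  assumes X: "\<And>p. X p \<in> Ob A" and Y: "\<And>p. Y p \<in> Ob A" and x: "\<And>p. x p \<in> Hom A (X p) (Y p)"
  shows "convergence_compatible A (row_ss_map X Y x) x (row_filtration X) (row_filtration Y)"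
  unfolding convergence_compatible_def
proof (intro allI impI)
  note [simp] = X Y x[simplified]
  fix n p :: nat assume p: "p \<le> n"
  have E: "E_infty_map (row_ss_map X Y x) p (n - p) = (if p = n then x n else Id A z)"
  proof -
    \<comment> \<open>Components of a morphism are \<open>undefined\<close> below page 2, so the
      bound has to be established before the component can be evaluated.\<close>
    have "stable_page p (n - p) \<in> {2..}" by (simp add: stable_page_def)
    then have "E_infty_map (row_ss_map X Y x) p (n - p) = row_map x (int p) (int (n - p))"
      by (simp add: E_infty_map_def row_ss_map_def)
    then show ?thesis using p by (simp add: row_map_def)
  qed
  \<comment> \<open>Up to \<open>p = n\<close> the filtration is the whole object, so
    \<open>x n\<close> is its own restriction; for \<open>p < n\<close> both projected composites
    end in a zero object.\<close>
  show "\<exists>k\<in>Hom A (Fob (row_filtration X) n p) (Fob (row_filtration Y) n p).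
      Finc (row_filtration Y) n p \<cdot> k = x n \<cdot> Finc (row_filtration X) n p \<and>
      Fproj (row_filtration Y) n p \<cdot> k = E_infty_map (row_ss_map X Y x) p (n - p) \<cdot> Fproj (row_filtration X) n p"
    unfolding E using p by (intro bexI[of _ "x n"]) (simp_all add: row_filtration_def)
qed

definition row_functor :: "('i, 'j, 'y) cat_scheme \<Rightarrow> (nat \<Rightarrow> ('i, 'j, 'o, 'm) functor_data)
    \<Rightarrow> ('i, 'j, ('o, 'm) specseq, ('o, 'm) ss_arrow) functor_data" where
  "row_functor X H = mk_functor X (\<lambda>T. row_ss (\<lambda>p. FO (H p) T))
    (\<lambda>t. row_ss_map (\<lambda>p. FO (H p) (Dom X t)) (\<lambda>p. FO (H p) (Cod X t)) (\<lambda>p. FM (H p) t))"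

lemma row_functor:
  assumes X: "category X" and H: "\<And>p. is_functor X A (H p)"
  shows "is_functor X (SpecSeq A) (row_functor X H)"
  unfolding row_functor_def
proof (rule category.mk_functorI[OF X])
  interpret X: category X by fact
  note [simp] = functor_simps[OF H]
  fix T assume T[simp]: "T \<in> Ob X"
  show "row_ss (\<lambda>p. FO (H p) T) \<in> Ob (SpecSeq A)"
    by (simp add: SpecSeq_def row_spectral_sequence)
  show "row_ss_map (\<lambda>p. FO (H p) (Dom X (Id X T))) (\<lambda>p. FO (H p) (Cod X (Id X T))) (\<lambda>p. FM (H p) (Id X T)) =
      Id (SpecSeq A) (row_ss (\<lambda>p. FO (H p) T))"
    by (auto simp: SpecSeq_def row_ss_map_def row_map_def row_def fun_eq_iff)
next
  interpret X: category X by fact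
  note [simp] = functor_simps[OF H]
  fix t assume t[simp]: "t \<in> Ar X"
  show "row_ss_map (\<lambda>p. FO (H p) (Dom X t)) (\<lambda>p. FO (H p) (Cod X t)) (\<lambda>p. FM (H p) t)
      \<in> Hom (SpecSeq A) (row_ss (\<lambda>p. FO (H p) (Dom X t))) (row_ss (\<lambda>p. FO (H p) (Cod X t)))"
    by (auto simp: SpecSeq_def intro!: row_ss_morphism) (simp_all add: row_ss_map_def)
next
  interpret X: category X by fact
  note [simp] = functor_simps[OF H]
  fix s t assume st[simp]: "s \<in> Ar X" "t \<in> Ar X" "Cod X s = Dom X t"
  show "row_ss_map (\<lambda>p. FO (H p) (Dom X (t \<cdot>\<^bsub>X\<^esub> s))) (\<lambda>p. FO (H p) (Cod X (t \<cdot>\<^bsub>X\<^esub> s))) (\<lambda>p. FM (H p) (t \<cdot>\<^bsub>X\<^esub> s)) =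
      row_ss_map (\<lambda>p. FO (H p) (Dom X t)) (\<lambda>p. FO (H p) (Cod X t)) (\<lambda>p. FM (H p) t) \<cdot>\<^bsub>SpecSeq A\<^esub>
      row_ss_map (\<lambda>p. FO (H p) (Dom X s)) (\<lambda>p. FO (H p) (Cod X s)) (\<lambda>p. FM (H p) s)"
    by (auto simp: SpecSeq_def row_ss_map_def row_map_def fun_eq_iff)
qed

text \<open>An equality of functors, not just an isomorphism, since both sides are
  \<open>undefined\<close> off their source. The bound on \<open>r\<close> keeps clear of the pages
  on which morphisms are \<open>undefined\<close>.\<close>

lemma row_page:
  assumes X: "category X" and H: "\<And>p. is_functor X A (H p)" and r: "r \<ge> 2"
  shows "fcomp X (page A r (int p) (int q)) (row_functor X H) = (if q = 0 then H p else mk_functor X (\<lambda>_. z) (\<lambda>_. Id A z))"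
    (is "?L = ?G")
proof -
  interpret X: category X by fact
  have F: "is_functor X (SpecSeq A) (row_functor X H)" by (rule row_functor[OF X H])
  have FO: "FO (row_functor X H) T = row_ss (\<lambda>p. FO (H p) T)" if "T \<in> Ob X" for T
    using that by (simp add: row_functor_def)
  have FM: "FM (row_functor X H) t = row_ss_map (\<lambda>p. FO (H p) (Dom X t)) (\<lambda>p. FO (H p) (Cod X t)) (\<lambda>p. FM (H p) t)" if "t \<in> Ar X" for t
    using that by (simp add: row_functor_def)
  have L: "FO ?L T = FO ?G T" if "T \<in> Ob X" for T
    using that functor_simps(1)[OF F that] FO[OF that] by (simp add: page_def row_def)
  have L': "FM ?L t = FM ?G t" if "t \<in> Ar X" for t
    using that functor_simps(2)[OF F that] FM[OF that] r by (simp add: page_def row_ss_map_def row_map_def)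
  have G: "is_functor X A ?G" using H by (auto intro: X.mk_functorI)
  have ext: "FO ?L \<in> extensional (Ob X)" "FM ?L \<in> extensional (Ar X)" by (auto simp: fcomp_def)
  have ext': "FO ?G \<in> extensional (Ob X)" "FM ?G \<in> extensional (Ar X)"
    using G unfolding is_functor_def PiE_iff by blast+
  have "FO ?L = FO ?G" by (rule extensionalityI[OF ext(1) ext'(1) L])
  moreover have "FM ?L = FM ?G" by (rule extensionalityI[OF ext(2) ext'(2) L'])
  ultimately show ?thesis by simp
qed

end

text \<open>The spectral sequence and its filtrations are assembled from the cohomology of
  \<open>E\<close>, and only the second page is then identified with the cohomology of
  \<open>B\<close>. The existence part guarantees that the quantification over Kan extensions and
  satellites is not vacuous.\<close>

theorem theorem2p6:
  fixes E B :: "('u, 'u) cat"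
    and u :: "('u, 'u, 'u, 'u) functor_data"
    and A :: "('o, 'm) pcat"
  assumes "infinite (UNIV :: 'u set)"
    and "category E" and "category B" and "is_functor E B u"
    and "abelian_category A"
    and "complete_category TYPE('u) A"
    and "exact_products TYPE('u) A"
  defines "FunE \<equiv> Fun (simplex_cat E) A"
    and "FunB \<equiv> Fun (simplex_cat B) A"
  defines "is_Ran \<equiv>
    is_right_adjoint FunB FunE (precomp (simplex_cat E) (simplex_cat B) A (simplex_functor E u))"
  shows "(\<exists>Ran R \<delta>. is_Ran Ran \<and> right_satellites FunE FunB Ran R \<delta>) \<and>
    (\<forall>Ran R \<delta>. is_Ran Ran \<and> right_satellites FunE FunB Ran R \<delta> \<longrightarrow>
      (\<exists>S \<Phi>.
        is_functor FunE (SpecSeq A) S \<and>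
        (\<forall>p q :: nat. naturally_isomorphic FunE A
          (fcomp FunE (page A 2 (int p) (int q)) S)
          (fcomp FunE (Th_cohomology A B p) (R q))) \<and>
        (\<forall>T \<in> Ob FunE.
          converges_to A (FO S T) (\<lambda>n. FO (Th_cohomology A E n) T) (\<Phi> T)) \<and>
        (\<forall>t \<in> Ar FunE.
          convergence_compatible A (FM S t) (\<lambda>n. FM (Th_cohomology A E n) t)
            (\<Phi> (Dom FunE t)) (\<Phi> (Cod FunE t)))))"
proof -
  interpret A: abelian_category A by fact
  interpret K: fibration_kan "simplex_cat E" "simplex_cat B" "simplex_functor E u" A "TYPE('u)"
    by (rule simplex_fibration_kan) fact+
  obtain z where z: "is_zero_object A z" using A.has_zero_object by blast
  interpret row: one_row A z by unfold_locales (rule z)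
  let ?zB = "mk_functor (simplex_cat B) (\<lambda>_. z) (\<lambda>_. Id A z)"
  have FunE: "category FunE" and FunB: "category FunB"
    unfolding FunE_def FunB_def by (rule K.FD.Fun_category K.FC.Fun_category)+
  show ?thesis
  proof (intro conjI allI impI)
    \<comment> \<open>The explicit model is exact, so the model followed by zero functors is a
      system of satellites.\<close>
    interpret ex: exact_functor FunE FunB K.ran ?zB
      unfolding FunE_def FunB_def by (rule K.exact_functor_R[OF K.ran_functor K.ran_universal z])
    have "is_Ran K.ran" unfolding is_Ran_def FunE_def FunB_def by (rule K.ran_is_right_adjoint)
    then show "\<exists>Ran R \<delta>. is_Ran Ran \<and> right_satellites FunE FunB Ran R \<delta>"
      by (intro exI conjI) (assumption, rule ex.sat_right_satellites)
  next
    fix Ran R \<delta>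
    assume as: "is_Ran Ran \<and> right_satellites FunE FunB Ran R \<delta>"
    then have sat: "right_satellites FunE FunB Ran R \<delta>" by blast
    have Ran: "is_functor FunE FunB Ran" using as unfolding is_Ran_def is_right_adjoint_def by blast
    obtain \<epsilon> where \<epsilon>: "universal_counit FunB FunE K.W Ran \<epsilon>"
      using right_adjoint_counit[OF FunB FunE] as unfolding is_Ran_def by blast
    have d: "delta_functor FunE FunB R \<delta>" and R0: "R 0 = Ran"
      using sat unfolding right_satellites_def by (rule conjunct1, rule conjunct1[OF conjunct2])
    have R: "is_functor FunE FunB (R q)" for q
      using d unfolding delta_functor_def additive_functor_def by blast
    \<comment> \<open>The given \<open>Ran\<close> is exact by way of its own counit, so its
      satellites vanish in positive degrees.\<close>
    interpret ex: exact_functor FunE FunB Ran ?zB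
      unfolding FunE_def FunB_def by (rule K.exact_functor_R[OF Ran[unfolded FunE_def FunB_def] \<epsilon>[unfolded FunE_def FunB_def] z])
    interpret TR: thomason_ran A E B u Ran \<epsilon>
      by unfold_locales (use assms Ran \<epsilon> in \<open>simp_all add: FunE_def FunB_def\<close>)
    let ?H = "Th_cohomology A E"
    have H: "is_functor FunE A (?H p)" for p unfolding FunE_def by (rule TR.E.Th_cohomology_functor)
    have HO: "FO (?H p) T \<in> Ob A" if "T \<in> Ob FunE" for p T by (rule functor_simps(1)[OF H that])
    let ?S = "row.row_functor FunE ?H"
    let ?\<Phi> = "\<lambda>T. row.row_filtration (\<lambda>p. FO (?H p) T)"
    \<comment> \<open>By \<open>row_page\<close> the left side is the cohomology of \<open>E\<close>
      for \<open>q = 0\<close> and constantly \<open>z\<close> otherwise. In row 0 the satellite is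
      \<open>Ran\<close> and the comparison of cochains applies; in the other rows both functors
      take zero objects as values.\<close>
    have "naturally_isomorphic FunE A (fcomp FunE (page A 2 (int p) (int q)) ?S) (fcomp FunE (Th_cohomology A B p) (R q))" for p q
    unfolding row.row_page[OF FunE H order_refl]
    proof (cases "q = 0")
      case True
      then show "naturally_isomorphic FunE A (if q = 0 then ?H p else mk_functor FunE (\<lambda>_. z) (\<lambda>_. Id A z))
          (fcomp FunE (Th_cohomology A B p) (R q))"
        using TR.cohomology_ran_iso[of p, folded FunE_def] by (simp add: R0)
    next
      case False
      have HR: "is_functor FunE A (fcomp FunE (Th_cohomology A B p) (R q))"
        by (rule category.fcomp_functor[OF FunE R]) (simp add: FunB_def TR.B.Th_cohomology_functor)
      have "is_zero_object A (FO (fcomp FunE (Th_cohomology A B p) (R q)) T)" if T: "T \<in> Ob FunE" for T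
      proof -
        have RT: "is_functor (simplex_cat B) A (FO (R q) T)"
          using functor_simps(1)[OF R T] by (simp add: FunB_def Fun_Ob)
        have zR: "is_zero_object FunB (FO (R q) T)" by (rule ex.satellites_zero[OF sat _ T]) (use False in simp)
        have "is_zero_object A (FO (FO (R q) T) (p, f))" if "f \<in> simplices B p" for f
          by (rule K.FC.Fun_zero_objectD[OF zR[unfolded FunB_def]]) (simp add: that)
        then show ?thesis using T TR.B.Th_cohomology_zero[OF RT] by simp
      qed
      moreover have "is_functor FunE A (mk_functor FunE (\<lambda>_. z) (\<lambda>_. Id A z))"
        by (rule category.mk_functorI[OF FunE]) auto
      ultimately have "naturally_isomorphic FunE A (mk_functor FunE (\<lambda>_. z) (\<lambda>_. Id A z))
          (fcomp FunE (Th_cohomology A B p) (R q))"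
        using z by (intro A.naturally_isomorphic_zero[OF FunE _ HR]) simp_all
      then show "naturally_isomorphic FunE A (if q = 0 then ?H p else mk_functor FunE (\<lambda>_. z) (\<lambda>_. Id A z))
          (fcomp FunE (Th_cohomology A B p) (R q))"
        using False by simp
    qed
    moreover have "is_functor FunE (SpecSeq A) ?S" by (rule row.row_functor[OF FunE H])
    moreover have "\<forall>T \<in> Ob FunE. converges_to A (FO ?S T) (\<lambda>n. FO (?H n) T) (?\<Phi> T)"
      by (auto simp: row.row_functor_def intro!: row.row_converges HO)
    moreover have "\<forall>t \<in> Ar FunE. convergence_compatible A (FM ?S t) (\<lambda>n. FM (?H n) t) (?\<Phi> (Dom FunE t)) (?\<Phi> (Cod FunE t))"
      using functor_simps(2-4)[OF H] HO category.Dom_Ob[OF FunE] category.Cod_Ob[OF FunE]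
      by (auto simp: row.row_functor_def intro!: row.row_convergence_compatible)
    ultimately show "\<exists>S \<Phi>. is_functor FunE (SpecSeq A) S \<and>
        (\<forall>p q :: nat. naturally_isomorphic FunE A (fcomp FunE (page A 2 (int p) (int q)) S)
          (fcomp FunE (Th_cohomology A B p) (R q))) \<and>
        (\<forall>T \<in> Ob FunE. converges_to A (FO S T) (\<lambda>n. FO (Th_cohomology A E n) T) (\<Phi> T)) \<and>
        (\<forall>t \<in> Ar FunE. convergence_compatible A (FM S t) (\<lambda>n. FM (Th_cohomology A E n) t)
            (\<Phi> (Dom FunE t)) (\<Phi> (Cod FunE t)))"
      by (intro exI[of _ ?S] exI[of _ ?\<Phi>]) blast
  qed
qed

end
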